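(* Let $(\Sigma_1,\Sigma_2,\Sigma_3)$ be an admissible triple in $\mathbb{R}^n$ with parameters $(\beta,b,\theta,R)$ (see context), and assume that $$\theta\leq |d(\sigma_1,\sigma_2,\sigma_3)|\leq 2\theta\qquad\text{for all }\sigma_i\in\Sigma_i,\ i=1,2,3.$$ Suppose that, for some constant $C$, the estimate $$\|f\ast g\|_{L^2(\Sigma_3)}\leq C\,\theta^{-\frac12}\|f\|_{L^2(\Sigma_1)}\|g\|_{L^2(\Sigma_2)}$$ holds for all $f\in L^2(\Sigma_1)$, $g\in L^2(\Sigma_2)$. Let $T:\mathbb{R}^n\to\mathbb{R}^n$ be an invertible linear map and set $\Sigma_i'=T\Sigma_i$ for $i=1,2,3$. Then $$\|f'\ast g'\|_{L^2(\Sigma_3')}\leq 2C\,{\theta'}^{-\frac12}\|f'\|_{L^2(\Sigma_1')}\|g'\|_{L^2(\Sigma_2')}$$ for all $f'\in L^2(\Sigma_1')$, $g'\in L^2(\Sigma_2')$, where $$\theta'=\inf_{\sigma_i'\in\Sigma_i'}|d'(\sigma_1',\sigma_2',\sigma_3')|$$ and $d'(\sigma_1',\sigma_2',\sigma_3')$ is the determinant formed as $d$, but from orthonormal bases of the normal spaces $N_{\sigma_i'}(\Sigma_i')$.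
   Context: Admissible triple. Let $0<\beta\le1$, $b>0$, $\theta>0$, $R>0$, and $m_1,m_2,m_3\in\mathbb{N}$ with $n=m_1+m_2+m_3$; put $n_i=n-m_i$. A triple $(\Sigma_1,\Sigma_2,\Sigma_3)$ of subsets of $\mathbb{R}^n$ is called admissible with parameters $(\beta,b,\theta,R)$ if, for some such $m_1,m_2,m_3$: (i) (regularity) for every $i=1,2,3$ there are an open set $U_i\subset\mathbb{R}^{n_i}$ and $\phi_i\in C^{1,\beta}(U_i;\mathbb{R}^{m_i})$ with $$R^{-\beta}\sup_{x\in U_i}|D\phi_i(x)|+\sup_{x,x'\in U_i}\frac{|D\phi_i(x)-D\phi_i(x')|}{|x-x'|^\beta}\le b,$$ such that $\Sigma_i$ is relatively open and compactly contained in $G_i\,\mathrm{graph}(\phi_i)$ for some orthogonal transformation $G_i\in O(n)$, where $\mathrm{graph}(\phi_i)=\{(x,\phi_i(x))^t\in\mathbb{R}^n:x\in U_i\}$; (ii) (transversality) for $\sigma_i\in\Sigma_i$, let $d(\sigma_1,\sigma_2,\sigma_3)$ be the determinant of the $n\times n$ matrix whose columns are, in order, the vectors of an orthonormal basis of the ($m_1$-dimensional) normal space $N_{\sigma_1}(\Sigma_1)$, of an orthonormal basis of $N_{\sigma_2}(\Sigma_2)$, and of an orthonormal basis of $N_{\sigma_3}(\Sigma_3)$ (the absolute value $|d|$ does not depend on the chosen orthonormal bases); then $\inf_{\sigma_1,\sigma_2,\sigma_3}|d(\sigma_1,\sigma_2,\sigma_3)|=\theta$; (iii) (size) $\mathrm{diam}(\Sigma_i)\le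 R$ for $i=1,2,3$. Convolution. $L^2(\Sigma_i)=L^2(\Sigma_i,\mu_i)$, where $\mu_i$ is the $n_i$-dimensional Hausdorff measure; $f\in L^2(\Sigma_i)$ is identified with the distribution $\psi\mapsto\int_{\Sigma_i}f\psi\,d\mu_i$. For compactly supported $f\in L^2(\Sigma_1)$, $g\in L^2(\Sigma_2)$, $f\ast g$ is the distribution $$\langle f\ast g,\psi\rangle=\int_{\Sigma_1}\int_{\Sigma_2}f(x)g(y)\psi(x+y)\,d\mu_1(x)\,d\mu_2(y),\quad\psi\in C_0^\infty(\mathbb{R}^n).$$ For $f\in C_0(\Sigma_1)$, $g\in C_0(\Sigma_2)$ (continuous with compact support) one has $f\ast g\in C_0(\mathbb{R}^n)$, so $f\ast g$ has a well-defined trace on $\Sigma_3$. For general $f\in L^2(\Sigma_1)$, $g\in L^2(\Sigma_2)$ the trace of $f\ast g$ on $\Sigma_3$ is defined by density, once an $L^2$-bound is established for continuous compactly supported functions. The same conventions apply to $\Sigma_1',\Sigma_2',\Sigma_3'$. *)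

theory Defs
  imports "HOL-Analysis.Analysis"
begin

section \<open>Hausdorff measure\<close>

text \<open>Normalised so that the \<open>k\<close>-dimensional measure of the unit ball in \<open>k\<close>-space is its volume.
  The case distinction only matters for \<open>k = 0\<close>, where \<open>0 ^ 0 = 1\<close>.\<close>

definition hausdorff_premeasure :: "nat \<Rightarrow> real \<Rightarrow> 'a::metric_space set \<Rightarrow> ennreal" where
  "hausdorff_premeasure k \<delta> A =
     (INF E \<in> {E :: nat \<Rightarrow> 'a set. A \<subseteq> (\<Union>j. E j) \<and> (\<forall>j. bounded (E j) \<and> diameter (E j) \<le> \<delta>)}.
        \<Sum>j. if E j = {} then 0 else ennreal (unit_ball_vol (real k) * (diameter (E j) / 2) ^ k))"

definition hausdorff_outer_measure :: "nat \<Rightarrow> 'a::metric_space set \<Rightarrow> ennreal" where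
  "hausdorff_outer_measure k A = (SUP \<delta>\<in>{0<..}. hausdorff_premeasure k \<delta> A)"

definition hausdorff_measure :: "nat \<Rightarrow> 'a::metric_space measure" where
  "hausdorff_measure k = measure_of UNIV (sets borel) (hausdorff_outer_measure k)"

definition surface_measure :: "nat \<Rightarrow> 'a::metric_space set \<Rightarrow> 'a measure" where
  "surface_measure k S = restrict_space (hausdorff_measure k) S"


section \<open>Tangent and normal spaces\<close>

text \<open>Velocities of curves in \<open>S\<close> through \<open>x\<close>; for a \<open>C\<^sup>1\<close> submanifold this is the usual tangent space.\<close>

definition tangent_space :: "'a::euclidean_space set \<Rightarrow> 'a \<Rightarrow> 'a set" where
  "tangent_space S x =
     {v. \<exists>\<gamma> \<epsilon>. \<epsilon> > 0 \<and> \<gamma> 0 = x \<and> (\<forall>t::real. \<bar>t\<bar> < \<epsilon> \<longrightarrow> \<gamma> t \<in> S) \<and> (\<gamma> has_vector_derivative v) (at 0)}"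

definition normal_space :: "'a::euclidean_space set \<Rightarrow> 'a \<Rightarrow> 'a set" where
  "normal_space S x = orthogonal_comp (tangent_space S x)"

definition is_orthonormal_basis :: "('m::finite \<Rightarrow> 'a::euclidean_space) \<Rightarrow> 'a set \<Rightarrow> bool" where
  "is_orthonormal_basis B N \<longleftrightarrow> (\<forall>i j. B i \<bullet> B j = (if i = j then 1 else 0)) \<and> span (range B) = N"


section \<open>Admissible triples\<close>

text \<open>The dimensions are carried by the index types: \<open>m\<^sub>i\<close> is the cardinality of the \<open>i\<close>-th index type,
  the ambient space of dimension \<open>n = m\<^sub>1 + m\<^sub>2 + m\<^sub>3\<close> is indexed by the sum type, and
  \<open>n\<^sub>i = n - m\<^sub>i\<close> is the cardinality of the sum of the two other types.\<close>

text \<open>Matrix whose columns are, in order, the vectors of \<open>B1\<close>, \<open>B2\<close>, \<open>B3\<close>.\<close>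

definition columns_matrix ::
  "('m1 \<Rightarrow> real^('m1 + 'm2 + 'm3)) \<Rightarrow> ('m2 \<Rightarrow> real^('m1 + 'm2 + 'm3)) \<Rightarrow> ('m3 \<Rightarrow> real^('m1 + 'm2 + 'm3))
    \<Rightarrow> real^('m1::finite + 'm2::finite + 'm3::finite)^('m1 + 'm2 + 'm3)" where
  "columns_matrix B1 B2 B3 =
     (\<chi> i j. (case j of Inl a \<Rightarrow> B1 a | Inr (Inl b) \<Rightarrow> B2 b | Inr (Inr c) \<Rightarrow> B3 c) $ i)"

text \<open>The orthonormal bases are chosen arbitrarily, so only the absolute value is meaningful.\<close>

definition normal_det ::
  "(real^('m1::finite + 'm2::finite + 'm3::finite)) set \<Rightarrow> (real^('m1 + 'm2 + 'm3)) set \<Rightarrow> (real^('m1 + 'm2 + 'm3)) set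
    \<Rightarrow> real^('m1 + 'm2 + 'm3) \<Rightarrow> real^('m1 + 'm2 + 'm3) \<Rightarrow> real^('m1 + 'm2 + 'm3) \<Rightarrow> real" where
  "normal_det S1 S2 S3 x1 x2 x3 =
     det (columns_matrix
       (SOME B :: 'm1 \<Rightarrow> _. is_orthonormal_basis B (normal_space S1 x1))
       (SOME B :: 'm2 \<Rightarrow> _. is_orthonormal_basis B (normal_space S2 x2))
       (SOME B :: 'm3 \<Rightarrow> _. is_orthonormal_basis B (normal_space S3 x3)))"

definition transversality_const ::
  "(real^('m1::finite + 'm2::finite + 'm3::finite)) set \<Rightarrow> (real^('m1 + 'm2 + 'm3)) set \<Rightarrow> (real^('m1 + 'm2 + 'm3)) set \<Rightarrow> real" where
  "transversality_const S1 S2 S3 =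
     (INF (x1, x2, x3) \<in> S1 \<times> S2 \<times> S3. \<bar>normal_det S1 S2 S3 x1 x2 x3\<bar>)"

text \<open>The bijection \<open>e\<close> identifies the product of a \<open>k\<close>- and an \<open>m\<close>-dimensional coordinate space with
  \<open>n\<close>-space. Different \<open>e\<close> differ by a permutation of coordinates, which is orthogonal.\<close>

definition graph_of ::
  "('n \<Rightarrow> 'k + 'm) \<Rightarrow> (real^'k::finite) set \<Rightarrow> (real^'k \<Rightarrow> real^'m::finite) \<Rightarrow> (real^'n::finite) set" where
  "graph_of e U \<phi> = (\<lambda>x. \<chi> j. case e j of Inl a \<Rightarrow> x $ a | Inr c \<Rightarrow> \<phi> x $ c) ` U"

text \<open>Suprema are taken in the extended nonnegative reals, so that finiteness is part of the bound.\<close>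

definition C1_hoelder_bound ::
  "real \<Rightarrow> real \<Rightarrow> real \<Rightarrow> (real^'k::finite) set \<Rightarrow> (real^'k \<Rightarrow> real^'m::finite) \<Rightarrow> bool" where
  "C1_hoelder_bound \<beta> b R U \<phi> \<longleftrightarrow>
     (\<exists>D :: real^'k \<Rightarrow> (real^'k) \<Rightarrow>\<^sub>L (real^'m).
        (\<forall>x\<in>U. (\<phi> has_derivative blinfun_apply (D x)) (at x)) \<and>
        ennreal (R powr (- \<beta>)) * (SUP x\<in>U. ennreal (norm (D x)))
          + (SUP x\<in>U. SUP x'\<in>U - {x}. ennreal (norm (D x - D x') / norm (x - x') powr \<beta>))
        \<le> ennreal b)"

definition regular_piece ::
  "real \<Rightarrow> real \<Rightarrow> real \<Rightarrow> (real^'k::finite) set \<Rightarrow> (real^'k \<Rightarrow> real^'m::finite) \<Rightarrow> (real^'n::finite) set \<Rightarrow> bool" where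
  "regular_piece \<beta> b R U \<phi> S \<longleftrightarrow>
     open U \<and> C1_hoelder_bound \<beta> b R U \<phi> \<and>
     (\<exists>(e :: 'n \<Rightarrow> 'k + 'm) G. bij e \<and> orthogonal_transformation G \<and>
        openin (top_of_set (G ` graph_of e U \<phi>)) S \<and>
        compact (closure S) \<and> closure S \<subseteq> G ` graph_of e U \<phi>)"

text \<open>Nonemptiness is part of transversality: the infimum over the empty set is infinite by convention
  and hence not equal to \<open>\<theta>\<close>, whereas \<open>INF\<close> over the empty set of reals is unspecified.\<close>

definition admissible ::
  "real \<Rightarrow> real \<Rightarrow> real \<Rightarrow> real \<Rightarrow> (real^('m1::finite + 'm2::finite + 'm3::finite)) set
    \<Rightarrow> (real^('m1 + 'm2 + 'm3)) set \<Rightarrow> (real^('m1 + 'm2 + 'm3)) set \<Rightarrow> bool" where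
  "admissible \<beta> b \<theta> R S1 S2 S3 \<longleftrightarrow>
     0 < \<beta> \<and> \<beta> \<le> 1 \<and> 0 < b \<and> 0 < \<theta> \<and> 0 < R \<and>
     (\<exists>U (\<phi> :: real^('m2 + 'm3) \<Rightarrow> real^'m1). regular_piece \<beta> b R U \<phi> S1) \<and>
     (\<exists>U (\<phi> :: real^('m1 + 'm3) \<Rightarrow> real^'m2). regular_piece \<beta> b R U \<phi> S2) \<and>
     (\<exists>U (\<phi> :: real^('m1 + 'm2) \<Rightarrow> real^'m3). regular_piece \<beta> b R U \<phi> S3) \<and>
     S1 \<noteq> {} \<and> S2 \<noteq> {} \<and> S3 \<noteq> {} \<and> transversality_const S1 S2 S3 = \<theta> \<and>
     diameter S1 \<le> R \<and> diameter S2 \<le> R \<and> diameter S3 \<le> R"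


section \<open>Convolution and its trace\<close>

definition L2 :: "'a measure \<Rightarrow> ('a \<Rightarrow> complex) set" where
  "L2 M = {f \<in> borel_measurable M. integrable M (\<lambda>x. (cmod (f x))\<^sup>2)}"

definition L2_norm :: "'a measure \<Rightarrow> ('a \<Rightarrow> complex) \<Rightarrow> real" where
  "L2_norm M f = sqrt (\<integral>x. (cmod (f x))\<^sup>2 \<partial>M)"

definition C0 :: "'a::topological_space set \<Rightarrow> ('a \<Rightarrow> complex) set" where
  "C0 S = {f. continuous_on S f \<and> (\<exists>K. compact K \<and> K \<subseteq> S \<and> (\<forall>x\<in>S - K. f x = 0))}"

primrec C_k :: "nat \<Rightarrow> ('a::euclidean_space \<Rightarrow> complex) \<Rightarrow> bool" where
  "C_k 0 f \<longleftrightarrow> continuous_on UNIV f"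
| "C_k (Suc k) f \<longleftrightarrow> (\<forall>x. f differentiable (at x)) \<and> (\<forall>v\<in>Basis. C_k k (\<lambda>x. frechet_derivative f (at x) v))"

definition test_functions :: "('a::euclidean_space \<Rightarrow> complex) set" where
  "test_functions = {\<psi> \<in> C0 UNIV. \<forall>k. C_k k \<psi>}"

text \<open>The distribution \<open>f * g\<close> is given by the function \<open>h \<in> C\<^sub>0\<close> (which is then unique).\<close>

definition conv_represented_by ::
  "'a::euclidean_space measure \<Rightarrow> 'a measure \<Rightarrow> ('a \<Rightarrow> complex) \<Rightarrow> ('a \<Rightarrow> complex) \<Rightarrow> ('a \<Rightarrow> complex) \<Rightarrow> bool" where
  "conv_represented_by M1 M2 f g h \<longleftrightarrow>
     h \<in> C0 UNIV \<and>
     (\<forall>\<psi>\<in>test_functions.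
        (\<integral>z. h z * \<psi> z \<partial>lborel) = (\<integral>y. (\<integral>x. f x * g y * \<psi> (x + y) \<partial>M1) \<partial>M2))"

text \<open>\<open>t\<close> is the trace of \<open>f * g\<close>, defined by density: for all approximations of \<open>f\<close>, \<open>g\<close> in \<open>L\<^sup>2\<close> by
  continuous compactly supported functions, the restrictions of the (continuous) convolutions
  converge to \<open>t\<close> in \<open>L\<^sup>2\<close> of the third surface. The underlying surfaces are the spaces of
  the measures.\<close>

definition is_conv_trace ::
  "'a::euclidean_space measure \<Rightarrow> 'a measure \<Rightarrow> 'a measure
    \<Rightarrow> ('a \<Rightarrow> complex) \<Rightarrow> ('a \<Rightarrow> complex) \<Rightarrow> ('a \<Rightarrow> complex) \<Rightarrow> bool" where
  "is_conv_trace M1 M2 M3 f g t \<longleftrightarrow>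
     t \<in> L2 M3 \<and>
     (\<forall>F G. (\<forall>k. F k \<in> C0 (space M1)) \<and> (\<forall>k. G k \<in> C0 (space M2)) \<and>
        (\<lambda>k. L2_norm M1 (\<lambda>x. F k x - f x)) \<longlonglongrightarrow> 0 \<and> (\<lambda>k. L2_norm M2 (\<lambda>y. G k y - g y)) \<longlonglongrightarrow> 0 \<longrightarrow>
        (\<exists>H. (\<forall>k. conv_represented_by M1 M2 (F k) (G k) (H k)) \<and>
             (\<lambda>k. L2_norm M3 (\<lambda>z. H k z - t z)) \<longlonglongrightarrow> 0))"

text \<open>For all \<open>f\<close>, \<open>g\<close> in \<open>L\<^sup>2\<close>, the trace of \<open>f * g\<close> exists and its \<open>L\<^sup>2\<close> norm is at most
  \<open>K\<close> times the product of the norms of \<open>f\<close> and \<open>g\<close>.\<close>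

definition L2_conv_estimate ::
  "(real^('m1::finite + 'm2::finite + 'm3::finite)) set \<Rightarrow> (real^('m1 + 'm2 + 'm3)) set
    \<Rightarrow> (real^('m1 + 'm2 + 'm3)) set \<Rightarrow> real \<Rightarrow> bool" where
  "L2_conv_estimate S1 S2 S3 K \<longleftrightarrow>
     (let M1 = surface_measure (CARD('m2) + CARD('m3)) S1;
          M2 = surface_measure (CARD('m1) + CARD('m3)) S2;
          M3 = surface_measure (CARD('m1) + CARD('m2)) S3
      in \<forall>f\<in>L2 M1. \<forall>g\<in>L2 M2. \<exists>t. is_conv_trace M1 M2 M3 f g t \<and>
           L2_norm M3 t \<le> K * L2_norm M1 f * L2_norm M2 g)"

end

theory Submission
  imports Defs
begin

text \<open>
  The estimate is transported along \<open>T\<close> by a change of variables. Write \<open>\<mu>\<^sub>i\<close> and \<open>\<mu>\<^sub>i'\<close> for the surface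
  measures of \<open>\<Sigma>\<^sub>i\<close> and \<open>\<Sigma>\<^sub>i' = T \<Sigma>\<^sub>i\<close>, and let \<open>J\<^sub>i(\<sigma>)\<close> be the factor by which \<open>T\<close> changes
  \<open>n\<^sub>i\<close>-dimensional volume on the tangent space of \<open>\<Sigma>\<^sub>i\<close> at \<open>\<sigma>\<close>. Then \<open>\<mu>\<^sub>i'\<close> is the image under \<open>T\<close> of
  \<open>J\<^sub>i \<mu>\<^sub>i\<close>. Given \<open>f'\<close> and \<open>g'\<close>, put \<open>f = J\<^sub>1 (f' \<circ> T)\<close> and \<open>g = J\<^sub>2 (g' \<circ> T)\<close>. The defining integrals show
  that \<open>(f' * g') \<circ> T = \<bar>det T\<bar>\<^sup>-\<^sup>1 (f * g)\<close>, while
  \<open>\<parallel>f\<parallel>\<^sup>2 \<le> sup J\<^sub>1 \<parallel>f'\<parallel>\<^sup>2\<close>, \<open>\<parallel>g\<parallel>\<^sup>2 \<le> sup J\<^sub>2 \<parallel>g'\<parallel>\<^sup>2\<close> and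
  \<open>\<parallel>h \<circ> T\<^sup>-\<^sup>1\<parallel>\<^sup>2 \<le> sup J\<^sub>3 \<parallel>h\<parallel>\<^sup>2\<close>. The estimate for the original triple therefore implies the one for the image with
  the constant multiplied by \<open>\<bar>det T\<bar>\<^sup>-\<^sup>1 (sup J\<^sub>1 sup J\<^sub>2 sup J\<^sub>3)\<^sup>1\<^sup>/\<^sup>2\<close>.

  What makes this factor harmless is the pointwise identity \<open>J\<^sub>1 J\<^sub>2 J\<^sub>3 \<bar>d'\<bar> = (det T)\<^sup>2 \<bar>d\<bar>\<close>. It holds because
  normal spaces are mapped by the inverse transpose \<open>S\<close> of \<open>T\<close>: if \<open>A\<^sub>i\<close> is the matrix of \<open>S\<close> between orthonormal bases of
  the normal spaces of \<open>\<Sigma>\<^sub>i\<close> and \<open>\<Sigma>\<^sub>i'\<close>, then \<open>J\<^sub>i = \<bar>det T\<bar> \<bar>det A\<^sub>i\<bar>\<close> (lemma \<open>normal_jacobian\<close>), whereas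
  \<open>\<bar>d\<bar> / \<bar>det T\<bar> = \<bar>d'\<bar> \<bar>det A\<^sub>1\<bar> \<bar>det A\<^sub>2\<bar> \<bar>det A\<^sub>3\<bar>\<close> (lemma \<open>columns_matrix_change_of_basis\<close>). Since \<open>\<bar>d\<bar> \<le> 2\<theta>\<close> and
  \<open>\<bar>d'\<bar> \<ge> \<theta>'\<close>, the product \<open>J\<^sub>1(\<sigma>\<^sub>1) J\<^sub>2(\<sigma>\<^sub>2) J\<^sub>3(\<sigma>\<^sub>3)\<close> never exceeds \<open>2 (det T)\<^sup>2 \<theta> / \<theta>'\<close>; the three points
  vary independently, so the same bound holds for the product of the suprema. The constant obtained is
  \<open>\<surd>2 C \<theta>'\<^sup>-\<^sup>1\<^sup>/\<^sup>2\<close>, which is at most \<open>2 C \<theta>'\<^sup>-\<^sup>1\<^sup>/\<^sup>2\<close> when \<open>C \<ge> 0\<close>.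

  The analytic core is the formula for \<open>\<mu>\<^sub>i'\<close> (lemma \<open>surface_measure_linear_image\<close>). On \<open>k\<close>-space the Hausdorff
  measure is translation invariant and locally finite, hence a constant multiple of Lebesgue measure, so an injective linear
  map multiplies it by the square root of its Gram determinant. A \<open>C\<^sup>1\<close> parametrisation agrees near a point with its
  linearisation up to a bi-Lipschitz map with constant near \<open>1\<close>, and Lipschitz maps control Hausdorff measure.
  Hence the ratio of \<open>\<mu>\<^sub>i'(T A)\<close> to \<open>\<mu>\<^sub>i(A)\<close> is nearly \<open>J\<^sub>i\<close> for small \<open>A\<close>, and a countable partition turns this
  into an identity of measures.
\<close>

section \<open>Hausdorff measure is a Borel measure\<close>

text \<open>The summand in the Hausdorff premeasure. It vanishes on the empty set also for \<open>k = 0\<close>, where the volume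
  formula would give \<open>1\<close>.\<close>

definition hausdorff_gauge :: "nat \<Rightarrow> 'a::metric_space set \<Rightarrow> ennreal" where
  "hausdorff_gauge k E = (if E = {} then 0 else ennreal (unit_ball_vol (real k) * (diameter E / 2) ^ k))"

lemma hausdorff_gauge_empty [simp]: "hausdorff_gauge k {} = 0"
  by (simp add: hausdorff_gauge_def)

definition fine_cover :: "real \<Rightarrow> 'a::metric_space set \<Rightarrow> (nat \<Rightarrow> 'a set) \<Rightarrow> bool" where
  "fine_cover \<delta> A E \<longleftrightarrow> A \<subseteq> (\<Union>j. E j) \<and> (\<forall>j. bounded (E j) \<and> diameter (E j) \<le> \<delta>)"

lemma hausdorff_premeasure_alt:
  "hausdorff_premeasure k \<delta> A = (INF E \<in> Collect (fine_cover \<delta> A). \<Sum>j. hausdorff_gauge k (E j))"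
  unfolding hausdorff_premeasure_def fine_cover_def hausdorff_gauge_def ..

lemma hausdorff_premeasure_le:
  "fine_cover \<delta> A E \<Longrightarrow> hausdorff_premeasure k \<delta> A \<le> (\<Sum>j. hausdorff_gauge k (E j))"
  unfolding hausdorff_premeasure_alt by (rule INF_lower) simp

lemma hausdorff_premeasure_mono:
  assumes "A \<subseteq> B" "\<delta> \<le> \<epsilon>"
  shows "hausdorff_premeasure k \<epsilon> A \<le> hausdorff_premeasure k \<delta> B"
proof -
  have "fine_cover \<delta> B E \<Longrightarrow> fine_cover \<epsilon> A E" for E
    using assms unfolding fine_cover_def by (meson order_trans)
  then show ?thesis
    unfolding hausdorff_premeasure_alt by (intro INF_superset_mono) auto
qed

lemma hausdorff_premeasure_empty: "\<delta> \<ge> 0 \<Longrightarrow> hausdorff_premeasure k \<delta> {} = 0"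
  using hausdorff_premeasure_le[of \<delta> "{}" "\<lambda>_. {}" k] by (simp add: fine_cover_def)

lemma hausdorff_premeasure_le_gauge:
  assumes "bounded A" "diameter A \<le> \<delta>" "0 \<le> \<delta>"
  shows "hausdorff_premeasure k \<delta> A \<le> hausdorff_gauge k A"
proof -
  have "fine_cover \<delta> A (\<lambda>j. if j = 0 then A else {})"
    using assms by (auto simp: fine_cover_def split: if_splits)
  from hausdorff_premeasure_le[OF this, of k]
  have "hausdorff_premeasure k \<delta> A \<le> (\<Sum>j. hausdorff_gauge k (if j = 0 then A else {}))" .
  also have "\<dots> = (\<Sum>j\<in>{0::nat}. hausdorff_gauge k (if j = 0 then A else {}))"
    by (rule suminf_finite) auto
  finally show ?thesis by simp
qed

text \<open>Covers of the single sets that are optimal up to \<open>e / 2\<^sup>n\<^sup>+\<^sup>1\<close> are enumerated together along a pairing of the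
  natural numbers.\<close>

lemma hausdorff_premeasure_countable_subadditive:
  "hausdorff_premeasure k \<delta> (\<Union>i. A i) \<le> (\<Sum>i::nat. hausdorff_premeasure k \<delta> (A i))"
proof (rule ennreal_le_epsilon)
  fix e :: real assume e: "0 < e" and fin: "(\<Sum>i. hausdorff_premeasure k \<delta> (A i)) < top"
  have "\<exists>E. fine_cover \<delta> (A n) E \<and>
      (\<Sum>j. hausdorff_gauge k (E j)) \<le> hausdorff_premeasure k \<delta> (A n) + e * (1/2)^Suc n" for n
  proof -
    have "hausdorff_premeasure k \<delta> (A n) < hausdorff_premeasure k \<delta> (A n) + e * (1/2)^Suc n"
      using fin e by (auto simp add: less_top dest!: ennreal_suminf_lessD)
    then show ?thesis
      by (subst (asm) (1) hausdorff_premeasure_alt) (auto simp: INF_less_iff intro: less_imp_le)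
  qed
  then obtain E where E: "\<And>n. fine_cover \<delta> (A n) (E n)"
    and le: "\<And>n. (\<Sum>j. hausdorff_gauge k (E n j)) \<le> hausdorff_premeasure k \<delta> (A n) + e * (1/2)^Suc n"
    by metis
  define F where "F = case_prod E \<circ> prod_decode"
  have "fine_cover \<delta> (\<Union>i. A i) F"
    unfolding fine_cover_def
  proof (intro conjI allI)
    show "(\<Union>i. A i) \<subseteq> (\<Union>j. F j)"
    proof
      fix x assume "x \<in> (\<Union>i. A i)"
      then obtain i where "x \<in> A i" by auto
      then obtain j where "x \<in> E i j" using E[of i] by (auto simp: fine_cover_def)
      then have "x \<in> F (prod_encode (i, j))" by (simp add: F_def)
      then show "x \<in> (\<Union>j. F j)" by blast
    qed
  qed (use E in \<open>auto simp: fine_cover_def F_def split_def\<close>)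
  from hausdorff_premeasure_le[OF this]
  have "hausdorff_premeasure k \<delta> (\<Union>i. A i) \<le> (\<Sum>j. (hausdorff_gauge k \<circ> F) j)" by simp
  also have "\<dots> = (\<Sum>n. \<Sum>j. hausdorff_gauge k (E n j))"
    unfolding F_def
    using suminf_ennreal_2dimen[of "\<lambda>n. \<Sum>j. hausdorff_gauge k (E n j)" "\<lambda>(n, j). hausdorff_gauge k (E n j)"]
    by (simp add: o_def split_def)
  also have "\<dots> \<le> (\<Sum>n. hausdorff_premeasure k \<delta> (A n) + e * (1/2) ^ Suc n)"
    by (intro suminf_le allI le) auto
  also have "\<dots> = (\<Sum>n. hausdorff_premeasure k \<delta> (A n)) + (\<Sum>n. ennreal e * ennreal ((1/2) ^ Suc n))"
    using \<open>0 < e\<close> by (subst suminf_add[symmetric])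
                     (auto simp del: ennreal_suminf_cmult simp add: ennreal_mult[symmetric])
  also have "\<dots> = (\<Sum>n. hausdorff_premeasure k \<delta> (A n)) + e"
    unfolding ennreal_suminf_cmult
    by (subst suminf_ennreal_eq[OF zero_le_power power_half_series]) auto
  finally show "hausdorff_premeasure k \<delta> (\<Union>i. A i) \<le> (\<Sum>n. hausdorff_premeasure k \<delta> (A n)) + e" .
qed

lemma hausdorff_premeasure_le_outer:
  "0 < \<delta> \<Longrightarrow> hausdorff_premeasure k \<delta> A \<le> hausdorff_outer_measure k A"
  unfolding hausdorff_outer_measure_def by (rule SUP_upper) simp

lemma hausdorff_outer_measure_mono:
  "A \<subseteq> B \<Longrightarrow> hausdorff_outer_measure k A \<le> hausdorff_outer_measure k B"
  unfolding hausdorff_outer_measure_def by (intro SUP_mono') (simp add: hausdorff_premeasure_mono)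

lemma hausdorff_outer_measure_empty [simp]: "hausdorff_outer_measure k {} = 0"
  unfolding hausdorff_outer_measure_def by (simp add: hausdorff_premeasure_empty)

lemma hausdorff_outer_measure_countable_subadditive:
  "hausdorff_outer_measure k (\<Union>i. A i) \<le> (\<Sum>i::nat. hausdorff_outer_measure k (A i))"
proof -
  have "hausdorff_premeasure k \<delta> (\<Union>i. A i) \<le> (\<Sum>i. hausdorff_outer_measure k (A i))" if "0 < \<delta>" for \<delta>
    by (rule order_trans[OF hausdorff_premeasure_countable_subadditive])
       (intro suminf_le hausdorff_premeasure_le_outer that summableI)
  then show ?thesis
    unfolding hausdorff_outer_measure_def[of k "\<Union>i. A i"] by (intro SUP_least) auto
qed

lemma outer_measure_space_hausdorff:
  "outer_measure_space UNIV (hausdorff_outer_measure k)"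
  unfolding outer_measure_space_def positive_def increasing_def countably_subadditive_def
  using hausdorff_outer_measure_countable_subadditive[of k]
  by (auto simp: hausdorff_outer_measure_mono)

lemma hausdorff_outer_measure_subadditive:
  "hausdorff_outer_measure k (A \<union> B) \<le> hausdorff_outer_measure k A + hausdorff_outer_measure k B"
proof -
  have "subadditive UNIV (hausdorff_outer_measure k :: 'a set \<Rightarrow> _)"
    using outer_measure_space_hausdorff[where 'a='a, of k] sigma_algebra_Pow[of "UNIV::'a set"]
    unfolding outer_measure_space_def
    by (intro ring_of_sets.countably_subadditive_subadditive[where \<Omega>=UNIV])
       (auto simp: sigma_algebra_def algebra_def)
  moreover have "hausdorff_outer_measure k (B - A) \<le> hausdorff_outer_measure k B"
    by (rule hausdorff_outer_measure_mono) auto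
  ultimately show ?thesis
    using subadditiveD[of UNIV "hausdorff_outer_measure k" A "B - A"]
    by (simp add: disjnt_def) (meson add_left_mono order_trans)
qed

text \<open>A covering set of diameter less than \<open>d\<close> cannot meet both \<open>A\<close> and \<open>B\<close>, so a fine cover of the union splits into
  a cover of \<open>A\<close> and a cover of \<open>B\<close>.\<close>

lemma hausdorff_outer_measure_separated:
  fixes A B :: "'a::metric_space set"
  assumes d: "0 < d" and sep: "\<And>x y. x \<in> A \<Longrightarrow> y \<in> B \<Longrightarrow> d \<le> dist x y"
  shows "hausdorff_outer_measure k A + hausdorff_outer_measure k B \<le> hausdorff_outer_measure k (A \<union> B)"
proof -
  have small: "hausdorff_premeasure k \<delta> A + hausdorff_premeasure k \<delta> B \<le> hausdorff_premeasure k \<delta> (A \<union> B)"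
    if "0 < \<delta>" "\<delta> < d" for \<delta>
    unfolding hausdorff_premeasure_alt[of k \<delta> "A \<union> B"]
  proof (rule INF_greatest)
    fix E assume "E \<in> Collect (fine_cover \<delta> (A \<union> B))"
    then have cov: "A \<union> B \<subseteq> (\<Union>j. E j)" and bd: "\<And>j. bounded (E j)" and dm: "\<And>j. diameter (E j) \<le> \<delta>"
      by (auto simp: fine_cover_def)
    define EA EB where "EA j = (if E j \<inter> A = {} then {} else E j)"
      and "EB j = (if E j \<inter> B = {} then {} else E j)" for j
    have "fine_cover \<delta> A EA" "fine_cover \<delta> B EB"
      using cov bd dm \<open>0 < \<delta>\<close> unfolding fine_cover_def EA_def EB_def by (auto simp: UN_iff subset_iff) (metis empty_iff Int_iff)+
    then have "hausdorff_premeasure k \<delta> A + hausdorff_premeasure k \<delta> B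
        \<le> (\<Sum>j. hausdorff_gauge k (EA j)) + (\<Sum>j. hausdorff_gauge k (EB j))"
      by (intro add_mono hausdorff_premeasure_le)
    also have "\<dots> = (\<Sum>j. hausdorff_gauge k (EA j) + hausdorff_gauge k (EB j))"
      by (rule suminf_add) auto
    also have "\<dots> \<le> (\<Sum>j. hausdorff_gauge k (E j))"
    proof (rule suminf_le)
      fix j
      have "E j \<inter> A = {} \<or> E j \<inter> B = {}"
      proof (rule ccontr)
        assume "\<not> ?thesis"
        then obtain x y where xy: "x \<in> E j" "x \<in> A" "y \<in> E j" "y \<in> B" by blast
        then have "d \<le> dist x y" using sep by auto
        also have "dist x y \<le> diameter (E j)"
          using bd xy by (intro diameter_bounded_bound)
        finally show False using dm[of j] \<open>\<delta> < d\<close> by auto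
      qed
      then show "hausdorff_gauge k (EA j) + hausdorff_gauge k (EB j) \<le> hausdorff_gauge k (E j)"
        by (auto simp: EA_def EB_def)
    qed auto
    finally show "hausdorff_premeasure k \<delta> A + hausdorff_premeasure k \<delta> B \<le> (\<Sum>j. hausdorff_gauge k (E j))" .
  qed
  have "hausdorff_outer_measure k A + hausdorff_outer_measure k B
      = (SUP \<delta>\<in>{0<..}. hausdorff_premeasure k \<delta> A + hausdorff_premeasure k \<delta> B)"
    unfolding hausdorff_outer_measure_def
  proof (rule SUP_add_directed_ennreal[symmetric])
    fix i j :: real assume "i \<in> {0<..}" "j \<in> {0<..}"
    then show "\<exists>l\<in>{0<..}. hausdorff_premeasure k i A + hausdorff_premeasure k j B
        \<le> hausdorff_premeasure k l A + hausdorff_premeasure k l B"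
      by (intro bexI[of _ "min i j"] add_mono hausdorff_premeasure_mono) auto
  qed
  also have "\<dots> \<le> hausdorff_outer_measure k (A \<union> B)"
  proof (rule SUP_least)
    fix \<delta> :: real assume "\<delta> \<in> {0<..}"
    define \<delta>' where "\<delta>' = min \<delta> (d/2)"
    have \<delta>': "0 < \<delta>'" "\<delta>' < d" "\<delta>' \<le> \<delta>" using d \<open>\<delta> \<in> _\<close> by (auto simp: \<delta>'_def)
    have "hausdorff_premeasure k \<delta> A + hausdorff_premeasure k \<delta> B
        \<le> hausdorff_premeasure k \<delta>' A + hausdorff_premeasure k \<delta>' B"
      using \<delta>' by (intro add_mono hausdorff_premeasure_mono) auto
    also have "\<dots> \<le> hausdorff_outer_measure k (A \<union> B)"
      using small[of \<delta>'] hausdorff_premeasure_le_outer[of \<delta>' k "A \<union> B"] \<delta>' by (meson order_trans)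
    finally show "hausdorff_premeasure k \<delta> A + hausdorff_premeasure k \<delta> B \<le> hausdorff_outer_measure k (A \<union> B)" .
  qed
  finally show ?thesis .
qed

lemma hausdorff_outer_measure_separated_chain:
  fixes R :: "nat \<Rightarrow> 'a::metric_space set"
  assumes d: "\<And>n. 0 < d n"
    and sep: "\<And>n i x y. i < n \<Longrightarrow> x \<in> R i \<Longrightarrow> y \<in> R n \<Longrightarrow> d n \<le> dist x y"
  shows "(\<Sum>i<N. hausdorff_outer_measure k (R i)) \<le> hausdorff_outer_measure k (\<Union>i<N. R i)"
proof (induction N)
  case (Suc N)
  have "(\<Sum>i<Suc N. hausdorff_outer_measure k (R i))
      \<le> hausdorff_outer_measure k (\<Union>i<N. R i) + hausdorff_outer_measure k (R N)"
    using Suc.IH by (simp add: add_right_mono)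
  also have "\<dots> \<le> hausdorff_outer_measure k ((\<Union>i<N. R i) \<union> R N)"
    by (rule hausdorff_outer_measure_separated[OF d[of N]]) (use sep in auto)
  also have "(\<Union>i<N. R i) \<union> R N = (\<Union>i<Suc N. R i)"
    by (auto simp: lessThan_Suc)
  finally show ?case .
qed simp

text \<open>Caratheodory's criterion for closed sets, valid for each outer measure that is additive on separated sets. The part
  \<open>A n\<close> of \<open>X\<close> at distance at least \<open>1 / (n + 1)\<close> from \<open>C\<close> is separated from \<open>X \<inter> C\<close>, so it suffices that the measure of the rest
  of \<open>X - C\<close> tends to \<open>0\<close>. That rest is a union of rings whose measures have a finite sum.\<close>

lemma hausdorff_outer_measure_caratheodory:
  fixes C X :: "'a::metric_space set"
  assumes "closed C"
  shows "hausdorff_outer_measure k (X \<inter> C) + hausdorff_outer_measure k (X - C) \<le> hausdorff_outer_measure k X"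
    (is "?H (X \<inter> C) + ?H (X - C) \<le> ?H X")
proof (cases "C = {} \<or> ?H X = \<infinity>")
  case False
  then have ne: "C \<noteq> {}" and fin: "?H X < top" by (auto simp: less_top)
  define g where "g x = infdist x C" for x
  define r :: "nat \<Rightarrow> real" where "r n = 1 / (real n + 1)" for n
  have r_pos: "0 < r n" and r_dec: "r (Suc n) < r n" for n by (auto simp: r_def field_simps)
  have r_mono: "r m \<le> r n" if "n \<le> m" for m n using that by (simp add: r_def frac_le)
  have g_lip: "g x - g y \<le> dist x y" for x y
    using infdist_triangle[of x C y] by (simp add: g_def)
  define A where "A n = {x\<in>X. r n \<le> g x}" for n
  define Q where "Q n = A (Suc n) - A n" for n
  \<comment> \<open>Rings of the same parity have positive distance, so their measures sum to at most that of \<open>X\<close>.\<close>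
  have parity: "(\<Sum>i<N. ?H (Q (2 * i + s))) \<le> ?H X" for N s
  proof -
    have "(\<Sum>i<N. ?H (Q (2 * i + s))) \<le> ?H (\<Union>i<N. Q (2 * i + s))"
    proof (rule hausdorff_outer_measure_separated_chain)
      show "0 < (if n = 0 then 1 else r (2 * n + s - 1) - r (2 * n + s))" for n
        using r_dec[of "2 * n + s - 1"] by auto
      fix n i x y assume "i < n" and x: "x \<in> Q (2 * i + s)" and y: "y \<in> Q (2 * n + s)"
      then have "r (2 * n + s - 1) \<le> r (Suc (2 * i + s))" by (intro r_mono) auto
      with x y \<open>i < n\<close> g_lip[of x y] show "(if n = 0 then 1 else r (2 * n + s - 1) - r (2 * n + s)) \<le> dist x y"
        by (auto simp: Q_def A_def)
    qed
    also have "\<dots> \<le> ?H X" by (rule hausdorff_outer_measure_mono) (auto simp: Q_def A_def)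
    finally show ?thesis .
  qed
  have split: "(\<Sum>i<2*N. f i) = (\<Sum>i<N. f (2*i)) + (\<Sum>i<N. f (2*i+1))" for f :: "nat \<Rightarrow> ennreal" and N
    by (induction N) (auto simp: algebra_simps)
  have partial: "(\<Sum>i<N. ?H (Q i)) \<le> 2 * ?H X" for N
  proof -
    have "(\<Sum>i<N. ?H (Q i)) \<le> (\<Sum>i<2*N. ?H (Q i))" by (rule sum_mono2) auto
    also have "\<dots> \<le> ?H X + ?H X"
      unfolding split using parity[where s=0 and N=N] parity[where s=1 and N=N] by (intro add_mono) simp_all
    finally show ?thesis by (simp add: mult_2)
  qed
  have "(\<Sum>i. ?H (Q i)) \<le> 2 * ?H X"
    unfolding suminf_eq_SUP by (rule SUP_least) (rule partial)
  also have "\<dots> < top" using fin by (simp add: ennreal_mult_less_top)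
  finally have sumfin: "(\<Sum>i. ?H (Q i)) < top" .
  \<comment> \<open>Finite, hence real values, so that the tail of the series can be made small.\<close>
  define a where "a i = enn2real (?H (Q i))" for i
  have a: "?H (Q i) = ennreal (a i)" "0 \<le> a i" for i
    using ennreal_suminf_lessD[OF sumfin, of i] by (auto simp: a_def)
  have sa: "summable a"
    using sumfin a by (intro summable_suminf_not_top) (auto simp: less_top)
  have far: "?H (X \<inter> C) + ?H (A n) \<le> ?H X" for n
  proof -
    have "?H (X \<inter> C) + ?H (A n) \<le> ?H (X \<inter> C \<union> A n)"
    proof (rule hausdorff_outer_measure_separated[OF r_pos[of n]])
      fix x y assume "x \<in> X \<inter> C" "y \<in> A n"
      then show "r n \<le> dist x y"
        using g_lip[of y x] by (simp add: A_def g_def dist_commute)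
    qed
    also have "\<dots> \<le> ?H X" by (rule hausdorff_outer_measure_mono) (auto simp: A_def)
    finally show ?thesis .
  qed
  have exhaust: "X - C \<subseteq> A n \<union> (\<Union>i. Q (i + n))" for n
  proof
    fix x assume x: "x \<in> X - C"
    then have "0 < g x" using assms ne by (simp add: g_def infdist_pos_not_in_closed)
    then obtain m :: nat where "1 / real (Suc m) < g x" using nat_approx_posE by blast
    then have m: "x \<in> A m" using x by (simp add: A_def r_def add.commute)
    show "x \<in> A n \<union> (\<Union>i. Q (i + n))"
    proof (cases "x \<in> A n")
      case False
      define p where "p = (LEAST m. x \<in> A m)"
      have p: "x \<in> A p" using m unfolding p_def by (rule LeastI)
      have "\<not> p \<le> n"
        using False p r_mono[of p n] by (force simp: A_def)
      then obtain q where q: "p = Suc q" "n \<le> q" by (cases p) auto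
      have "x \<notin> A q" using not_less_Least[of q "\<lambda>m. x \<in> A m"] q by (simp add: p_def)
      then have "x \<in> Q ((q - n) + n)" using p q by (simp add: Q_def)
      then show ?thesis by blast
    qed simp
  qed
  show ?thesis
  proof (rule ennreal_le_epsilon)
    fix e :: real assume "0 < e"
    then obtain n where n: "norm (\<Sum>i. a (i + n)) < e"
      using suminf_exist_split[OF _ sa] by blast
    have "?H (X - C) \<le> ?H (A n) + ?H (\<Union>i. Q (i + n))"
      using hausdorff_outer_measure_mono[OF exhaust] hausdorff_outer_measure_subadditive
      by (rule order_trans)
    also have "?H (\<Union>i. Q (i + n)) \<le> (\<Sum>i. ?H (Q (i + n)))"
      by (rule hausdorff_outer_measure_countable_subadditive)
    also have "\<dots> = ennreal (\<Sum>i. a (i + n))"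
      unfolding a(1) using sa a(2) by (intro suminf_ennreal2) (auto simp: summable_iff_shift)
    also have "\<dots> \<le> ennreal e" using n by (auto intro: ennreal_leI)
    finally have "?H (X - C) \<le> ?H (A n) + e" by (simp add: add_left_mono)
    then have "?H (X \<inter> C) + ?H (X - C) \<le> (?H (X \<inter> C) + ?H (A n)) + e"
      by (simp add: add_left_mono add.assoc)
    also have "\<dots> \<le> ?H X + e" using far[of n] by (rule add_right_mono)
    finally show "?H (X \<inter> C) + ?H (X - C) \<le> ?H X + ennreal e" .
  qed
qed auto

lemma measure_space_hausdorff:
  "measure_space UNIV (sets borel) (hausdorff_outer_measure k :: 'a::metric_space set \<Rightarrow> ennreal)"
proof -
  let ?H = "hausdorff_outer_measure k :: 'a set \<Rightarrow> ennreal"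
  interpret P: sigma_algebra "UNIV :: 'a set" UNIV using sigma_algebra_Pow[of "UNIV::'a set"] by simp
  let ?L = "lambda_system UNIV UNIV ?H"
  have ms: "measure_space UNIV ?L ?H"
    by (rule P.caratheodory_lemma) (rule outer_measure_space_hausdorff)
  then interpret L: sigma_algebra UNIV ?L by (simp add: measure_space_def)
  have "Collect closed \<subseteq> ?L"
  proof
    fix C :: "'a set" assume "C \<in> Collect closed"
    moreover have "?H X \<le> ?H (X \<inter> C) + ?H (X - C)" for X
      using hausdorff_outer_measure_subadditive[of k "X \<inter> C" "X - C"] by (simp add: Int_Diff_Un)
    ultimately show "C \<in> ?L"
      using hausdorff_outer_measure_caratheodory[of C k] by (auto simp: P.lambda_system_eq intro: antisym)
  qed
  then have "sets borel \<subseteq> ?L"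
    by (simp add: borel_eq_closed L.sigma_sets_subset)
  with ms show ?thesis
    unfolding measure_space_def countably_additive_def positive_def
    using sets.sigma_algebra_axioms[of "borel :: 'a measure"] by auto
qed

lemma
  shows sets_hausdorff_measure [simp, measurable_cong]: "sets (hausdorff_measure k) = sets borel"
    and space_hausdorff_measure [simp]: "space (hausdorff_measure k) = UNIV"
  by (auto simp: hausdorff_measure_def sets.sigma_sets_eq[of borel, simplified])

lemma emeasure_hausdorff_measure:
  "A \<in> sets borel \<Longrightarrow> emeasure (hausdorff_measure k) A = hausdorff_outer_measure k A"
  using measure_space_hausdorff[of k]
  by (subst emeasure_measure_of[OF hausdorff_measure_def])
     (auto simp: measure_space_def sets.sigma_sets_eq[of borel, simplified])

section \<open>Hausdorff measure under Lipschitz maps\<close>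

lemma diameter_leI:
  fixes S :: "'a::metric_space set"
  assumes "0 \<le> d" "\<And>x y. x \<in> S \<Longrightarrow> y \<in> S \<Longrightarrow> dist x y \<le> d"
  shows "diameter S \<le> d"
  using assms by (auto simp: diameter_def intro!: cSUP_least)

lemma hausdorff_gauge_lipschitz_image:
  fixes f :: "'a::metric_space \<Rightarrow> 'b::metric_space"
  assumes c: "0 < c" and lip: "\<And>x y. x \<in> A \<Longrightarrow> y \<in> A \<Longrightarrow> dist (f x) (f y) \<le> c * dist x y"
    and E: "bounded E" "E \<subseteq> A"
  shows "bounded (f ` E)" "diameter (f ` E) \<le> c * diameter E"
    "hausdorff_gauge k (f ` E) \<le> ennreal (c ^ k) * hausdorff_gauge k E"
proof -
  have d: "dist (f x) (f y) \<le> c * diameter E" if "x \<in> E" "y \<in> E" for x y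
  proof -
    have "dist (f x) (f y) \<le> c * dist x y" using that E lip by blast
    also have "\<dots> \<le> c * diameter E" using c that diameter_bounded_bound[OF E(1)] by simp
    finally show ?thesis .
  qed
  then show "bounded (f ` E)" unfolding bounded_two_points by blast
  show di: "diameter (f ` E) \<le> c * diameter E"
    using c E(1) by (intro diameter_leI) (auto intro: d simp: diameter_ge_0)
  have "unit_ball_vol (real k) * (diameter (f ` E) / 2) ^ k
      \<le> unit_ball_vol (real k) * (c * diameter E / 2) ^ k"
    using di \<open>bounded (f ` E)\<close> by (intro mult_left_mono power_mono divide_right_mono) (auto simp: diameter_ge_0)
  also have "\<dots> = c ^ k * (unit_ball_vol (real k) * (diameter E / 2) ^ k)"
    by (simp add: power_mult_distrib power_divide)
  finally show "hausdorff_gauge k (f ` E) \<le> ennreal (c ^ k) * hausdorff_gauge k E"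
    using c E by (auto simp: hausdorff_gauge_def ennreal_mult[symmetric] diameter_ge_0 intro!: ennreal_leI)
qed

text \<open>A cover of \<open>A\<close> of fineness \<open>\<delta> / c\<close> is mapped to a cover of the image of fineness \<open>\<delta>\<close>. The covering sets are
  first cut down to \<open>A\<close>, the only place where \<open>f\<close> is known to be Lipschitz.\<close>

lemma hausdorff_outer_measure_lipschitz_image:
  fixes f :: "'a::metric_space \<Rightarrow> 'b::metric_space"
  assumes c: "0 < c" and lip: "\<And>x y. x \<in> A \<Longrightarrow> y \<in> A \<Longrightarrow> dist (f x) (f y) \<le> c * dist x y"
  shows "hausdorff_outer_measure k (f ` A) \<le> ennreal (c ^ k) * hausdorff_outer_measure k A"
proof -
  have pre: "hausdorff_premeasure k \<delta> (f ` A) \<le> ennreal (c ^ k) * hausdorff_premeasure k (\<delta> / c) A" for \<delta>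
  proof -
    have "ennreal (1 / c ^ k) * hausdorff_premeasure k \<delta> (f ` A) \<le> hausdorff_premeasure k (\<delta> / c) A"
      unfolding hausdorff_premeasure_alt[of k "\<delta> / c"]
    proof (rule INF_greatest)
      fix E assume "E \<in> Collect (fine_cover (\<delta> / c) A)"
      then have E: "A \<subseteq> (\<Union>j. E j)" "\<And>j. bounded (E j)" "\<And>j. diameter (E j) \<le> \<delta> / c"
        by (auto simp: fine_cover_def)
      note im = hausdorff_gauge_lipschitz_image[OF c lip, of A "A \<inter> E j" for j]
      have bd: "bounded (A \<inter> E j)" for j using E(2) by (simp add: bounded_Int)
      have dm: "diameter (A \<inter> E j) \<le> diameter (E j)" for j
        by (intro diameter_subset E) auto
      have "diameter (f ` (A \<inter> E j)) \<le> \<delta>" for j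
      proof -
        have "diameter (f ` (A \<inter> E j)) \<le> c * diameter (A \<inter> E j)" by (rule im) (auto simp: bd)
        also have "\<dots> \<le> c * (\<delta> / c)" using c dm[of j] E(3)[of j] by (intro mult_left_mono) auto
        finally show ?thesis using c by simp
      qed
      moreover have "bounded (f ` (A \<inter> E j))" for j by (rule im) (auto simp: bd)
      moreover have "f ` A \<subseteq> (\<Union>j. f ` (A \<inter> E j))" using E(1) by blast
      ultimately have "fine_cover \<delta> (f ` A) (\<lambda>j. f ` (A \<inter> E j))"
        by (simp add: fine_cover_def)
      from hausdorff_premeasure_le[OF this]
      have "hausdorff_premeasure k \<delta> (f ` A) \<le> (\<Sum>j. hausdorff_gauge k (f ` (A \<inter> E j)))" .
      also have "\<dots> \<le> (\<Sum>j. ennreal (c ^ k) * hausdorff_gauge k (E j))"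
      proof (intro suminf_le summableI)
        fix j
        have "hausdorff_gauge k (f ` (A \<inter> E j)) \<le> ennreal (c ^ k) * hausdorff_gauge k (A \<inter> E j)"
          by (rule im) (auto simp: bd)
        also have "hausdorff_gauge k (A \<inter> E j) \<le> hausdorff_gauge k (E j)"
          using dm[of j] bd[of j] by (auto simp: hausdorff_gauge_def diameter_ge_0
              intro!: ennreal_leI mult_left_mono power_mono divide_right_mono)
        finally show "hausdorff_gauge k (f ` (A \<inter> E j)) \<le> ennreal (c ^ k) * hausdorff_gauge k (E j)"
          by (simp add: mult_left_mono)
      qed
      finally have "hausdorff_premeasure k \<delta> (f ` A) \<le> ennreal (c ^ k) * (\<Sum>j. hausdorff_gauge k (E j))"
        by simp
      then have "ennreal (1 / c ^ k) * hausdorff_premeasure k \<delta> (f ` A)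
          \<le> ennreal (1 / c ^ k) * (ennreal (c ^ k) * (\<Sum>j. hausdorff_gauge k (E j)))"
        by (rule mult_left_mono) simp
      then show "ennreal (1 / c ^ k) * hausdorff_premeasure k \<delta> (f ` A) \<le> (\<Sum>j. hausdorff_gauge k (E j))"
        using c by (simp add: mult.assoc[symmetric] ennreal_mult[symmetric])
    qed
    then have "ennreal (c ^ k) * (ennreal (1 / c ^ k) * hausdorff_premeasure k \<delta> (f ` A))
        \<le> ennreal (c ^ k) * hausdorff_premeasure k (\<delta> / c) A"
      by (rule mult_left_mono) simp
    then show ?thesis
      using c by (simp add: mult.assoc[symmetric] ennreal_mult[symmetric])
  qed
  show ?thesis
    unfolding hausdorff_outer_measure_def[of k "f ` A"]
  proof (rule SUP_least)
    fix \<delta> :: real assume "\<delta> \<in> {0<..}"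
    then have "hausdorff_premeasure k (\<delta> / c) A \<le> hausdorff_outer_measure k A"
      using c by (intro hausdorff_premeasure_le_outer) auto
    then show "hausdorff_premeasure k \<delta> (f ` A) \<le> ennreal (c ^ k) * hausdorff_outer_measure k A"
      using pre[of \<delta>] by (meson mult_left_mono order_trans zero_le)
  qed
qed

lemma hausdorff_outer_measure_isometric_image:
  fixes f :: "'a::metric_space \<Rightarrow> 'b::metric_space"
  assumes "\<And>x y. x \<in> A \<Longrightarrow> y \<in> A \<Longrightarrow> dist (f x) (f y) = dist x y"
  shows "hausdorff_outer_measure k (f ` A) = hausdorff_outer_measure k A"
proof (rule antisym)
  show "hausdorff_outer_measure k (f ` A) \<le> hausdorff_outer_measure k A"
    using hausdorff_outer_measure_lipschitz_image[of 1 A f k] assms by simp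
  have inj: "inj_on f A" using assms by (metis dist_eq_0_iff inj_onI)
  have "hausdorff_outer_measure k (inv_into A f ` (f ` A)) \<le> ennreal (1 ^ k) * hausdorff_outer_measure k (f ` A)"
    using assms inj by (intro hausdorff_outer_measure_lipschitz_image) (auto simp: inv_into_f_f)
  moreover have "inv_into A f ` (f ` A) = A"
    using inj by (auto simp: inv_into_f_f image_image)
  ultimately show "hausdorff_outer_measure k A \<le> hausdorff_outer_measure k (f ` A)"
    by simp
qed

text \<open>The full-dimensional Hausdorff measure is locally finite: a cube of side \<open>2 r\<close> is covered by about \<open>N\<^sup>k\<close> cubes of side
  \<open>2 r / N\<close>, and the gauges of these add up to a bound independent of \<open>N\<close>.\<close>

lemma hausdorff_outer_measure_finite_bounded:
  fixes A :: "(real^'k::finite) set"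
  assumes "bounded A"
  shows "hausdorff_outer_measure CARD('k) A < \<infinity>"
proof -
  let ?k = "CARD('k)"
  obtain r where r: "0 < r" "A \<subseteq> cball 0 r"
    using assms by (auto simp: bounded_pos subset_iff)
  have comp: "\<bar>x $ i\<bar> \<le> r" if "x \<in> A" for x i
    using that r component_le_norm_cart[of x i] by (auto simp: subset_iff)
  define K where "K = unit_ball_vol (real ?k) * (2 * r * real ?k / 2) ^ ?k * 2 ^ ?k"
  have K: "0 \<le> K" using r by (simp add: K_def)
  have "hausdorff_premeasure ?k \<delta> A \<le> ennreal K" if "0 < \<delta>" for \<delta>
  proof -
    \<comment> \<open>Divide the cube of side \<open>2 r\<close> into \<open>N ^ k\<close> cubes of side \<open>2 r / N\<close>, allowing \<open>N + 1\<close>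
      indices per coordinate because the cube is closed.\<close>
    obtain N :: nat where N: "2 * r * real ?k / \<delta> < real N" using reals_Archimedean2 by blast
    then have N0: "0 < N" using r \<open>0 < \<delta>\<close>
      by (metis divide_pos_pos gr0I less_asym mult_pos_pos of_nat_0 of_nat_0_less_iff zero_less_card_finite zero_less_numeral)
    define s where "s = 2 * r / real N"
    have s: "0 < s" "s * real ?k \<le> \<delta>"
      using N N0 r \<open>0 < \<delta>\<close> by (auto simp: s_def field_simps)
    define I where "I = (UNIV :: 'k set) \<rightarrow>\<^sub>E {0..N}"
    have finI: "finite I" by (simp add: I_def finite_PiE)
    have cardI: "card I = (N + 1) ^ ?k" by (simp add: I_def card_PiE)
    define Q where "Q i = {x \<in> A. \<forall>j. nat \<lfloor>(x $ j + r) / s\<rfloor> = i j}" for i :: "'k \<Rightarrow> nat"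
    have Qdist: "dist x y \<le> s * real ?k" if "x \<in> Q i" "y \<in> Q i" for x y i
    proof -
      have "\<bar>(x - y) $ j\<bar> \<le> s" for j
      proof -
        have fl: "real (i j) \<le> (z $ j + r) / s \<and> (z $ j + r) / s < real (i j) + 1" if "z \<in> Q i" for z
        proof -
          have "0 \<le> (z $ j + r) / s" using comp[of z j] that s by (auto simp: Q_def)
          moreover have "nat \<lfloor>(z $ j + r) / s\<rfloor> = i j" using that by (simp add: Q_def)
          ultimately show ?thesis by linarith
        qed
        have "\<bar>(x $ j + r) / s - (y $ j + r) / s\<bar> \<le> 1" using fl[OF that(1)] fl[OF that(2)] by linarith
        then have "\<bar>(x $ j - y $ j) / s\<bar> \<le> 1" by (simp add: diff_divide_distrib add_divide_distrib)
        then show ?thesis using s by (simp add: abs_divide field_simps)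
      qed
      then have "norm (x - y) \<le> (\<Sum>j\<in>(UNIV::'k set). s)"
        by (intro order_trans[OF norm_le_l1_cart] sum_mono) auto
      then show ?thesis by (simp add: dist_norm mult.commute)
    qed
    have Qb: "bounded (Q i)" for i using assms by (rule bounded_subset) (auto simp: Q_def)
    have Qd: "diameter (Q i) \<le> s * real ?k" for i
      using Qdist s by (intro diameter_leI) auto
    have gauge: "hausdorff_gauge ?k (Q i) \<le> ennreal (unit_ball_vol (real ?k) * (s * real ?k / 2) ^ ?k)" for i
      using Qd Qb s unfolding hausdorff_gauge_def
      by (auto intro!: ennreal_leI mult_left_mono power_mono divide_right_mono diameter_ge_0)
    have cov: "A \<subseteq> (\<Union>i\<in>I. Q i)"
    proof
      fix x assume x: "x \<in> A"
      define i where "i = (\<lambda>j. nat \<lfloor>(x $ j + r) / s\<rfloor>)"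
      have "i j \<le> N" for j
      proof -
        have "(x $ j + r) / s \<le> real N"
          using comp[OF x, of j] s(1) N0 r(1) by (simp add: s_def field_simps abs_le_iff)
        then show ?thesis unfolding i_def by (simp add: nat_le_iff le_floor_iff floor_le_iff)
      qed
      then have "i \<in> I" by (auto simp: I_def)
      moreover have "x \<in> Q i" using x by (simp add: Q_def i_def)
      ultimately show "x \<in> (\<Union>i\<in>I. Q i)" by blast
    qed
    have sub: "hausdorff_premeasure ?k \<delta> (\<Union>i\<in>J. Q i) \<le> (\<Sum>i\<in>J. hausdorff_premeasure ?k \<delta> (Q i))"
      if J: "finite J" for J
    proof -
      obtain e n where e: "J = e ` {..<n::nat}" "inj_on e {..<n}"
        using finite_imp_nat_seg_image_inj_on[OF J] by (auto simp: lessThan_def)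
      have "hausdorff_premeasure ?k \<delta> (\<Union>i\<in>J. Q i) = hausdorff_premeasure ?k \<delta> (\<Union>m. if m < n then Q (e m) else {})"
        by (rule arg_cong[where f="hausdorff_premeasure ?k \<delta>"]) (auto simp: e(1) split: if_splits)
      also have "\<dots> \<le> (\<Sum>m. hausdorff_premeasure ?k \<delta> (if m < n then Q (e m) else {}))"
        by (rule hausdorff_premeasure_countable_subadditive)
      also have "\<dots> = (\<Sum>m<n. hausdorff_premeasure ?k \<delta> (Q (e m)))"
        using \<open>0 < \<delta>\<close> by (subst suminf_finite[of "{..<n}"]) (auto simp: hausdorff_premeasure_empty)
      also have "\<dots> = (\<Sum>i\<in>J. hausdorff_premeasure ?k \<delta> (Q i))"
        unfolding e(1) by (simp add: sum.reindex[OF e(2)])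
      finally show ?thesis .
    qed
    have "hausdorff_premeasure ?k \<delta> A \<le> hausdorff_premeasure ?k \<delta> (\<Union>i\<in>I. Q i)"
      by (rule hausdorff_premeasure_mono[OF cov order_refl])
    also have "\<dots> \<le> (\<Sum>i\<in>I. hausdorff_premeasure ?k \<delta> (Q i))" by (rule sub[OF finI])
    also have "\<dots> \<le> (\<Sum>i\<in>I. ennreal (unit_ball_vol (real ?k) * (s * real ?k / 2) ^ ?k))"
    proof (rule sum_mono)
      fix i
      have "hausdorff_premeasure ?k \<delta> (Q i) \<le> hausdorff_gauge ?k (Q i)"
        using Qb Qd[of i] s \<open>0 < \<delta>\<close> by (intro hausdorff_premeasure_le_gauge) auto
      then show "hausdorff_premeasure ?k \<delta> (Q i) \<le> ennreal (unit_ball_vol (real ?k) * (s * real ?k / 2) ^ ?k)"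
        using gauge[of i] by (rule order_trans)
    qed
    also have "\<dots> = ennreal (real ((N + 1) ^ ?k) * (unit_ball_vol (real ?k) * (s * real ?k / 2) ^ ?k))"
      using s by (simp add: cardI ennreal_mult ennreal_of_nat_eq_real_of_nat del: of_nat_power)
    also have "\<dots> \<le> ennreal K"
    proof (rule ennreal_leI)
      have "real (N + 1) * s \<le> 2 * r * 2"
        using r N0 by (simp add: s_def field_simps)
      then have "(real (N + 1) * s * real ?k / 2) ^ ?k \<le> (2 * r * 2 * real ?k / 2) ^ ?k"
        using s by (intro power_mono divide_right_mono mult_right_mono) auto
      then have "unit_ball_vol (real ?k) * (real (N + 1) * s * real ?k / 2) ^ ?k
          \<le> unit_ball_vol (real ?k) * (2 * r * 2 * real ?k / 2) ^ ?k"
        by (rule mult_left_mono) simp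
      then show "real ((N + 1) ^ ?k) * (unit_ball_vol (real ?k) * (s * real ?k / 2) ^ ?k) \<le> K"
        by (simp add: K_def power_mult_distrib power_divide mult_ac)
    qed
    finally show ?thesis .
  qed
  then have "hausdorff_outer_measure ?k A \<le> ennreal K"
    unfolding hausdorff_outer_measure_def by (intro SUP_least) auto
  then show ?thesis by (simp add: le_less_trans)
qed

section \<open>Multiplicative functions of a matrix and the determinant\<close>

text \<open>Invertible matrices are products of diagonal matrices, transpositions and shears. A positive multiplicative function is
  \<open>1\<close> on transpositions, which are involutions, and on shears, because a shear is conjugate to its own square by a diagonal
  matrix. So it is determined by its values on diagonal matrices. This identifies both the
  scaling factor of Lebesgue measure and the determinant of a block-diagonal matrix.\<close>

lemma abs_det_unique:
  fixes F :: "real^'n^'n \<Rightarrow> real"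
  assumes mult: "\<And>A B. invertible A \<Longrightarrow> invertible B \<Longrightarrow> F (A ** B) = F A * F B"
    and pos: "\<And>A. invertible A \<Longrightarrow> 0 < F A"
    and diag: "\<And>A. invertible A \<Longrightarrow> (\<And>i j. i \<noteq> j \<Longrightarrow> A$i$j = 0) \<Longrightarrow> F A = \<bar>\<Prod>i\<in>UNIV. A$i$i\<bar>"
  assumes "invertible A"
  shows "F A = \<bar>det A\<bar>"
proof -
  have inv_prod: "invertible (A ** B) \<longleftrightarrow> invertible A \<and> invertible B" for A B :: "real^'n^'n"
    by (simp add: invertible_det_nz det_mul)
  define S :: "'n \<Rightarrow> 'n \<Rightarrow> real^'n^'n"
    where "S m n = (\<chi> i j. mat 1 $ i $ Transposition.transpose m n j)" for m n
  define E :: "'n \<Rightarrow> 'n \<Rightarrow> real \<Rightarrow> real^'n^'n"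
    where "E m n c = (\<chi> i j. if i = m \<and> j = n then c else of_bool (i = j))" for m n c
  define D :: "'n \<Rightarrow> real^'n^'n"
    where "D m = (\<chi> i j. if i = j then if i = m then 2 else 1 else 0)" for m
  have SS: "S m n ** S m n = mat 1" for m n
  proof -
    let ?t = "Transposition.transpose m n"
    have S: "S m n $ i $ j = (if j = ?t i then 1 else 0)" for i j
      by (auto simp: S_def mat_def)
    have "(S m n ** S m n) $ i $ j = (\<Sum>k\<in>UNIV. if k = ?t i then (if j = ?t k then 1 else 0) else 0)" for i j
      unfolding matrix_matrix_mult_def by (simp only: vec_lambda_beta S) (rule sum.cong, auto)
    then show ?thesis by (simp add: vec_eq_iff mat_def)
  qed
  have E_mult: "(E m n a ** B) $ i $ j = B $ i $ j + (if i = m then a * B $ n $ j else 0)"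
    if "m \<noteq> n" for m n a B i j
  proof -
    have "(E m n a ** B) $ i $ j
        = (\<Sum>k\<in>UNIV. (if k = i then B $ k $ j else 0) + (if k = n then if i = m then a * B $ k $ j else 0 else 0))"
      unfolding matrix_matrix_mult_def E_def using that
      by (simp only: vec_lambda_beta) (rule sum.cong, auto)
    then show ?thesis by (simp add: sum.distrib)
  qed
  have D_mult: "(D m ** B) $ i $ j = (if i = m then 2 else 1) * B $ i $ j" for m B i j
  proof -
    have "(D m ** B) $ i $ j = (\<Sum>k\<in>UNIV. if k = i then (if i = m then 2 else 1) * B $ k $ j else 0)"
      unfolding matrix_matrix_mult_def D_def by (simp only: vec_lambda_beta) (rule sum.cong, auto)
    then show ?thesis by simp
  qed
  have EE: "E m n a ** E m n c = E m n (a + c)" if "m \<noteq> n" for m n a c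
    using that by (simp add: vec_eq_iff E_mult) (simp add: E_def)
  have DE: "D m ** E m n c = E m n (2 * c) ** D m" if "m \<noteq> n" for m n c
    using that by (simp add: vec_eq_iff E_mult D_mult) (simp add: E_def D_def)
  have detD: "det (D m) = 2" for m
    by (subst det_diagonal) (auto simp: D_def)
  have Dinv: "invertible (D m)" for m by (simp add: invertible_det_nz detD)
  have Sinv: "invertible (S m n)" for m n
    using SS[of m n] inv_prod[of "S m n" "S m n"] by (simp add: invertible_det_nz)
  have Einv: "invertible (E m n c)" if "m \<noteq> n" for m n c
  proof -
    have "E m n c ** E m n (- c) = mat 1"
      using that by (simp add: EE) (simp add: E_def mat_def vec_eq_iff)
    then show ?thesis using inv_prod[of "E m n c" "E m n (- c)"] by (simp add: invertible_det_nz)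
  qed
  \<comment> \<open>The generators that are not diagonal have \<open>G = 1\<close> for each multiplicative \<open>G\<close>.\<close>
  have one: "G (S m n) = 1 \<and> (m \<noteq> n \<longrightarrow> G (E m n c) = 1)"
    if G: "\<And>A B. invertible A \<Longrightarrow> invertible B \<Longrightarrow> G (A ** B) = G A * G B"
      and Gpos: "\<And>A. invertible A \<Longrightarrow> 0 < G A"
    for G :: "real^'n^'n \<Rightarrow> real" and m n c
  proof
    have "invertible (mat 1 :: real^'n^'n)" by (simp add: invertible_det_nz)
    then have "G (mat 1) = G (mat 1) * G (mat 1)" "0 < G (mat 1)"
      using G[of "mat 1" "mat 1"] Gpos by auto
    then have "G (S m n) * G (S m n) = 1"
      using G[OF Sinv Sinv, of m n m n] by (simp add: SS)
    then show "G (S m n) = 1" using Gpos[OF Sinv, of m n]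
      by (metis abs_of_pos abs_square_eq_1 power2_eq_square)
    show "m \<noteq> n \<longrightarrow> G (E m n c) = 1"
    proof
      assume mn: "m \<noteq> n"
      have "G (D m) * G (E m n c) = G (D m ** E m n c)"
        by (rule G[OF Dinv Einv[OF mn], symmetric])
      also have "D m ** E m n c = (E m n c ** E m n c) ** D m"
        by (simp only: DE[OF mn] EE[OF mn] mult_2)
      also have "G \<dots> = G (E m n c) * G (E m n c) * G (D m)"
        using Einv[OF mn, of c] Dinv[of m] by (simp only: G inv_prod simp_thms)
      finally show "G (E m n c) = 1"
        using Gpos[OF Dinv, of m] Gpos[OF Einv[OF mn], of c] by simp
    qed
  qed
  have "invertible A \<longrightarrow> F A = \<bar>det A\<bar>"
  proof (rule induct_matrix_elementary)
    fix A B :: "real^'n^'n"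
    assume "invertible A \<longrightarrow> F A = \<bar>det A\<bar>" "invertible B \<longrightarrow> F B = \<bar>det B\<bar>"
    then show "invertible (A ** B) \<longrightarrow> F (A ** B) = \<bar>det (A ** B)\<bar>"
      by (simp add: inv_prod mult det_mul abs_mult)
  next
    fix A :: "real^'n^'n" and i assume "row i A = 0"
    then show "invertible A \<longrightarrow> F A = \<bar>det A\<bar>"
      by (simp add: invertible_det_nz det_zero_row)
  next
    fix A :: "real^'n^'n" assume "\<And>i j. i \<noteq> j \<Longrightarrow> A$i$j = 0"
    then show "invertible A \<longrightarrow> F A = \<bar>det A\<bar>"
      by (simp add: diag det_diagonal)
  next
    fix m n :: 'n assume "m \<noteq> n"
    have "\<bar>det (S m n)\<bar> = 1"
      using one[of "\<lambda>A. \<bar>det A\<bar>" m n] by (simp add: det_mul abs_mult invertible_det_nz)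
    then show "invertible (\<chi> i j. mat 1 $ i $ Transposition.transpose m n j) \<longrightarrow>
       F (\<chi> i j. mat 1 $ i $ Transposition.transpose m n j)
       = \<bar>det (\<chi> i j. mat 1 $ i $ Transposition.transpose m n j :: real^'n^'n)\<bar>"
      using one[of F m n] mult pos unfolding S_def by simp
  next
    fix m n :: 'n and c assume "m \<noteq> n"
    then have "\<bar>det (E m n c)\<bar> = 1"
      using one[of "\<lambda>A. \<bar>det A\<bar>" m n c] by (simp add: det_mul abs_mult invertible_det_nz)
    then show "invertible (\<chi> i j. if i = m \<and> j = n then c else of_bool (i = j)) \<longrightarrow>
       F (\<chi> i j. if i = m \<and> j = n then c else of_bool (i = j))
       = \<bar>det (\<chi> i j. if i = m \<and> j = n then c else of_bool (i = j) :: real^'n^'n)\<bar>"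
      using one[of F m n c] mult pos \<open>m \<noteq> n\<close> unfolding E_def by simp
  qed
  with assms show ?thesis by blast
qed

section \<open>Translation-invariant measures and linear maps\<close>

text \<open>Uniqueness of Haar measure, for Euclidean space. With \<open>Q\<close> the closed unit ball and \<open>\<lambda>\<close> Lebesgue measure, Fubini's
  theorem and the invariance of both measures give
  \<open>M(A) \<lambda>(Q) = \<integral>\<integral> 1\<^sub>A(x) 1\<^sub>Q(y - x) = \<integral>\<integral> 1\<^sub>A(x + y) 1\<^sub>Q(-x) = M(-Q) \<lambda>(A)\<close>, and \<open>-Q = Q\<close>.\<close>

lemma translation_invariant_eq_lborel:
  fixes M :: "'a::euclidean_space measure"
  assumes sets [measurable_cong]: "sets M = sets borel"
    and trans: "\<And>a A. A \<in> sets borel \<Longrightarrow> emeasure M ((\<lambda>x. x + a) -` A) = emeasure M A"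
    and fin: "\<And>r. emeasure M (cball 0 r) < \<infinity>"
  obtains c :: real where "0 \<le> c" "\<And>A. A \<in> sets borel \<Longrightarrow> emeasure M A = ennreal c * emeasure lborel A"
proof -
  have spM [simp]: "space M = UNIV" using sets_eq_imp_space_eq[OF sets] by simp
  interpret M: sigma_finite_measure M
  proof (rule sigma_finite_measure.intro, intro exI[of _ "range (\<lambda>n::nat. cball 0 (real n))"] conjI)
    show "\<Union> (range (\<lambda>n::nat. cball (0::'a) (real n))) = space M"
      using real_arch_simple by (auto simp: mem_cball)
  qed (use fin in \<open>auto simp: sets less_top\<close>)
  interpret MN: pair_sigma_finite M lborel ..
  have distr: "distr M borel (\<lambda>x. x + a) = M" for a
    by (rule measure_eqI) (simp_all add: sets emeasure_distr trans)
  let ?Q = "cball 0 1 :: 'a set"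
  define u :: "'a \<Rightarrow> ennreal" where "u = indicator ?Q"
  have u [measurable]: "u \<in> borel_measurable borel"
    unfolding u_def by (rule borel_measurable_indicator) simp
  have "emeasure M A * emeasure lborel ?Q = emeasure M ?Q * emeasure lborel A"
    if [measurable]: "A \<in> sets borel" for A
  proof -
    have "emeasure M A * emeasure lborel ?Q
        = (\<integral>\<^sup>+x. indicator A x * (\<integral>\<^sup>+y. u y \<partial>lborel) \<partial>M)"
      by (simp add: nn_integral_multc sets u_def)
    also have "\<dots> = (\<integral>\<^sup>+x. (\<integral>\<^sup>+y. indicator A x * u (y - x) \<partial>lborel) \<partial>M)"
    proof (rule nn_integral_cong)
      fix x
      have "(\<integral>\<^sup>+y. u y \<partial>lborel) = (\<integral>\<^sup>+y. u y \<partial>distr lborel borel (\<lambda>y. - x + y))"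
        by (simp only: lborel_distr_plus)
      also have "\<dots> = (\<integral>\<^sup>+y. u (y - x) \<partial>lborel)"
        by (subst nn_integral_distr) auto
      finally show "indicator A x * (\<integral>\<^sup>+y. u y \<partial>lborel)
          = (\<integral>\<^sup>+y. indicator A x * u (y - x) \<partial>lborel)"
        by (simp only:) (rule nn_integral_cmult[symmetric], measurable)
    qed
    also have "\<dots> = (\<integral>\<^sup>+y. (\<integral>\<^sup>+x. indicator A x * u (y - x) \<partial>M) \<partial>lborel)"
      by (rule MN.Fubini'[symmetric]) measurable
    also have "\<dots> = (\<integral>\<^sup>+y. (\<integral>\<^sup>+x. indicator A (x + y) * u (- x) \<partial>M) \<partial>lborel)"
    proof (rule nn_integral_cong)
      fix y
      have "(\<integral>\<^sup>+x. indicator A x * u (y - x) \<partial>M)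
          = (\<integral>\<^sup>+x. indicator A x * u (y - x) \<partial>distr M borel (\<lambda>x. x + y))"
        by (simp add: distr)
      also have "\<dots> = (\<integral>\<^sup>+x. indicator A (x + y) * u (- x) \<partial>M)"
        by (subst nn_integral_distr) auto
      finally show "(\<integral>\<^sup>+x. indicator A x * u (y - x) \<partial>M)
          = (\<integral>\<^sup>+x. indicator A (x + y) * u (- x) \<partial>M)" .
    qed
    also have "\<dots> = (\<integral>\<^sup>+x. (\<integral>\<^sup>+y. indicator A (x + y) * u (- x) \<partial>lborel) \<partial>M)"
      by (rule MN.Fubini') measurable
    also have "\<dots> = (\<integral>\<^sup>+x. emeasure lborel A * u x \<partial>M)"
    proof (rule nn_integral_cong)
      fix x
      have "(\<integral>\<^sup>+y. indicator A (x + y) \<partial>lborel) = (\<integral>\<^sup>+y. indicator A y \<partial>distr lborel borel (\<lambda>y. x + y))"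
        by (subst nn_integral_distr) auto
      also have "\<dots> = emeasure lborel A" using lborel_distr_plus[of x] by simp
      finally have "(\<integral>\<^sup>+y. indicator A (x + y) \<partial>lborel) = emeasure lborel A" .
      moreover have "u (- x) = u x" by (simp add: u_def indicator_def)
      ultimately show "(\<integral>\<^sup>+y. indicator A (x + y) * u (- x) \<partial>lborel) = emeasure lborel A * u x"
        by (simp add: nn_integral_multc)
    qed
    also have "\<dots> = emeasure M ?Q * emeasure lborel A"
      unfolding u_def by (subst nn_integral_cmult_indicator) (simp_all add: sets mult.commute)
    finally show ?thesis .
  qed
  moreover define q m where "q = measure lborel ?Q" and "m = measure M ?Q"
  moreover have "0 < q"
    unfolding q_def using content_cball_pos[of 1 "0::'a"] by simp
  moreover have "emeasure lborel ?Q = ennreal q" "emeasure M ?Q = ennreal m"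
    using fin[of 1] emeasure_bounded_finite[of ?Q]
    by (auto simp: q_def m_def less_top[symmetric] intro!: emeasure_eq_ennreal_measure)
  ultimately have eq: "emeasure M A * ennreal q = ennreal m * emeasure lborel A" if "A \<in> sets borel" for A
    using that by simp
  show thesis
  proof (rule that[of "m / q"])
    show "0 \<le> m / q" using \<open>0 < q\<close> by (simp add: m_def)
    fix A :: "'a set" assume "A \<in> sets borel"
    then have "(emeasure M A * ennreal q) * ennreal (1 / q) = (ennreal m * emeasure lborel A) * ennreal (1 / q)"
      by (simp only: eq)
    moreover have "(emeasure M A * ennreal q) * ennreal (1 / q) = emeasure M A * (ennreal q * ennreal (1 / q))"
      by (rule mult.assoc)
    moreover have "ennreal q * ennreal (1 / q) = 1"
      using \<open>0 < q\<close> by (simp add: ennreal_mult[symmetric])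
    moreover have "(ennreal m * emeasure lborel A) * ennreal (1 / q) = (ennreal m * ennreal (1 / q)) * emeasure lborel A"
      by (simp only: mult_ac)
    moreover have "ennreal m * ennreal (1 / q) = ennreal (m / q)"
      using \<open>0 < q\<close> by (simp add: ennreal_mult[symmetric] m_def)
    ultimately show "emeasure M A = ennreal (m / q) * emeasure lborel A"
      by simp
  qed
qed

lemma Basis_cart: "(Basis :: (real^'n) set) = range (\<lambda>i. axis i 1)"
  by (auto simp: Basis_vec_def)

lemma inj_axis: "inj (\<lambda>i::'n::finite. axis i (1::real))"
  by (auto simp: inj_on_def axis_eq_axis)

lemma prod_Basis_cart: "(\<Prod>b\<in>(Basis :: (real^'n) set). f b) = (\<Prod>i\<in>UNIV. f (axis i 1))"
  unfolding Basis_cart by (simp add: prod.reindex[OF inj_axis])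

lemma sum_Basis_cart: "(\<Sum>b\<in>(Basis :: (real^'n) set). f b) = (\<Sum>i\<in>UNIV. f (axis i 1))"
  unfolding Basis_cart by (simp add: sum.reindex[OF inj_axis])

lemma matrix_image_eq_vimage:
  fixes A A' :: "real^'n^'n"
  assumes "A ** A' = mat 1" "A' ** A = mat 1"
  shows "(*v) A ` B = (*v) A' -` B"
proof safe
  fix x assume "A' *v x \<in> B"
  moreover have "x = A *v (A' *v x)" by (simp add: matrix_vector_mul_assoc assms)
  ultimately show "x \<in> (*v) A ` B" by blast
qed (simp add: matrix_vector_mul_assoc assms)

lemma borel_matrix_image:
  fixes A :: "real^'n^'n"
  assumes "invertible A" "B \<in> sets borel"
  shows "(*v) A ` B \<in> sets borel"
proof -
  obtain A' where A': "A ** A' = mat 1" "A' ** A = mat 1"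
    using assms(1) by (auto simp: invertible_def)
  have "(*v) A ` B = (*v) A' -` B" by (rule matrix_image_eq_vimage[OF A'])
  moreover have "(*v) A' \<in> borel_measurable borel"
    by (intro borel_measurable_continuous_onI linear_continuous_on)
       (simp add: matrix_vector_mul_bounded_linear)
  ultimately show ?thesis using assms(2) by (metis measurable_sets_borel)
qed

text \<open>The map \<open>B \<mapsto> \<lambda>(A B)\<close> is translation invariant, so it is \<open>F(A) \<lambda>\<close> for a number \<open>F(A)\<close>; this \<open>F\<close> is multiplicative and
  known on diagonal matrices, hence equal to \<open>\<bar>det A\<bar>\<close>.\<close>

lemma emeasure_lborel_matrix_image:
  fixes A :: "real^'n^'n"
  assumes "invertible A" "B \<in> sets borel"
  shows "emeasure lborel ((*v) A ` B) = ennreal \<bar>det A\<bar> * emeasure lborel B"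
proof -
  have scale: "\<exists>c>0. \<forall>B\<in>sets borel. emeasure lborel ((*v) A ` B) = ennreal c * emeasure lborel B"
    if inv: "invertible A" for A :: "real^'n^'n"
  proof -
    obtain A' where A': "A ** A' = mat 1" "A' ** A = mat 1"
      using inv by (auto simp: invertible_def)
    note im = matrix_image_eq_vimage[OF A']
    have [measurable]: "(*v) A' \<in> borel_measurable borel"
      by (intro borel_measurable_continuous_onI linear_continuous_on)
         (simp add: matrix_vector_mul_bounded_linear)
    define M where "M = distr lborel borel ((*v) A')"
    have M: "emeasure M B = emeasure lborel ((*v) A ` B)" if "B \<in> sets borel" for B
      using that by (simp add: M_def emeasure_distr im)
    obtain c where c: "0 \<le> c" "\<And>B. B \<in> sets borel \<Longrightarrow> emeasure M B = ennreal c * emeasure lborel B"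
    proof (rule translation_invariant_eq_lborel)
      show "sets M = sets borel" by (simp add: M_def)
      fix a :: "real^'n" and B :: "(real^'n) set" assume B: "B \<in> sets borel"
      have shift: "(\<lambda>x. x + a) -` B \<in> sets borel"
        using B by (intro measurable_sets_borel[of _ borel]) auto
      have "(*v) A' -` ((\<lambda>x. x + a) -` B) = (\<lambda>x. A *v a + x) -` ((*v) A' -` B)"
        by (auto simp: matrix_vector_right_distrib matrix_vector_mul_assoc A' add.commute)
      moreover have "emeasure lborel ((\<lambda>x. A *v a + x) -` ((*v) A' -` B))
          = emeasure (distr lborel borel ((+) (A *v a))) ((*v) A' -` B)"
        using B by (subst emeasure_distr) (auto intro!: measurable_sets_borel[of _ borel])
      ultimately show "emeasure M ((\<lambda>x. x + a) -` B) = emeasure M B"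
        using B shift by (simp add: M_def emeasure_distr lborel_distr_plus)
    next
      fix r
      have "bounded ((*v) A ` cball 0 r)"
        by (intro bounded_linear_image bounded_cball matrix_vector_mul_bounded_linear)
      then show "emeasure M (cball 0 r) < \<infinity>"
        using emeasure_bounded_finite by (simp add: M)
    qed blast
    have "c \<noteq> 0"
    proof
      assume "c = 0"
      then have "emeasure lborel ((*v) A ` UNIV) = 0" using c(2)[of UNIV] M[of UNIV] by simp
      moreover have "(*v) A ` UNIV = UNIV" by (simp add: im)
      ultimately show False by simp
    qed
    with c show ?thesis using M by (intro exI[of _ c]) auto
  qed
  define F where "F A = (SOME c. 0 < c \<and> (\<forall>B\<in>sets borel. emeasure lborel ((*v) A ` B) = ennreal c * emeasure lborel B))"
    for A :: "real^'n^'n"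
  have F: "0 < F A" "\<And>B. B \<in> sets borel \<Longrightarrow> emeasure lborel ((*v) A ` B) = ennreal (F A) * emeasure lborel B"
    if "invertible A" for A
    using someI_ex[OF scale[OF that]] unfolding F_def by blast+
  have box: "emeasure lborel (box 0 (One :: real^'n)) = 1" by (simp add: emeasure_lborel_box_eq)
  have eqF: "F A = c" if "invertible A" "0 \<le> c" "emeasure lborel ((*v) A ` box 0 One) = ennreal c" for A c
    using F(2)[OF that(1), of "box 0 One"] F(1)[OF that(1)] that box by simp
  have "F A = \<bar>det A\<bar>"
  proof (rule abs_det_unique[OF _ F(1) _ assms(1)])
    fix A B :: "real^'n^'n" assume AB: "invertible A" "invertible B"
    have "(*v) (A ** B) ` X = (*v) A ` (*v) B ` X" for X
      by (auto simp: image_image matrix_vector_mul_assoc)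
    then have "emeasure lborel ((*v) (A ** B) ` box 0 One) = ennreal (F A * F B)"
      using AB F(1)[OF AB(1)] F(1)[OF AB(2)]
      by (simp add: F(2) borel_matrix_image box ennreal_mult less_imp_le)
    then show "F (A ** B) = F A * F B"
      using AB F(1)[OF AB(1)] F(1)[OF AB(2)] by (intro eqF) (auto simp: invertible_mult)
  next
    fix A :: "real^'n^'n" assume inv: "invertible A" and diag: "\<And>i j. i \<noteq> j \<Longrightarrow> A $ i $ j = 0"
    have nz: "A $ i $ i \<noteq> 0" for i
      using inv diag by (auto simp: invertible_det_nz det_diagonal)
    define c where "c b = b \<bullet> (A *v b)" for b
    have c_axis: "c (axis i 1) = A $ i $ i" for i
      by (simp add: c_def inner_axis' matrix_vector_mult_basis column_def)
    let ?T = "\<lambda>x :: real^'n. 0 + (\<Sum>j\<in>Basis. (c j * (x \<bullet> j)) *\<^sub>R j)"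
    have T: "?T = (*v) A"
    proof
      fix x :: "real^'n"
      have "?T x \<bullet> axis i 1 = (A *v x) \<bullet> axis i 1" for i
      proof -
        have "?T x \<bullet> axis i 1 = A $ i $ i * x $ i"
          by (simp add: inner_sum_left sum_Basis_cart c_axis inner_axis) (simp add: axis_def if_distrib cong: if_cong)
        also have "\<dots> = (\<Sum>j\<in>UNIV. if j = i then A $ i $ j * x $ j else 0)" by simp
        also have "\<dots> = (A *v x) \<bullet> axis i 1"
          by (simp only: inner_axis matrix_vector_mult_def vec_lambda_beta inner_real_def mult_1_right)
             (rule sum.cong, auto simp: diag)
        finally show ?thesis .
      qed
      then show "?T x = A *v x" by (simp add: vec_eq_iff inner_axis)
    qed
    have "lborel = density (distr lborel borel ?T) (\<lambda>_. (\<Prod>j\<in>Basis. \<bar>c j\<bar>))"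
      by (rule lborel_affine_euclidean) (auto simp: Basis_vec_def c_axis nz)
    also have "(\<Prod>j\<in>Basis. \<bar>c j\<bar>) = \<bar>\<Prod>i\<in>UNIV. A $ i $ i\<bar>"
      by (simp add: prod_Basis_cart c_axis abs_prod)
    finally have L: "lborel = density (distr lborel borel ((*v) A)) (\<lambda>_. \<bar>\<Prod>i\<in>UNIV. A $ i $ i\<bar>)"
      unfolding T .
    have [measurable]: "(*v) A \<in> borel_measurable borel"
      by (intro borel_measurable_continuous_onI linear_continuous_on)
         (simp add: matrix_vector_mul_bounded_linear)
    have "(*v) A -` (*v) A ` box 0 One = box 0 One"
      using inv by (intro inj_vimage_image_eq) (simp add: inj_matrix_vector_mult)
    moreover have "(*v) A ` box 0 One \<in> sets borel" by (rule borel_matrix_image[OF inv]) simp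
    ultimately have "emeasure lborel ((*v) A ` box 0 One) = ennreal \<bar>\<Prod>i\<in>UNIV. A $ i $ i\<bar>"
      by (subst L) (simp add: emeasure_density nn_integral_cmult emeasure_distr box)
    then show "F A = \<bar>\<Prod>i\<in>UNIV. A $ i $ i\<bar>" using inv by (intro eqF) auto
  qed
  then show ?thesis using F(2)[OF assms] by simp
qed

text \<open>Full-dimensional Hausdorff measure is a constant multiple of Lebesgue measure, and the constant cancels here.\<close>

lemma hausdorff_matrix_image:
  fixes A :: "real^'k^'k"
  assumes "invertible A" "B \<in> sets borel"
  shows "hausdorff_outer_measure CARD('k) ((*v) A ` B) = ennreal \<bar>det A\<bar> * hausdorff_outer_measure CARD('k) B"
proof -
  let ?M = "hausdorff_measure CARD('k) :: (real^'k) measure"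
  obtain c where c: "\<And>B. B \<in> sets borel \<Longrightarrow> emeasure ?M B = ennreal c * emeasure lborel B"
  proof (rule translation_invariant_eq_lborel[of ?M])
    show "sets ?M = sets borel" by simp
    show "emeasure ?M (cball 0 r) < \<infinity>" for r
      using hausdorff_outer_measure_finite_bounded[of "cball (0::real^'k) r"]
      by (simp add: emeasure_hausdorff_measure)
    fix a :: "real^'k" and B :: "(real^'k) set" assume B: "B \<in> sets borel"
    then have shift: "(\<lambda>x. x + a) -` B \<in> sets borel"
      by (intro measurable_sets_borel[of _ borel]) auto
    have "hausdorff_outer_measure CARD('k) ((\<lambda>x. x + a) ` ((\<lambda>x. x + a) -` B))
        = hausdorff_outer_measure CARD('k) ((\<lambda>x. x + a) -` B)"
      by (rule hausdorff_outer_measure_isometric_image) simp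
    moreover have "(\<lambda>x. x + a) ` ((\<lambda>x. x + a) -` B) = B"
      by (intro surj_image_vimage_eq) (auto simp: surj_def intro: exI[of _ "_ - a"])
    ultimately show "emeasure ?M ((\<lambda>x. x + a) -` B) = emeasure ?M B"
      using B shift by (simp add: emeasure_hausdorff_measure)
  qed blast
  show ?thesis
    using c[OF assms(2)] c[OF borel_matrix_image[OF assms]] assms
    by (simp add: emeasure_hausdorff_measure borel_matrix_image emeasure_lborel_matrix_image mult_ac)
qed

section \<open>Block-triangular determinants\<close>

text \<open>The upper triangular block matrix with diagonal blocks \<open>A\<close>, \<open>D\<close> and corner \<open>X\<close>. The bijection \<open>e\<close> distributes the index
  type over the two blocks, so that the matrix keeps the index type of the ambient space.\<close>

definition block_matrix ::
  "('n \<Rightarrow> 'k + 'm) \<Rightarrow> real^'k^'k \<Rightarrow> real^'m^'k \<Rightarrow> real^'m^'m \<Rightarrow> real^'n::finite^'n" where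
  "block_matrix e A X D = (\<chi> i j. case e i of
       Inl a \<Rightarrow> (case e j of Inl b \<Rightarrow> A $ a $ b | Inr d \<Rightarrow> X $ a $ d)
     | Inr c \<Rightarrow> (case e j of Inl b \<Rightarrow> 0 | Inr d \<Rightarrow> D $ c $ d))"

lemma sum_over_blocks:
  fixes e :: "'n::finite \<Rightarrow> 'k::finite + 'm::finite"
  assumes "bij e"
  shows "(\<Sum>i\<in>UNIV. f (e i)) = (\<Sum>a\<in>UNIV. f (Inl a)) + (\<Sum>c\<in>UNIV. f (Inr c))"
proof -
  have "(\<Sum>i\<in>UNIV. f (e i)) = (\<Sum>s\<in>UNIV. f s)"
    using assms by (rule sum.reindex_bij_betw)
  then show ?thesis using sum.Plus[of "UNIV :: 'k set" "UNIV :: 'm set" f] by simp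
qed

lemma prod_over_blocks:
  fixes e :: "'n::finite \<Rightarrow> 'k::finite + 'm::finite"
  assumes "bij e"
  shows "(\<Prod>i\<in>UNIV. f (e i)) = (\<Prod>a\<in>UNIV. f (Inl a)) * (\<Prod>c\<in>UNIV. f (Inr c))"
proof -
  have "(\<Prod>i\<in>UNIV. f (e i)) = (\<Prod>s\<in>UNIV. f s)"
    using assms by (rule prod.reindex_bij_betw)
  then show ?thesis using prod.Plus[of "UNIV :: 'k set" "UNIV :: 'm set" f] by simp
qed

lemma block_matrix_mult:
  fixes e :: "'n::finite \<Rightarrow> 'k::finite + 'm::finite"
  assumes e: "bij e"
  shows "block_matrix e A X D ** block_matrix e A' X' D'
    = block_matrix e (A ** A') (A ** X' + X ** D') (D ** D')" (is "?L = ?R")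
proof -
  have "?L $ i $ j = ?R $ i $ j" for i j
  proof -
    define f where "f s = (case e i of
         Inl a \<Rightarrow> (case s of Inl b \<Rightarrow> A $ a $ b | Inr d \<Rightarrow> X $ a $ d)
       | Inr c \<Rightarrow> (case s of Inl b \<Rightarrow> 0 | Inr d \<Rightarrow> D $ c $ d)) *
      (case s of
         Inl a \<Rightarrow> (case e j of Inl b \<Rightarrow> A' $ a $ b | Inr d \<Rightarrow> X' $ a $ d)
       | Inr c \<Rightarrow> (case e j of Inl b \<Rightarrow> 0 | Inr d \<Rightarrow> D' $ c $ d))" for s
    have "?L $ i $ j = (\<Sum>k\<in>UNIV. f (e k))"
      by (simp add: matrix_matrix_mult_def block_matrix_def f_def)
    also have "\<dots> = (\<Sum>a\<in>UNIV. f (Inl a)) + (\<Sum>c\<in>UNIV. f (Inr c))"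
      by (rule sum_over_blocks[OF e])
    also have "\<dots> = ?R $ i $ j"
      by (cases "e i"; cases "e j") (simp_all add: f_def block_matrix_def matrix_matrix_mult_def)
    finally show ?thesis .
  qed
  then show ?thesis by (simp add: vec_eq_iff)
qed

lemma block_matrix_one:
  fixes e :: "'n::finite \<Rightarrow> 'k::finite + 'm::finite"
  assumes "bij e"
  shows "block_matrix e (mat 1) 0 (mat 1) = mat 1"
proof -
  have "block_matrix e (mat 1) 0 (mat 1) $ i $ j = mat 1 $ i $ j" for i j
    using bij_is_inj[OF assms, THEN injD, of i j]
    by (cases "e i"; cases "e j") (auto simp: block_matrix_def mat_def)
  then show ?thesis by (simp add: vec_eq_iff)
qed

lemma abs_det_block_diagonal:
  fixes e :: "'n::finite \<Rightarrow> 'k::finite + 'm::finite"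
  assumes e: "bij e"
  shows "invertible A \<Longrightarrow> \<bar>det (block_matrix e A 0 (mat 1))\<bar> = \<bar>det A\<bar>"
    and "invertible D \<Longrightarrow> \<bar>det (block_matrix e (mat 1) 0 D)\<bar> = \<bar>det D\<bar>"
proof -
  have nz: "det (block_matrix e A 0 D) \<noteq> 0" if inv: "invertible A" "invertible D" for A D
  proof -
    obtain A' where A': "A ** A' = mat 1" using inv(1) unfolding invertible_def by blast
    obtain D' where D': "D ** D' = mat 1" using inv(2) unfolding invertible_def by blast
    have "det (block_matrix e A 0 D) * det (block_matrix e A' 0 D') = 1"
      by (simp add: det_mul[symmetric] block_matrix_mult[OF e] A' D' block_matrix_one[OF e])
    then show ?thesis by auto
  qed
  have diag: "det (block_matrix e A 0 D) = (\<Prod>a\<in>UNIV. A $ a $ a) * (\<Prod>c\<in>UNIV. D $ c $ c)"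
    if zA: "\<And>i j. i \<noteq> j \<Longrightarrow> A $ i $ j = 0" and zD: "\<And>i j. i \<noteq> j \<Longrightarrow> D $ i $ j = 0" for A D
  proof -
    have "block_matrix e A 0 D $ i $ j = 0" if "i \<noteq> j" for i j
      using that bij_is_inj[OF e, THEN injD, of i j]
      by (cases "e i"; cases "e j") (auto simp: block_matrix_def intro: zA zD)
    then have "det (block_matrix e A 0 D) = (\<Prod>i\<in>UNIV. block_matrix e A 0 D $ i $ i)"
      by (rule det_diagonal)
    also have "\<dots> = (\<Prod>i\<in>UNIV. case e i of Inl a \<Rightarrow> A $ a $ a | Inr c \<Rightarrow> D $ c $ c)"
      by (rule prod.cong) (auto simp: block_matrix_def split: sum.split)
    also have "\<dots> = (\<Prod>a\<in>UNIV. A $ a $ a) * (\<Prod>c\<in>UNIV. D $ c $ c)"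
      using prod_over_blocks[OF e, of "\<lambda>s. case s of Inl a \<Rightarrow> A $ a $ a | Inr c \<Rightarrow> D $ c $ c"] by simp
    finally show ?thesis .
  qed
  show "\<bar>det (block_matrix e A 0 (mat 1))\<bar> = \<bar>det A\<bar>" if "invertible A" for A
  proof (rule abs_det_unique[OF _ _ _ that])
    fix A B :: "real^'k^'k"
    show "\<bar>det (block_matrix e (A ** B) 0 (mat 1))\<bar>
        = \<bar>det (block_matrix e A 0 (mat 1))\<bar> * \<bar>det (block_matrix e B 0 (mat 1))\<bar>"
      by (simp add: abs_mult[symmetric] det_mul[symmetric] block_matrix_mult[OF e])
  next
    fix A :: "real^'k^'k" assume "\<And>i j. i \<noteq> j \<Longrightarrow> A $ i $ j = 0"
    then have "det (block_matrix e A 0 (mat 1)) = (\<Prod>a\<in>UNIV. A $ a $ a) * (\<Prod>c\<in>(UNIV::'m set). mat 1 $ c $ c)"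
      by (intro diag) (auto simp: mat_def)
    then show "\<bar>det (block_matrix e A 0 (mat 1))\<bar> = \<bar>\<Prod>a\<in>UNIV. A $ a $ a\<bar>" by (simp add: mat_def)
  qed (use nz[of _ "mat 1"] in \<open>simp add: invertible_det_nz\<close>)
  show "\<bar>det (block_matrix e (mat 1) 0 D)\<bar> = \<bar>det D\<bar>" if "invertible D" for D
  proof (rule abs_det_unique[OF _ _ _ that])
    fix A B :: "real^'m^'m"
    show "\<bar>det (block_matrix e (mat 1) 0 (A ** B))\<bar>
        = \<bar>det (block_matrix e (mat 1) 0 A)\<bar> * \<bar>det (block_matrix e (mat 1) 0 B)\<bar>"
      by (simp add: abs_mult[symmetric] det_mul[symmetric] block_matrix_mult[OF e])
  next
    fix D :: "real^'m^'m" assume "\<And>i j. i \<noteq> j \<Longrightarrow> D $ i $ j = 0"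
    then have "det (block_matrix e (mat 1) 0 D) = (\<Prod>a\<in>(UNIV::'k set). mat 1 $ a $ a) * (\<Prod>c\<in>UNIV. D $ c $ c)"
      by (intro diag) (auto simp: mat_def)
    then show "\<bar>det (block_matrix e (mat 1) 0 D)\<bar> = \<bar>\<Prod>a\<in>UNIV. D $ a $ a\<bar>" by (simp add: mat_def)
  qed (use nz[of "mat 1"] in \<open>simp add: invertible_det_nz\<close>)
qed

lemma mat_matrix_mult: "mat s ** X = s *\<^sub>R X" for X :: "real^'q^'k::finite"
  by (simp add: matrix_matrix_mult_def mat_def vec_eq_iff if_distrib if_distribR cong: if_cong)

text \<open>The unipotent matrices form a group under addition of the corner, and \<open>X\<close> is conjugate to \<open>2 X\<close> by a diagonal
  matrix. So the determinant equals its own square, and it is nonzero.\<close>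

lemma det_block_unipotent:
  fixes e :: "'n::finite \<Rightarrow> 'k::finite + 'm::finite"
  assumes e: "bij e"
  shows "det (block_matrix e (mat 1) X (mat 1)) = 1"
proof -
  let ?N = "\<lambda>X. block_matrix e (mat 1) X (mat 1)" and ?S = "\<lambda>s. block_matrix e (mat s) 0 (mat 1)"
  have add: "?N X ** ?N Y = ?N (X + Y)" for X Y
    by (simp add: block_matrix_mult[OF e] add.commute)
  have ms: "mat s ** mat t = (mat (s * t) :: real^'k^'k)" for s t
    unfolding mat_matrix_mult by (simp add: mat_def vec_eq_iff)
  have "det (?S 2) * det (?S (1/2)) = 1"
    by (simp add: det_mul[symmetric] block_matrix_mult[OF e] ms block_matrix_one[OF e])
  then have S: "det (?S 2) \<noteq> 0" by auto
  have "det (?N X) * det (?N (- X)) = 1"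
    by (simp add: det_mul[symmetric] add block_matrix_one[OF e])
  then have N: "det (?N X) \<noteq> 0" by auto
  have "?S 2 ** ?N X = ?N (X + X) ** ?S 2"
    by (simp add: block_matrix_mult[OF e] mat_matrix_mult scaleR_2)
  then have "det (?S 2) * det (?N X) = det (?N X ** ?N X) * det (?S 2)"
    by (simp only: add det_mul[symmetric])
  then show ?thesis using S N by (simp add: det_mul)
qed

lemma abs_det_block_matrix:
  fixes e :: "'n::finite \<Rightarrow> 'k::finite + 'm::finite"
  assumes e: "bij e" and "invertible A" "invertible D"
  shows "\<bar>det (block_matrix e A X D)\<bar> = \<bar>det A\<bar> * \<bar>det D\<bar>"
proof -
  have "block_matrix e (mat 1) 0 D ** (block_matrix e (mat 1) X (mat 1) ** block_matrix e A 0 (mat 1))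
      = block_matrix e A X D"
    by (simp add: block_matrix_mult[OF e])
  then have "det (block_matrix e A X D)
      = det (block_matrix e (mat 1) 0 D) * (det (block_matrix e (mat 1) X (mat 1)) * det (block_matrix e A 0 (mat 1)))"
    by (metis det_mul)
  then show ?thesis
    using abs_det_block_diagonal[OF e] assms by (simp add: det_block_unipotent[OF e] abs_mult)
qed

section \<open>Gram determinants\<close>

lemma matrix_of_linear: "linear f \<Longrightarrow> matrix f *v x = f x" for f :: "real^'n \<Rightarrow> real^'m"
  by (simp add: matrix_works linear_matrix_vector_mul_eq)

definition gram :: "(real^'k::finite \<Rightarrow> 'a::real_inner) \<Rightarrow> real^'k^'k" where
  "gram L = (\<chi> i j. L (axis i 1) \<bullet> L (axis j 1))"

text \<open>The \<open>k\<close>-dimensional volume of the parallelepiped spanned by the images of the unit vectors.\<close>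

definition gram_vol :: "(real^'k::finite \<Rightarrow> 'a::real_inner) \<Rightarrow> real" where
  "gram_vol L = sqrt (det (gram L))"

text \<open>Polar-type decomposition: \<open>Q\<close> identifies \<open>k\<close>-space isometrically with the range of \<open>L\<close>. It reduces statements about
  \<open>L\<close> to statements about a square matrix.\<close>

lemma linear_isometry_factorization:
  fixes L :: "real^'k \<Rightarrow> 'a::euclidean_space"
  assumes "linear L" "inj L"
  obtains Q :: "real^'k \<Rightarrow> 'a" and A :: "real^'k^'k"
  where "linear Q" "\<And>x. norm (Q x) = norm x" "invertible A" "\<And>x. L x = Q (A *v x)"
proof -
  have dim: "dim (UNIV :: (real^'k) set) = dim (range L)"
    using assms by (intro dim_image_eq[symmetric]) auto
  have sub: "subspace (range L)" using assms(1) by (simp add: linear_subspace_image)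
  obtain Q :: "real^'k \<Rightarrow> 'a" and g where Q: "linear Q" "linear g" "Q ` UNIV = range L" "g ` range L = UNIV"
      "\<And>x. x \<in> UNIV \<Longrightarrow> norm (Q x) = norm x" "\<And>x. x \<in> range L \<Longrightarrow> norm (g x) = norm x"
      "\<And>x. x \<in> UNIV \<Longrightarrow> g (Q x) = x" "\<And>x. x \<in> range L \<Longrightarrow> Q (g x) = x"
    using isometries_subspaces[OF subspace_UNIV sub dim] by blast
  have lin: "linear (g \<circ> L)" using Q assms by (intro linear_compose)
  have A: "matrix (g \<circ> L) *v x = g (L x)" for x
    using matrix_of_linear[OF lin, of x] by simp
  have "inj ((*v) (matrix (g \<circ> L)))"
  proof (rule injI)
    fix x y assume "matrix (g \<circ> L) *v x = matrix (g \<circ> L) *v y"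
    then have "Q (g (L x)) = Q (g (L y))" by (simp only: A)
    then have "L x = L y" by (simp only: Q(8) rangeI)
    then show "x = y" using assms(2) by (simp add: inj_eq)
  qed
  then have "invertible (matrix (g \<circ> L))"
    by (simp add: invertible_left_inverse matrix_left_invertible_injective)
  then show thesis
    using that[of Q "matrix (g \<circ> L)"] Q A by simp
qed

lemma linear_isometry_inner:
  fixes Q :: "'a::real_inner \<Rightarrow> 'b::real_inner"
  assumes "linear Q" "\<And>x. norm (Q x) = norm x"
  shows "Q x \<bullet> Q y = x \<bullet> y"
proof -
  have "norm (Q x + Q y) = norm (x + y)"
    using assms linear_add[OF assms(1), of x y] by metis
  then show ?thesis by (simp add: dot_norm assms(2))
qed

lemma gram_isometry_matrix:
  fixes Q :: "real^'k \<Rightarrow> 'a::real_inner" and A :: "real^'k^'k"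
  assumes "linear Q" "\<And>x. norm (Q x) = norm x" "\<And>x. L x = Q (A *v x)"
  shows "gram L = transpose A ** A"
  by (simp add: gram_def assms(3) linear_isometry_inner[OF assms(1,2)] vec_eq_iff
      matrix_vector_mult_basis column_def matrix_matrix_mult_def transpose_def inner_vec_def)

lemma det_gram_pos:
  fixes L :: "real^'k \<Rightarrow> 'a::euclidean_space"
  assumes "linear L" "inj L"
  shows "0 < det (gram L)"
proof -
  obtain Q :: "real^'k \<Rightarrow> 'a" and A :: "real^'k^'k" where "linear Q" "\<And>x. norm (Q x) = norm x" "invertible A" "\<And>x. L x = Q (A *v x)"
    by (rule linear_isometry_factorization[OF assms]) (rule that)
  then show ?thesis
    using gram_isometry_matrix[of Q L A] by (auto simp: det_mul invertible_det_nz zero_less_mult_iff)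
qed

lemma gram_vol_pos:
  fixes L :: "real^'k \<Rightarrow> 'a::euclidean_space"
  shows "linear L \<Longrightarrow> inj L \<Longrightarrow> 0 < gram_vol L"
  by (simp add: gram_vol_def det_gram_pos)

lemma hausdorff_linear_image:
  fixes L :: "real^'k \<Rightarrow> 'a::euclidean_space"
  assumes "linear L" "inj L" and B: "B \<in> sets borel"
  shows "hausdorff_outer_measure CARD('k) (L ` B) = ennreal (gram_vol L) * hausdorff_outer_measure CARD('k) B"
proof -
  obtain Q :: "real^'k \<Rightarrow> 'a" and A :: "real^'k^'k" where Q: "linear Q" "\<And>x. norm (Q x) = norm x" and A: "invertible A" and L: "\<And>x. L x = Q (A *v x)"
    by (rule linear_isometry_factorization[OF assms(1,2)]) (rule that)
  have "hausdorff_outer_measure CARD('k) (Q ` ((*v) A ` B)) = hausdorff_outer_measure CARD('k) ((*v) A ` B)"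
    by (rule hausdorff_outer_measure_isometric_image)
       (metis Q dist_norm linear_diff)
  moreover have "Q ` ((*v) A ` B) = L ` B" by (auto simp: L image_image)
  moreover have "gram_vol L = \<bar>det A\<bar>"
    by (simp add: gram_vol_def gram_isometry_matrix[OF Q L] det_mul real_sqrt_mult)
  ultimately show ?thesis using hausdorff_matrix_image[OF A B] by simp
qed

section \<open>Normal spaces under a linear map\<close>

lemma det_matrix_inv_adjoint:
  fixes T :: "real^'n \<Rightarrow> real^'n"
  assumes "linear T" "bij T"
  shows "det (matrix T) * det (matrix (adjoint (inv T))) = 1"
proof -
  have I: "linear (inv T)" using assms by (simp add: bij_is_inj inj_linear_imp_inv_linear)
  have "matrix T ** matrix (inv T) = mat 1"
    using assms I by (simp add: matrix_compose[symmetric] comp_def bij_is_surj surj_f_inv_f matrix_id_mat_1[unfolded id_def])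
  then have "det (matrix T) * det (matrix (inv T)) = 1" by (metis det_I det_mul)
  moreover have "matrix (adjoint (inv T)) = transpose (matrix (inv T))"
    using I by (rule matrix_adjoint)
  ultimately show ?thesis by simp
qed

text \<open>The factor \<open>gram_vol (T \<circ> L) / gram_vol L\<close> by which \<open>T\<close> changes volume on the range of \<open>L\<close>, expressed through the normal
  space. Complete the frame of \<open>L\<close> by \<open>B\<close> to a square matrix \<open>M\<close>, and the frame of \<open>T \<circ> L\<close> by \<open>B'\<close> to \<open>M'\<close>. As the two parts
  of each frame are orthogonal, \<open>\<bar>det M\<bar> = gram_vol L\<close> and \<open>\<bar>det M'\<bar> = gram_vol (T \<circ> L)\<close>. On the other hand \<open>M\<^sup>t T\<^sup>-\<^sup>1 M'\<close> is block
  triangular with diagonal blocks \<open>gram L\<close> and \<open>C\<^sup>t\<close>, where \<open>C\<close> is the matrix of the inverse transpose of \<open>T\<close> between the two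
  normal frames. Comparing determinants gives the formula.\<close>

lemma normal_jacobian:
  fixes L :: "real^'k \<Rightarrow> real^'n" and T :: "real^'n \<Rightarrow> real^'n" and B B' :: "'m::finite \<Rightarrow> real^'n"
    and e :: "'n \<Rightarrow> 'k + 'm"
  assumes e: "bij e" and L: "linear L" "inj L" and T: "linear T" "bij T"
    and B: "is_orthonormal_basis B (orthogonal_comp (range L))"
    and B': "is_orthonormal_basis B' (orthogonal_comp (range (T \<circ> L)))"
  obtains C :: "real^'m^'m" where "invertible C"
    "\<And>j. adjoint (inv T) (B j) = (\<Sum>i\<in>UNIV. C $ i $ j *\<^sub>R B' i)"
    "gram_vol (T \<circ> L) = \<bar>det (matrix T)\<bar> * \<bar>det C\<bar> * gram_vol L"
proof -
  let ?I = "inv T" and ?S = "adjoint (inv T)"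
  have I: "linear ?I" using T by (simp add: bij_is_inj inj_linear_imp_inv_linear)
  have S: "linear ?S" using I by (rule adjoint_linear)
  have IT: "?I (T x) = x" for x using T by (simp add: bij_is_inj)
  have TI: "T (?I x) = x" for x using T by (simp add: bij_is_surj surj_f_inv_f)
  have adj: "?S x \<bullet> y = x \<bullet> ?I y" for x y by (simp add: adjoint_clauses(2)[OF I])
  have oB: "B i \<bullet> B j = (if i = j then 1 else 0)" "B' i \<bullet> B' j = (if i = j then 1 else 0)" for i j
    using B B' by (auto simp: is_orthonormal_basis_def)
  have BL: "B i \<bullet> L x = 0" "L x \<bullet> B i = 0" for i x
    using B span_base[of "B i" "range B"]
    by (auto simp: is_orthonormal_basis_def orthogonal_comp_def orthogonal_def inner_commute)
  have B'L: "B' i \<bullet> T (L x) = 0" "T (L x) \<bullet> B' i = 0" for i x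
    using B' span_base[of "B' i" "range B'"]
    by (auto simp: is_orthonormal_basis_def orthogonal_comp_def orthogonal_def inner_commute)
  \<comment> \<open>The coordinates of the vectors \<open>?S (B j)\<close>, which are normal to the range of \<open>T \<circ> L\<close>.\<close>
  define C :: "real^'m^'m" where "C = (\<chi> i j. B' i \<bullet> ?S (B j))"
  have C: "?S (B j) = (\<Sum>i\<in>UNIV. C $ i $ j *\<^sub>R B' i)" for j
  proof -
    let ?v = "?S (B j) - (\<Sum>i\<in>UNIV. C $ i $ j *\<^sub>R B' i)"
    have "?S (B j) \<in> orthogonal_comp (range (T \<circ> L))"
      by (auto simp: orthogonal_comp_def orthogonal_def adj IT BL inner_commute[of "T _"])
    then have "?S (B j) \<in> span (range B')" using B' by (simp add: is_orthonormal_basis_def)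
    then have v: "?v \<in> span (range B')"
      by (intro span_diff span_sum span_scale) (auto intro: span_base)
    have "orthogonal ?v y" if y: "y \<in> range B'" for y
    proof -
      obtain l where l: "y = B' l" using y by blast
      have "?v \<bullet> B' l = ?S (B j) \<bullet> B' l - (\<Sum>i\<in>UNIV. if i = l then C $ i $ j else 0)"
        by (simp add: inner_diff_left inner_sum_left oB if_distrib cong: if_cong)
      then show ?thesis by (simp add: l orthogonal_def C_def inner_commute)
    qed
    then have "orthogonal ?v ?v"
      using orthogonal_to_span[OF v] by blast
    then show ?thesis by (simp add: orthogonal_self)
  qed
  have Cinv: "invertible C"
  proof -
    have "w = 0" if "C *v w = 0" for w
    proof -
      define b where "b = (\<Sum>j\<in>UNIV. w $ j *\<^sub>R B j)"
      have "?S b = (\<Sum>j\<in>UNIV. w $ j *\<^sub>R (\<Sum>i\<in>UNIV. C $ i $ j *\<^sub>R B' i))"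
        by (simp add: b_def linear_sum[OF S] linear_scale[OF S] C)
      also have "\<dots> = (\<Sum>i\<in>UNIV. (C *v w) $ i *\<^sub>R B' i)"
        by (simp add: scaleR_sum_right matrix_vector_mult_def scaleR_sum_left mult.commute)
           (rule sum.swap)
      also have "\<dots> = 0" using that by simp
      finally have "b \<bullet> ?I y = 0" for y using adj[of b y] by simp
      from this[of "T b"] have "b = 0" by (simp add: IT)
      then have "b \<bullet> B j = 0" for j by simp
      then have "w $ j = 0" for j
        by (simp add: b_def inner_sum_left oB if_distrib cong: if_cong)
      then show ?thesis by (simp add: vec_eq_iff)
    qed
    then show ?thesis by (simp add: invertible_left_inverse matrix_left_invertible_ker)
  qed
  have TL: "linear (T \<circ> L)" "inj (T \<circ> L)"
    using L T by (auto intro: linear_compose inj_compose simp: bij_is_inj)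
  \<comment> \<open>Complete each tangent frame by the orthonormal normal frame.\<close>
  define M M' where "M = (\<chi> i j. (case e j of Inl a \<Rightarrow> L (axis a 1) | Inr c \<Rightarrow> B c) $ i)"
    and "M' = (\<chi> i j. (case e j of Inl a \<Rightarrow> T (L (axis a 1)) | Inr c \<Rightarrow> B' c) $ i)"
  have MM: "transpose M ** M = block_matrix e (gram L) 0 (mat 1)"
  proof -
    have "(transpose M ** M) $ i $ j = (case e i of Inl a \<Rightarrow> L (axis a 1) | Inr c \<Rightarrow> B c) \<bullet>
        (case e j of Inl a \<Rightarrow> L (axis a 1) | Inr c \<Rightarrow> B c)" for i j
      by (simp add: M_def matrix_matrix_mult_def transpose_def inner_vec_def)
    then show ?thesis
      by (simp add: vec_eq_iff block_matrix_def gram_def BL oB mat_def split: sum.split)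
  qed
  have MM': "transpose M' ** M' = block_matrix e (gram (T \<circ> L)) 0 (mat 1)"
  proof -
    have "(transpose M' ** M') $ i $ j = (case e i of Inl a \<Rightarrow> T (L (axis a 1)) | Inr c \<Rightarrow> B' c) \<bullet>
        (case e j of Inl a \<Rightarrow> T (L (axis a 1)) | Inr c \<Rightarrow> B' c)" for i j
      by (simp add: M'_def matrix_matrix_mult_def transpose_def inner_vec_def)
    then show ?thesis
      by (simp add: vec_eq_iff block_matrix_def gram_def B'L oB mat_def split: sum.split)
  qed
  have gram_inv: "invertible (gram L)" "invertible (gram (T \<circ> L))"
    using det_gram_pos[OF L] det_gram_pos[OF TL] by (auto simp: invertible_det_nz)
  have "(det M)\<^sup>2 = \<bar>det (transpose M ** M)\<bar>" by (simp add: det_mul power2_eq_square)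
  then have detM: "\<bar>det M\<bar> = gram_vol L"
    using abs_det_block_diagonal(1)[OF e gram_inv(1)] det_gram_pos[OF L]
    by (simp add: MM gram_vol_def) (metis real_sqrt_abs)
  have "(det M')\<^sup>2 = \<bar>det (transpose M' ** M')\<bar>" by (simp add: det_mul power2_eq_square)
  then have detM': "\<bar>det M'\<bar> = gram_vol (T \<circ> L)"
    using abs_det_block_diagonal(1)[OF e gram_inv(2)] det_gram_pos[OF TL]
    by (simp add: MM' gram_vol_def) (metis real_sqrt_abs)
  define X :: "real^'m^'k" where "X = (\<chi> a c. L (axis a 1) \<bullet> ?I (B' c))"
  have mixed: "transpose M ** (matrix ?I ** M') = block_matrix e (gram L) X (transpose C)"
  proof -
    have "(matrix ?I ** M') $ i $ j = ?I (case e j of Inl a \<Rightarrow> T (L (axis a 1)) | Inr c \<Rightarrow> B' c) $ i" for i j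
    proof -
      have "(matrix ?I ** M') $ i $ j = (matrix ?I *v (\<chi> i. M' $ i $ j)) $ i"
        by (simp add: matrix_matrix_mult_def matrix_vector_mult_def)
      also have "(\<chi> i. M' $ i $ j) = (case e j of Inl a \<Rightarrow> T (L (axis a 1)) | Inr c \<Rightarrow> B' c)"
        by (simp add: M'_def vec_eq_iff)
      finally show ?thesis by (simp add: matrix_of_linear[OF I])
    qed
    then have entry: "(transpose M ** (matrix ?I ** M')) $ i $ j = (case e i of Inl a \<Rightarrow> L (axis a 1) | Inr c \<Rightarrow> B c) \<bullet>
        ?I (case e j of Inl a \<Rightarrow> T (L (axis a 1)) | Inr c \<Rightarrow> B' c)" for i j
      unfolding matrix_matrix_mult_def[of "transpose M"]
      by (simp add: M_def transpose_def inner_vec_def)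
    moreover have "B c \<bullet> ?I (B' d) = C $ d $ c" for c d
      by (simp add: C_def inner_commute[of "B' d"] adj)
    ultimately show ?thesis
      by (simp add: vec_eq_iff block_matrix_def gram_def X_def BL IT transpose_def split: sum.split)
  qed
  have "matrix T ** matrix ?I = mat 1"
    using T I by (simp add: matrix_compose[symmetric] comp_def TI matrix_id_mat_1[unfolded id_def])
  then have detI: "det (matrix T) * det (matrix ?I) = 1" by (metis det_I det_mul)
  have "\<bar>det M\<bar> * (\<bar>det (matrix ?I)\<bar> * \<bar>det M'\<bar>) = \<bar>det (transpose M ** (matrix ?I ** M'))\<bar>"
    by (simp add: det_mul abs_mult)
  also have "\<dots> = \<bar>det (gram L)\<bar> * \<bar>det C\<bar>"
    unfolding mixed using Cinv by (subst abs_det_block_matrix[OF e gram_inv(1)]) (auto simp: invertible_det_nz)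
  also have "\<bar>det (gram L)\<bar> = gram_vol L * gram_vol L"
    using det_gram_pos[OF L] by (simp add: gram_vol_def)
  finally have "\<bar>det (matrix ?I)\<bar> * gram_vol (T \<circ> L) = gram_vol L * \<bar>det C\<bar>"
    using gram_vol_pos[OF L] by (simp add: detM detM' mult.assoc)
  then have "\<bar>det (matrix T)\<bar> * \<bar>det (matrix ?I)\<bar> * gram_vol (T \<circ> L) = \<bar>det (matrix T)\<bar> * \<bar>det C\<bar> * gram_vol L"
    by simp
  then have "gram_vol (T \<circ> L) = \<bar>det (matrix T)\<bar> * \<bar>det C\<bar> * gram_vol L"
    by (simp add: abs_mult[symmetric] detI)
  with that[of C] Cinv C show thesis by blast
qed

text \<open>In matrix form the hypotheses say \<open>S B = B' diag(C1, C2, C3)\<close>.\<close>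

lemma columns_matrix_change_of_basis:
  fixes B1 B1' :: "'m1::finite \<Rightarrow> real^('m1 + 'm2::finite + 'm3::finite)" and B2 B2' :: "'m2 \<Rightarrow> real^('m1 + 'm2 + 'm3)"
    and B3 B3' :: "'m3 \<Rightarrow> real^('m1 + 'm2 + 'm3)"
  assumes S: "linear S" and inv: "invertible C1" "invertible C2" "invertible C3"
    and C1: "\<And>j. S (B1 j) = (\<Sum>i\<in>UNIV. C1 $ i $ j *\<^sub>R B1' i)"
    and C2: "\<And>j. S (B2 j) = (\<Sum>i\<in>UNIV. C2 $ i $ j *\<^sub>R B2' i)"
    and C3: "\<And>j. S (B3 j) = (\<Sum>i\<in>UNIV. C3 $ i $ j *\<^sub>R B3' i)"
  shows "\<bar>det (matrix S)\<bar> * \<bar>det (columns_matrix B1 B2 B3)\<bar>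
    = \<bar>det (columns_matrix B1' B2' B3')\<bar> * (\<bar>det C1\<bar> * \<bar>det C2\<bar> * \<bar>det C3\<bar>)"
proof -
  let ?D = "block_matrix (\<lambda>s :: 'm2 + 'm3. s) C2 0 C3"
  let ?E = "block_matrix (\<lambda>s :: 'm1 + 'm2 + 'm3. s) C1 0 ?D"
  have b: "bij (\<lambda>s. s)" by (rule bij_id[unfolded id_def])
  have detD: "\<bar>det ?D\<bar> = \<bar>det C2\<bar> * \<bar>det C3\<bar>"
    by (rule abs_det_block_matrix[OF b inv(2,3)])
  then have "invertible ?D" using inv by (auto simp: invertible_det_nz)
  then have detE: "\<bar>det ?E\<bar> = \<bar>det C1\<bar> * (\<bar>det C2\<bar> * \<bar>det C3\<bar>)"
    using abs_det_block_matrix[OF b inv(1), of ?D 0] detD by simp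
  have "(matrix S ** columns_matrix B1 B2 B3) $ i $ j
      = S (case j of Inl a \<Rightarrow> B1 a | Inr (Inl b) \<Rightarrow> B2 b | Inr (Inr c) \<Rightarrow> B3 c) $ i" for i j
  proof -
    have "(matrix S ** columns_matrix B1 B2 B3) $ i $ j = (matrix S *v (\<chi> i. columns_matrix B1 B2 B3 $ i $ j)) $ i"
      by (simp add: matrix_matrix_mult_def matrix_vector_mult_def)
    also have "(\<chi> i. columns_matrix B1 B2 B3 $ i $ j) = (case j of Inl a \<Rightarrow> B1 a | Inr (Inl b) \<Rightarrow> B2 b | Inr (Inr c) \<Rightarrow> B3 c)"
      by (simp add: columns_matrix_def vec_eq_iff)
    finally show ?thesis by (simp add: matrix_of_linear[OF S])
  qed
  moreover have "(columns_matrix B1' B2' B3' ** ?E) $ i $ j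
      = S (case j of Inl a \<Rightarrow> B1 a | Inr (Inl b) \<Rightarrow> B2 b | Inr (Inr c) \<Rightarrow> B3 c) $ i" for i j
    using sum_over_blocks[OF b, of "\<lambda>s. columns_matrix B1' B2' B3' $ i $ s * ?E $ s $ j"]
      sum_over_blocks[OF b, of "\<lambda>s. columns_matrix B1' B2' B3' $ i $ Inr s * ?E $ Inr s $ j"]
    by (simp add: matrix_matrix_mult_def columns_matrix_def block_matrix_def C1 C2 C3 mult.commute
        split: sum.split)
  ultimately have "matrix S ** columns_matrix B1 B2 B3 = columns_matrix B1' B2' B3' ** ?E"
    by (simp add: vec_eq_iff)
  then have "\<bar>det (matrix S ** columns_matrix B1 B2 B3)\<bar> = \<bar>det (columns_matrix B1' B2' B3' ** ?E)\<bar>" by simp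
  then show ?thesis by (simp add: det_mul abs_mult detE mult_ac)
qed

section \<open>Surface measure under a linear map\<close>

text \<open>A \<open>C\<^sup>1\<close> parametrisation \<open>\<Phi>\<close> together with a linear map \<open>p\<close> of the ambient space that recovers the parameter. A graph has such
  a \<open>p\<close>, the projection to the base, and the existence of \<open>p\<close> is inherited by linear images, which need no longer
  be graphs over the original coordinates. It makes the derivative injective and the inverse of \<open>\<Phi>\<close> continuous.\<close>

definition regular_parametrization ::
  "(real^'k::finite) set \<Rightarrow> (real^'k \<Rightarrow> 'a::euclidean_space) \<Rightarrow> (real^'k \<Rightarrow> (real^'k) \<Rightarrow>\<^sub>L 'a) \<Rightarrow> ('a \<Rightarrow> real^'k) \<Rightarrow> 'a set \<Rightarrow> bool" where
  "regular_parametrization U \<Phi> D p S \<longleftrightarrow>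
     open U \<and> (\<forall>x\<in>U. (\<Phi> has_derivative blinfun_apply (D x)) (at x)) \<and> continuous_on U D \<and>
     linear p \<and> (\<forall>x\<in>U. p (\<Phi> x) = x) \<and>
     openin (top_of_set (\<Phi> ` U)) S \<and> compact (closure S) \<and> closure S \<subseteq> \<Phi> ` U"

lemma derivative_retraction:
  fixes \<Phi> :: "'b::euclidean_space \<Rightarrow> 'a::euclidean_space"
  assumes "open U" "x \<in> U" "(\<Phi> has_derivative blinfun_apply L) (at x)" "linear p" "\<And>x. x \<in> U \<Longrightarrow> p (\<Phi> x) = x"
  shows "p (blinfun_apply L w) = w"
proof -
  have "bounded_linear p" using assms(4) by (simp add: linear_conv_bounded_linear)
  then have "((\<lambda>y. p (\<Phi> y)) has_derivative (\<lambda>w. p (blinfun_apply L w))) (at x)"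
    using assms(3) by (rule bounded_linear.has_derivative)
  moreover have "((\<lambda>y. p (\<Phi> y)) has_derivative (\<lambda>w. w)) (at x)"
    by (rule has_derivative_transform_within_open[OF has_derivative_ident assms(1,2)]) (simp add: assms(5))
  ultimately have "(\<lambda>w. p (blinfun_apply L w)) = (\<lambda>w. w)" by (rule has_derivative_unique)
  then show ?thesis by (rule fun_cong)
qed

text \<open>Near \<open>x0\<close> the error of the linearisation is small compared with \<open>norm (x - y)\<close>, by the mean value theorem for the continuous
  derivative, and \<open>norm (x - y)\<close> is controlled by the image under the derivative, because \<open>p\<close> inverts it.\<close>

lemma parametrization_almost_isometric:
  fixes \<Phi> :: "real^'k::finite \<Rightarrow> 'a::euclidean_space"
  assumes R: "open U" "\<And>x. x \<in> U \<Longrightarrow> (\<Phi> has_derivative blinfun_apply (D x)) (at x)" "continuous_on U D"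
    "linear p" "\<And>x. x \<in> U \<Longrightarrow> p (\<Phi> x) = x" and x0: "x0 \<in> U" and \<eta>: "0 < \<eta>"
  obtains r where "0 < r" "ball x0 r \<subseteq> U"
    "\<And>x y. x \<in> ball x0 r \<Longrightarrow> y \<in> ball x0 r \<Longrightarrow> norm (\<Phi> x - \<Phi> y - D x0 (x - y)) \<le> \<eta> * norm (D x0 (x - y))"
proof -
  obtain P where P: "0 < P" "\<And>z. norm (p z) \<le> P * norm z"
    using linear_bounded_pos[OF R(4)] by blast
  define \<epsilon> where "\<epsilon> = \<eta> / P"
  have \<epsilon>: "0 < \<epsilon>" using P \<eta> by (simp add: \<epsilon>_def)
  obtain r1 where r1: "0 < r1" "ball x0 r1 \<subseteq> U" using R(1) x0 open_contains_ball by blast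
  obtain r2 where r2: "0 < r2" "\<And>x. x \<in> U \<Longrightarrow> dist x x0 < r2 \<Longrightarrow> dist (D x) (D x0) < \<epsilon>"
    using R(3) x0 \<epsilon> unfolding continuous_on_iff by blast
  define r where "r = min r1 r2"
  show thesis
  proof (rule that[of r])
    show "0 < r" "ball x0 r \<subseteq> U" using r1 r2 by (auto simp: r_def)
    fix x y assume xy: "x \<in> ball x0 r" "y \<in> ball x0 r"
    have "norm (\<Phi> x - \<Phi> y - D x0 (x - y)) \<le> norm (x - y) * \<epsilon>"
    proof (rule differentiable_bound_linearization[where S="ball x0 r" and f'="\<lambda>x. blinfun_apply (D x)"])
      fix t :: real assume t: "t \<in> {0..1}"
      have "(1 - t) *\<^sub>R y + t *\<^sub>R x \<in> ball x0 r"
        using convex_ball[of x0 r] xy t by (intro convexD) auto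
      then show "y + t *\<^sub>R (x - y) \<in> ball x0 r" by (simp add: algebra_simps)
    next
      fix z assume z: "z \<in> ball x0 r"
      then have zU: "z \<in> U" "dist z x0 < r2" using r1 by (auto simp: r_def dist_commute)
      then show "(\<Phi> has_derivative blinfun_apply (D z)) (at z within ball x0 r)"
        using R(2) has_derivative_at_withinI by blast
      have "onorm (blinfun_apply (D z - D x0)) \<le> \<epsilon>"
        using r2(2)[OF zU] by (simp add: dist_norm norm_blinfun.rep_eq)
      then show "onorm (blinfun_apply (D z) - blinfun_apply (D x0)) \<le> \<epsilon>"
        by (simp add: minus_blinfun.rep_eq fun_diff_def)
    qed (use \<open>0 < r\<close> in simp)
    also have "norm (x - y) \<le> P * norm (D x0 (x - y))"
      using P(2)[of "D x0 (x - y)"] derivative_retraction[OF R(1) x0 R(2)[OF x0] R(4,5), of "x - y"] by simp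
    then have "norm (x - y) * \<epsilon> \<le> (P * norm (D x0 (x - y))) * \<epsilon>"
      using \<epsilon> by (intro mult_right_mono) auto
    also have "\<dots> = \<eta> * norm (D x0 (x - y))" using P by (simp add: \<epsilon>_def)
    finally show "norm (\<Phi> x - \<Phi> y - D x0 (x - y)) \<le> \<eta> * norm (D x0 (x - y))" .
  qed
qed

lemma inj_derivative_retraction:
  fixes \<Phi> :: "'b::euclidean_space \<Rightarrow> 'a::euclidean_space"
  assumes "open U" "x \<in> U" "(\<Phi> has_derivative blinfun_apply L) (at x)" "linear p" "\<And>x. x \<in> U \<Longrightarrow> p (\<Phi> x) = x"
  shows "inj (blinfun_apply L)"
  using derivative_retraction[OF assms] by (metis injI)

text \<open>Near \<open>x0\<close> the maps between \<open>\<Phi> x\<close> and \<open>D x0 x\<close> are Lipschitz in both directions with constant \<open>s = q\<^sup>1\<^sup>/\<^sup>k\<close>, so the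
  Hausdorff measures of the images of \<open>B\<close> under \<open>\<Phi>\<close> and under its linearisation differ at most by the factor \<open>q\<close>.\<close>

lemma hausdorff_parametrization_local:
  fixes \<Phi> :: "real^'k::finite \<Rightarrow> 'a::euclidean_space"
  assumes R: "open U" "\<And>x. x \<in> U \<Longrightarrow> (\<Phi> has_derivative blinfun_apply (D x)) (at x)" "continuous_on U D"
    "linear p" "\<And>x. x \<in> U \<Longrightarrow> p (\<Phi> x) = x" and x0: "x0 \<in> U" and q: "1 < q"
  obtains r where "0 < r" "ball x0 r \<subseteq> U"
    "\<And>B. B \<in> sets borel \<Longrightarrow> B \<subseteq> ball x0 r \<Longrightarrow>
       hausdorff_outer_measure CARD('k) (\<Phi> ` B) \<le> ennreal q * (ennreal (gram_vol (D x0)) * hausdorff_outer_measure CARD('k) B)"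
    "\<And>B. B \<in> sets borel \<Longrightarrow> B \<subseteq> ball x0 r \<Longrightarrow>
       ennreal (gram_vol (D x0)) * hausdorff_outer_measure CARD('k) B \<le> ennreal q * hausdorff_outer_measure CARD('k) (\<Phi> ` B)"
proof -
  let ?k = "CARD('k)" and ?L = "blinfun_apply (D x0)"
  \<comment> \<open>With \<open>\<eta> = 1 - 1 / s\<close> both \<open>1 + \<eta>\<close> and \<open>1 / (1 - \<eta>)\<close> are at most \<open>s\<close>.\<close>
  define s where "s = root ?k q"
  have s: "1 < s" "s ^ ?k = q"
    using q by (auto simp: s_def real_root_gt_1_iff real_root_pow_pos2)
  define \<eta> where "\<eta> = 1 - 1 / s"
  have \<eta>: "0 < \<eta>" "\<eta> < 1" using s by (auto simp: \<eta>_def)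
  have "0 < (s - 1) * (s - 1)" using s by simp
  then have s1: "1 + \<eta> \<le> s" using s by (simp add: \<eta>_def field_simps)
  have s2: "s * (1 - \<eta>) = 1" using s by (simp add: \<eta>_def)
  obtain r where r: "0 < r" "ball x0 r \<subseteq> U"
    and lin: "\<And>x y. x \<in> ball x0 r \<Longrightarrow> y \<in> ball x0 r \<Longrightarrow> norm (\<Phi> x - \<Phi> y - ?L (x - y)) \<le> \<eta> * norm (?L (x - y))"
    using parametrization_almost_isometric[OF R x0 \<eta>(1)] by blast
  have L: "linear ?L" "inj ?L"
    using inj_derivative_retraction[OF R(1) x0 R(2)[OF x0] R(4,5)]
    by (auto intro: bounded_linear.linear blinfun.bounded_linear_right)
  have up: "dist (\<Phi> x) (\<Phi> y) \<le> s * dist (?L x) (?L y)" and lo: "dist (?L x) (?L y) \<le> s * dist (\<Phi> x) (\<Phi> y)"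
    if "x \<in> ball x0 r" "y \<in> ball x0 r" for x y
  proof -
    have n: "norm (\<Phi> x - \<Phi> y - (?L x - ?L y)) \<le> \<eta> * norm (?L x - ?L y)"
      using lin[OF that] by (simp add: blinfun.diff_right)
    have "norm (\<Phi> x - \<Phi> y) \<le> (1 + \<eta>) * norm (?L x - ?L y)"
      using n norm_triangle_sub[of "\<Phi> x - \<Phi> y" "?L x - ?L y"] by (simp add: algebra_simps)
    also have "\<dots> \<le> s * norm (?L x - ?L y)" using s1 by (intro mult_right_mono) auto
    finally show "dist (\<Phi> x) (\<Phi> y) \<le> s * dist (?L x) (?L y)" by (simp add: dist_norm)
    have "norm (?L x - ?L y) \<le> norm (\<Phi> x - \<Phi> y) + \<eta> * norm (?L x - ?L y)"
      using n norm_triangle_sub[of "?L x - ?L y" "\<Phi> x - \<Phi> y"] by (simp add: norm_minus_commute)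
    then have "(1 - \<eta>) * norm (?L x - ?L y) \<le> norm (\<Phi> x - \<Phi> y)" by (simp add: algebra_simps)
    then have "s * ((1 - \<eta>) * norm (?L x - ?L y)) \<le> s * norm (\<Phi> x - \<Phi> y)"
      using s by (intro mult_left_mono) auto
    then show "dist (?L x) (?L y) \<le> s * dist (\<Phi> x) (\<Phi> y)"
      using s2 by (simp add: dist_norm mult.assoc[symmetric])
  qed
  show thesis
  proof (rule that[OF r])
    fix B :: "(real^'k) set" assume B: "B \<in> sets borel" "B \<subseteq> ball x0 r"
    note HL = hausdorff_linear_image[OF L B(1)]
    have "hausdorff_outer_measure ?k ((\<lambda>z. \<Phi> (inv ?L z)) ` (?L ` B)) \<le> ennreal (s ^ ?k) * hausdorff_outer_measure ?k (?L ` B)"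
    proof (rule hausdorff_outer_measure_lipschitz_image)
      fix z z' assume "z \<in> ?L ` B" "z' \<in> ?L ` B"
      then obtain x y where "z = ?L x" "x \<in> B" "z' = ?L y" "y \<in> B" by blast
      moreover from this have "x \<in> ball x0 r" "y \<in> ball x0 r" using B(2) by auto
      ultimately show "dist (\<Phi> (inv ?L z)) (\<Phi> (inv ?L z')) \<le> s * dist z z'"
        using up[of x y] L(2) by simp
    qed (use s in simp)
    moreover have "(\<lambda>z. \<Phi> (inv ?L z)) ` (?L ` B) = \<Phi> ` B" using L(2) by (simp add: image_image)
    ultimately show "hausdorff_outer_measure ?k (\<Phi> ` B) \<le> ennreal q * (ennreal (gram_vol (D x0)) * hausdorff_outer_measure ?k B)"
      by (simp add: HL s(2))
    have "hausdorff_outer_measure ?k ((\<lambda>z. ?L (p z)) ` (\<Phi> ` B)) \<le> ennreal (s ^ ?k) * hausdorff_outer_measure ?k (\<Phi> ` B)"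
    proof (rule hausdorff_outer_measure_lipschitz_image)
      fix z z' assume "z \<in> \<Phi> ` B" "z' \<in> \<Phi> ` B"
      then obtain x y where "z = \<Phi> x" "x \<in> B" "z' = \<Phi> y" "y \<in> B" by blast
      moreover from this have "x \<in> ball x0 r" "y \<in> ball x0 r" using B(2) by auto
      moreover from this have "x \<in> U" "y \<in> U" using r(2) by auto
      ultimately show "dist (?L (p z)) (?L (p z')) \<le> s * dist z z'"
        using lo[of x y] R(5) by simp
    qed (use s in simp)
    moreover have "(\<lambda>z. ?L (p z)) ` (\<Phi> ` B) = ?L ` B"
      unfolding image_image using B(2) r(2) R(5) by (intro image_cong) auto
    ultimately show "ennreal (gram_vol (D x0)) * hausdorff_outer_measure ?k B \<le> ennreal q * hausdorff_outer_measure ?k (\<Phi> ` B)"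
      by (simp add: HL s(2))
  qed
qed

lemma ennreal_le_if_le_mult:
  fixes a b :: ennreal
  assumes "\<And>c::real. 1 < c \<Longrightarrow> a \<le> ennreal c * b"
  shows "a \<le> b"
proof (rule ennreal_le_epsilon)
  fix e :: real assume e: "0 < e" and b: "b < top"
  define r where "r = enn2real b"
  have r: "b = ennreal r" "0 \<le> r" using b by (auto simp: r_def)
  have "a \<le> ennreal (1 + e / (r + 1)) * b" using e r by (intro assms) auto
  also have "\<dots> = ennreal ((1 + e / (r + 1)) * r)" using e r by (simp add: ennreal_mult)
  also have "\<dots> \<le> ennreal (r + e)"
    using e r by (intro ennreal_leI) (simp add: field_simps)
  finally show "a \<le> b + ennreal e" using e r by simp
qed

text \<open>A derivative of one measure with respect to another that holds locally up to factors arbitrarily near \<open>1\<close> is a density: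
  for fixed \<open>c > 1\<close>, Lindelof's theorem gives a countable Borel partition into pieces on which the two sides agree up to
  the factor \<open>c\<close>; the pieces are summed, and then \<open>c\<close> tends to \<open>1\<close>.\<close>

lemma density_of_local_ratio:
  fixes M N :: "'a::second_countable_topology measure" and J :: "'a \<Rightarrow> real"
  assumes setsM: "sets M = sets (restrict_space borel S)" and setsN: "sets N = sets M"
    and Jc: "continuous_on S J" and Jpos: "\<And>x. x \<in> S \<Longrightarrow> 0 < J x"
    and loc: "\<And>x q. x \<in> S \<Longrightarrow> 1 < q \<Longrightarrow> \<exists>V. open V \<and> x \<in> V \<and>
      (\<forall>A\<in>sets M. A \<subseteq> V \<longrightarrow> emeasure N A \<le> ennreal (q * J x) * emeasure M A \<and>
        ennreal (J x) * emeasure M A \<le> ennreal q * emeasure N A)"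
  shows "density M J = N"
proof (rule measure_eqI)
  have spM: "space M = S" using sets_eq_imp_space_eq[OF setsM] by (simp add: space_restrict_space)
  have Jm [measurable]: "J \<in> borel_measurable M"
    using borel_measurable_continuous_on_restrict[OF Jc] by (simp cong: measurable_cong_sets add: setsM)
  have cover: "emeasure N A \<le> ennreal c * emeasure (density M J) A \<and>
      emeasure (density M J) A \<le> ennreal c * emeasure N A"
    if A: "A \<in> sets M" and c: "1 < c" for A c
  proof -
    define q where "q = sqrt c"
    have q: "1 < q" "q * q = c" using c by (auto simp: q_def)
    have "\<exists>V. open V \<and> x \<in> V \<and> (\<forall>A\<in>sets M. A \<subseteq> V \<longrightarrow>
        emeasure N A \<le> ennreal c * emeasure (density M J) A \<and> emeasure (density M J) A \<le> ennreal c * emeasure N A)"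
      if x: "x \<in> S" for x
    proof -
      obtain V1 where V1: "open V1" "x \<in> V1" and
        V1N: "\<And>A. A \<in> sets M \<Longrightarrow> A \<subseteq> V1 \<Longrightarrow> emeasure N A \<le> ennreal (q * J x) * emeasure M A"
        and V1M: "\<And>A. A \<in> sets M \<Longrightarrow> A \<subseteq> V1 \<Longrightarrow> ennreal (J x) * emeasure M A \<le> ennreal q * emeasure N A"
        using loc[OF x q(1)] by blast
      have "J x \<in> {J x / q <..< q * J x}" using Jpos[OF x] q by (simp add: divide_less_eq)
      then obtain V2 where V2: "open V2" "x \<in> V2" "\<And>y. y \<in> S \<Longrightarrow> y \<in> V2 \<Longrightarrow> J x / q < J y \<and> J y < q * J x"
        using Jc x unfolding continuous_on_topological
        by (metis greaterThanLessThan_iff open_greaterThanLessThan)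
      show ?thesis
      proof (intro exI[of _ "V1 \<inter> V2"] conjI ballI impI)
        fix A assume A: "A \<in> sets M" "A \<subseteq> V1 \<inter> V2"
        then have AS: "A \<subseteq> S" using sets.sets_into_space spM by blast
        have Jb: "ennreal (J x / q) \<le> ennreal (J y)" "ennreal (J y) \<le> ennreal (q * J x)" if "y \<in> A" for y
        proof -
          have "y \<in> S" "y \<in> V2" using A(2) AS that by auto
          from V2(3)[OF this] show "ennreal (J x / q) \<le> ennreal (J y)" "ennreal (J y) \<le> ennreal (q * J x)"
            by (auto intro!: ennreal_leI)
        qed
        have dens: "emeasure (density M J) A = (\<integral>\<^sup>+y. ennreal (J y) * indicator A y \<partial>M)"
          using A by (simp add: emeasure_density)
        have const: "ennreal a * emeasure M A = (\<integral>\<^sup>+y. ennreal a * indicator A y \<partial>M)" for a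
          using A by (simp add: nn_integral_cmult_indicator)
        have "ennreal (J x / q) * emeasure M A \<le> emeasure (density M J) A"
          unfolding dens const using Jb by (intro nn_integral_mono) (auto simp: indicator_def)
        then have "ennreal c * (ennreal (J x / q) * emeasure M A) \<le> ennreal c * emeasure (density M J) A"
          by (rule mult_left_mono) simp
        moreover have "ennreal c * (ennreal (J x / q) * emeasure M A) = ennreal (q * J x) * emeasure M A"
        proof -
          have "c * (J x / q) = q * J x" using q by (simp add: field_simps)
          then show ?thesis using c q Jpos[OF x]
            by (simp add: mult.assoc[symmetric] ennreal_mult[symmetric])
        qed
        ultimately show "emeasure N A \<le> ennreal c * emeasure (density M J) A"
          using V1N[of A] A by (simp add: order_trans)
        have "emeasure (density M J) A \<le> ennreal (q * J x) * emeasure M A"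
          unfolding dens const using Jb by (intro nn_integral_mono) (auto simp: indicator_def)
        also have "\<dots> = ennreal q * (ennreal (J x) * emeasure M A)"
          using q Jpos[OF x] by (simp add: ennreal_mult mult.assoc)
        also have "\<dots> \<le> ennreal q * (ennreal q * emeasure N A)"
          using V1M[of A] A by (intro mult_left_mono) auto
        also have "\<dots> = ennreal c * emeasure N A"
          using q by (simp add: mult.assoc[symmetric] ennreal_mult[symmetric])
        finally show "emeasure (density M J) A \<le> ennreal c * emeasure N A" .
      qed (use V1 V2 in auto)
    qed
    then obtain V where V: "\<And>x. x \<in> S \<Longrightarrow> open (V x)" "\<And>x. x \<in> S \<Longrightarrow> x \<in> V x"
      and VA: "\<And>x A. x \<in> S \<Longrightarrow> A \<in> sets M \<Longrightarrow> A \<subseteq> V x \<Longrightarrow>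
        emeasure N A \<le> ennreal c * emeasure (density M J) A \<and> emeasure (density M J) A \<le> ennreal c * emeasure N A"
      by metis
    obtain \<F> where \<F>: "\<F> \<subseteq> V ` S" "countable \<F>" "\<Union>\<F> = \<Union>(V ` S)"
      using Lindelof[of "V ` S"] V(1) by blast
    show ?thesis
    proof (cases "S = {}")
      case True
      then have "A = {}" using A sets.sets_into_space spM by blast
      then show ?thesis by simp
    next
      case False
      then have ne: "\<F> \<noteq> {}" using \<F>(3) V(2) by blast
      define W where "W = from_nat_into \<F>"
      have rW: "range W = \<F>" unfolding W_def using range_from_nat_into[OF ne \<F>(2)] .
      define E where "E i = A \<inter> disjointed W i" for i
      have WV: "\<exists>x\<in>S. W i = V x" for i
      proof -
        have "W i \<in> \<F>" unfolding rW[symmetric] by (rule rangeI)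
        then show ?thesis using \<F>(1) by blast
      qed
      have Wopen: "open (W i)" for i using WV[of i] V(1) by auto
      have dm: "S \<inter> disjointed W i \<in> sets M" for i
      proof -
        have "disjointed W i \<in> sets borel"
          unfolding disjointed_def using Wopen by (intro sets.Diff sets.finite_UN) auto
        then show ?thesis unfolding setsM sets_restrict_space by blast
      qed
      have "E i = A \<inter> (S \<inter> disjointed W i)" for i
        using sets.sets_into_space[OF A] spM by (auto simp: E_def)
      then have EM: "E i \<in> sets M" for i using A dm by auto
      have Edis: "disjoint_family E"
        using disjoint_family_disjointed[of W] by (auto simp: E_def disjoint_family_on_def)
      have EU: "(\<Union>i. E i) = A"
      proof -
        have "A \<subseteq> \<Union>\<F>" unfolding \<F>(3) using V(2) sets.sets_into_space[OF A] spM by blast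
        then show ?thesis using UN_disjointed_eq[of W] rW by (auto simp: E_def)
      qed
      have EV: "emeasure N (E i) \<le> ennreal c * emeasure (density M J) (E i) \<and>
          emeasure (density M J) (E i) \<le> ennreal c * emeasure N (E i)" for i
      proof -
        obtain x where x: "x \<in> S" "W i = V x" using WV[of i] by blast
        show ?thesis
          using disjointed_subset[of W i] x by (intro VA[OF x(1) EM]) (auto simp: E_def)
      qed
      have sumN: "(\<Sum>i. emeasure N (E i)) = emeasure N A"
        using suminf_emeasure[of E N] EM Edis EU setsN by auto
      have sumM: "(\<Sum>i. emeasure (density M J) (E i)) = emeasure (density M J) A"
        using suminf_emeasure[of E "density M J"] EM Edis EU by auto
      have "(\<Sum>i. emeasure N (E i)) \<le> (\<Sum>i. ennreal c * emeasure (density M J) (E i))"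
        using EV by (intro suminf_le) auto
      moreover have "(\<Sum>i. emeasure (density M J) (E i)) \<le> (\<Sum>i. ennreal c * emeasure N (E i))"
        using EV by (intro suminf_le) auto
      ultimately show ?thesis by (simp add: sumN sumM)
    qed
  qed
  show "sets (density M J) = sets N" by (simp add: setsN)
  fix A assume "A \<in> sets (density M J)"
  then have A: "A \<in> sets M" by simp
  show "emeasure (density M J) A = emeasure N A"
  proof (rule antisym; rule ennreal_le_if_le_mult)
    fix c :: real assume "1 < c"
    from cover[OF A this] show "emeasure (density M J) A \<le> ennreal c * emeasure N A" by (rule conjunct2)
  next
    fix c :: real assume "1 < c"
    from cover[OF A this] show "emeasure N A \<le> ennreal c * emeasure (density M J) A" by (rule conjunct1)
  qed
qed

lemma continuous_on_gram_vol:
  fixes F :: "'b::topological_space \<Rightarrow> real^'k::finite \<Rightarrow> 'a::real_inner"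
  assumes "\<And>w. continuous_on X (\<lambda>x. F x w)"
  shows "continuous_on X (\<lambda>x. gram_vol (F x))"
  unfolding gram_vol_def gram_def det_def by (intro continuous_intros) (auto intro!: continuous_intros assms)

text \<open>The closure of \<open>S\<close> lies in the image of \<open>\<Phi>\<close>, in which \<open>S\<close> is relatively open; so \<open>S\<close> is the intersection of its closure
  with an open set.\<close>

lemma borel_regular_parametrization:
  assumes "regular_parametrization U \<Phi> D p S"
  shows "S \<in> sets borel"
proof -
  obtain O' where O': "open O'" "S = \<Phi> ` U \<inter> O'"
    using assms unfolding regular_parametrization_def openin_open by blast
  have "S = closure S \<inter> O'"
    using O'(2) assms closure_subset[of S] unfolding regular_parametrization_def by blast
  then show ?thesis using O'(1) by (metis borel_closed borel_open closed_closure sets.Int)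
qed

lemma regular_parametrization_linear_image:
  fixes T :: "real^'n \<Rightarrow> real^'n"
  assumes R: "regular_parametrization U \<Phi> D p S" and T: "linear T" "bij T"
  shows "regular_parametrization U (T \<circ> \<Phi>) (\<lambda>x. Blinfun T o\<^sub>L D x) (p \<circ> inv T) (T ` S)"
proof -
  have bl: "bounded_linear T" using T(1) by (simp add: linear_conv_bounded_linear)
  have I: "linear (inv T)" using T by (simp add: bij_is_inj inj_linear_imp_inv_linear)
  have cT: "continuous_on X T" for X using T(1) by (simp add: linear_continuous_on linear_conv_bounded_linear)
  have hom: "homeomorphism UNIV UNIV T (inv T)"
    using T I bij_is_surj[OF bij_imp_bij_inv[OF T(2)]]
    by (simp add: homeomorphism_def linear_continuous_on linear_conv_bounded_linear bij_is_inj bij_is_surj surj_f_inv_f)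
  have cl: "closure (T ` S) = T ` closure S"
    using closure_injective_linear_image[OF T(1) bij_is_inj[OF T(2)]] by simp
  have openT: "open (T ` X)" if "open X" for X
    using homeomorphism_imp_open_map[OF hom, of X] that by simp
  obtain O' where O': "open O'" "S = \<Phi> ` U \<inter> O'"
    using R unfolding regular_parametrization_def openin_open by blast
  have "T ` S = (T \<circ> \<Phi>) ` U \<inter> T ` O'"
    using O'(2) T(2) by (auto simp: image_Int[OF bij_is_inj] image_comp)
  then have "openin (top_of_set ((T \<circ> \<Phi>) ` U)) (T ` S)"
    unfolding openin_open using openT[OF O'(1)] by blast
  moreover have "compact (closure (T ` S))" "closure (T ` S) \<subseteq> (T \<circ> \<Phi>) ` U"
    using R cT unfolding cl regular_parametrization_def
    by (auto intro: compact_continuous_image simp: image_comp[symmetric])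
  moreover have "((T \<circ> \<Phi>) has_derivative blinfun_apply (Blinfun T o\<^sub>L D x)) (at x)" if "x \<in> U" for x
  proof -
    have "(\<Phi> has_derivative blinfun_apply (D x)) (at x)"
      using R that by (simp add: regular_parametrization_def)
    from bounded_linear.has_derivative[OF bl this] show ?thesis
      by (simp add: bounded_linear_Blinfun_apply[OF bl] o_def blinfun_compose.rep_eq)
  qed
  moreover have "continuous_on U (\<lambda>x. Blinfun T o\<^sub>L D x)"
    using R unfolding regular_parametrization_def by (auto intro!: continuous_intros)
  ultimately show ?thesis
    using R T I unfolding regular_parametrization_def
    by (auto simp: bij_is_inj intro!: linear_compose[OF I, of p])
qed

definition tangential_jacobian ::
  "('a \<Rightarrow> 'b::euclidean_space) \<Rightarrow> (real^'k::finite \<Rightarrow> (real^'k) \<Rightarrow>\<^sub>L 'a::euclidean_space) \<Rightarrow> ('a \<Rightarrow> real^'k) \<Rightarrow> 'a \<Rightarrow> real" where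
  "tangential_jacobian T D p x = gram_vol (T \<circ> blinfun_apply (D (p x))) / gram_vol (blinfun_apply (D (p x)))"

context
  fixes U :: "(real^'k::finite) set" and \<Phi> D p and S :: "(real^'n::finite) set" and T :: "real^'n \<Rightarrow> real^'n"
  assumes R: "regular_parametrization U \<Phi> D p S" and T: "linear T" "bij T"
begin

lemma
  shows gram_vol_derivative_pos: "x \<in> U \<Longrightarrow> 0 < gram_vol (blinfun_apply (D x))"
    "x \<in> U \<Longrightarrow> 0 < gram_vol (T \<circ> blinfun_apply (D x))"
    and tangential_jacobian_continuous: "continuous_on (\<Phi> ` U) (tangential_jacobian T D p)"
proof -
  have der: "inj (blinfun_apply (D x))" if "x \<in> U" for x
    using R that unfolding regular_parametrization_def
    by (intro inj_derivative_retraction[of U x \<Phi> "D x" p]) auto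
  have lin: "linear (blinfun_apply (D x))" for x
    by (simp add: bounded_linear.linear blinfun.bounded_linear_right)
  show 1: "0 < gram_vol (blinfun_apply (D x))" if "x \<in> U" for x
    by (rule gram_vol_pos[OF lin der[OF that]])
  show 2: "0 < gram_vol (T \<circ> blinfun_apply (D x))" if "x \<in> U" for x
    using der[OF that] T lin by (intro gram_vol_pos linear_compose inj_compose) (auto simp: bij_is_inj)
  have cp: "continuous_on X p" for X
    using R by (simp add: regular_parametrization_def linear_continuous_on linear_conv_bounded_linear)
  have cT: "continuous_on X T" for X
    using T by (simp add: linear_continuous_on linear_conv_bounded_linear)
  have pU: "p ` \<Phi> ` U \<subseteq> U" using R by (auto simp: regular_parametrization_def)
  have cD: "continuous_on (\<Phi> ` U) (\<lambda>x. blinfun_apply (D (p x)) w)" for w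
  proof -
    have "continuous_on U D" using R by (simp add: regular_parametrization_def)
    from continuous_on_compose2[OF this cp pU] show ?thesis
      by (intro continuous_intros)
  qed
  have cTD: "continuous_on (\<Phi> ` U) (\<lambda>x. (T \<circ> blinfun_apply (D (p x))) w)" for w
    using continuous_on_compose2[OF cT[of UNIV] cD, of w] by simp
  have "gram_vol (blinfun_apply (D (p x))) \<noteq> 0" if "x \<in> \<Phi> ` U" for x
    using 1[of "p x"] pU that by fastforce
  then show "continuous_on (\<Phi> ` U) (tangential_jacobian T D p)"
    unfolding tangential_jacobian_def
    by (intro continuous_on_divide continuous_on_gram_vol cD cTD) auto
qed

text \<open>The Jacobian is continuous and positive on the compact closure of \<open>S\<close>.\<close>

lemma tangential_jacobian_bounds:
  obtains c C where "0 < c" "\<And>x. x \<in> S \<Longrightarrow> c \<le> tangential_jacobian T D p x"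
    "\<And>x. x \<in> S \<Longrightarrow> tangential_jacobian T D p x \<le> C"
proof (cases "S = {}")
  case False
  let ?J = "tangential_jacobian T D p"
  have K: "compact (closure S)" "closure S \<subseteq> \<Phi> ` U" "closure S \<noteq> {}"
    using R False by (auto simp: regular_parametrization_def)
  have cJ: "continuous_on (closure S) ?J"
    using tangential_jacobian_continuous K(2) by (rule continuous_on_subset)
  obtain a where a: "a \<in> closure S" "\<And>y. y \<in> closure S \<Longrightarrow> ?J a \<le> ?J y"
    using continuous_attains_inf[OF K(1,3) cJ] by blast
  obtain b where b: "\<And>y. y \<in> closure S \<Longrightarrow> ?J y \<le> ?J b"
    using continuous_attains_sup[OF K(1,3) cJ] by blast
  have "p a \<in> U" using a(1) K(2) R by (auto simp: regular_parametrization_def)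
  then have "0 < ?J a" by (simp add: tangential_jacobian_def gram_vol_derivative_pos)
  then show thesis using a(2) b closure_subset[of S] by (intro that[of "?J a" "?J b"]) auto
qed (use that[of 1 1] in auto)

text \<open>Both \<open>\<Phi>\<close> and \<open>T \<circ> \<Phi>\<close> are compared with their linearisations at the same parameter, on a ball where both comparisons
  hold. The ratio of the two volumes is then within a factor \<open>q\<close> of the tangential Jacobian.\<close>

lemma surface_measure_linear_image:
  "surface_measure CARD('k) (T ` S) =
     distr (density (surface_measure CARD('k) S) (tangential_jacobian T D p)) (surface_measure CARD('k) (T ` S)) T"
proof -
  let ?k = "CARD('k)" and ?J = "tangential_jacobian T D p"
  let ?M = "surface_measure ?k S" and ?M' = "surface_measure ?k (T ` S)"
  let ?H = "hausdorff_outer_measure ?k :: (real^'n) set \<Rightarrow> ennreal"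
  note R' = regular_parametrization_linear_image[OF R T]
  have I: "linear (inv T)" using T by (simp add: bij_is_inj inj_linear_imp_inv_linear)
  have Tm: "T \<in> borel_measurable borel" and Im: "inv T \<in> borel_measurable borel"
    using T(1) I by (auto intro!: borel_measurable_continuous_onI simp: linear_continuous_on linear_conv_bounded_linear)
  have IT: "inv T (T x) = x" and TI: "T (inv T x) = x" for x
    using T(2) by (auto simp: bij_is_inj bij_is_surj surj_f_inv_f)
  have TA: "T ` A = inv T -` A" for A
  proof safe
    fix x assume "inv T x \<in> A"
    then have "T (inv T x) \<in> T ` A" by (rule imageI)
    then show "x \<in> T ` A" by (simp add: TI)
  qed (simp add: IT)
  have Tborel: "T ` A \<in> sets borel" if "A \<in> sets borel" for A
    unfolding TA using Im that by (rule measurable_sets_borel)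
  have S: "S \<in> sets borel" "T ` S \<in> sets borel"
    using borel_regular_parametrization[OF R] Tborel by auto
  have setsM: "sets (surface_measure ?k X) = sets (restrict_space borel X)" for X :: "(real^'n) set"
    unfolding surface_measure_def by (rule sets_restrict_space_cong) simp
  have sp: "space (surface_measure ?k X) = X" for X :: "(real^'n) set"
    by (simp add: surface_measure_def space_restrict_space)
  have sets_iff: "A \<in> sets (surface_measure ?k X) \<longleftrightarrow> A \<in> sets borel \<and> A \<subseteq> X" if "X \<in> sets borel" for A X :: "(real^'n) set"
    using that unfolding setsM by (auto simp: sets_restrict_space_iff)
  have em: "emeasure (surface_measure ?k X) A = ?H A"
    if "X \<in> sets borel" "A \<in> sets borel" "A \<subseteq> X" for A X :: "(real^'n) set"
    unfolding surface_measure_def using that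
    by (subst emeasure_restrict_space) (auto simp: emeasure_hausdorff_measure)
  have Imeas: "inv T \<in> measurable ?M' ?M" and Tmeas: "T \<in> measurable ?M ?M'"
    using Tm Im unfolding measurable_cong_sets[OF setsM setsM]
    by (auto intro!: measurable_restrict_space3 simp: IT)
  \<comment> \<open>The set function \<open>A \<mapsto> H\<^sup>k(T A)\<close> on \<open>S\<close>, as a measure.\<close>
  define N where "N = distr ?M' ?M (inv T)"
  have emN: "emeasure N A = ?H (T ` A)" if "A \<in> sets ?M" for A
  proof -
    have A: "A \<in> sets borel" "A \<subseteq> S" using that sets_iff[OF S(1)] by auto
    have "inv T -` A \<inter> space ?M' = T ` A" using A(2) by (auto simp: sp TA[symmetric])
    then show ?thesis
      using that A Tborel[OF A(1)] by (simp add: N_def emeasure_distr[OF Imeas] em S image_mono)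
  qed
  have U: "open U" "\<And>x. x \<in> U \<Longrightarrow> (\<Phi> has_derivative blinfun_apply (D x)) (at x)" "continuous_on U D"
    "linear p" "\<And>x. x \<in> U \<Longrightarrow> p (\<Phi> x) = x"
    using R by (auto simp: regular_parametrization_def)
  let ?D' = "\<lambda>x. Blinfun T o\<^sub>L D x"
  have U': "\<And>x. x \<in> U \<Longrightarrow> ((T \<circ> \<Phi>) has_derivative blinfun_apply (?D' x)) (at x)" "continuous_on U ?D'"
    "linear (p \<circ> inv T)" "\<And>x. x \<in> U \<Longrightarrow> (p \<circ> inv T) ((T \<circ> \<Phi>) x) = x"
    using R' by (auto simp: regular_parametrization_def)
  have D': "blinfun_apply (?D' x) = T \<circ> blinfun_apply (D x)" for x
    using T(1) by (simp add: fun_eq_iff bounded_linear_Blinfun_apply linear_conv_bounded_linear)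
  have "density ?M ?J = N"
  proof (rule density_of_local_ratio[OF setsM])
    show "sets N = sets ?M" by (simp add: N_def)
    show "continuous_on S ?J"
      using R closure_subset[of S] by (intro continuous_on_subset[OF tangential_jacobian_continuous])
        (auto simp: regular_parametrization_def)
    fix x assume x: "x \<in> S"
    define u where "u = p x"
    have u: "u \<in> U" "\<Phi> u = x"
      using x R closure_subset[of S] by (auto simp: u_def regular_parametrization_def)
    let ?g = "gram_vol (blinfun_apply (D u))" and ?g' = "gram_vol (T \<circ> blinfun_apply (D u))"
    have g: "0 < ?g" "0 < ?g'" using gram_vol_derivative_pos[OF u(1)] by auto
    have J: "?J x = ?g' / ?g" by (simp add: tangential_jacobian_def u_def)
    then show "0 < ?J x" using g by simp
    fix q :: real assume q: "1 < q"
    define s where "s = sqrt q"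
    have s: "1 < s" "s * s = q" using q by (auto simp: s_def)
    obtain r1 where r1: "0 < r1" "ball u r1 \<subseteq> U" and
      h1: "\<And>B. B \<in> sets borel \<Longrightarrow> B \<subseteq> ball u r1 \<Longrightarrow>
         ?H (\<Phi> ` B) \<le> ennreal s * (ennreal ?g * hausdorff_outer_measure ?k B)"
      "\<And>B. B \<in> sets borel \<Longrightarrow> B \<subseteq> ball u r1 \<Longrightarrow>
         ennreal ?g * hausdorff_outer_measure ?k B \<le> ennreal s * ?H (\<Phi> ` B)"
      using hausdorff_parametrization_local[OF U u(1) s(1)] by blast
    obtain r2 where r2: "0 < r2" "ball u r2 \<subseteq> U" and
      h2': "\<And>B. B \<in> sets borel \<Longrightarrow> B \<subseteq> ball u r2 \<Longrightarrow>
         ?H ((T \<circ> \<Phi>) ` B) \<le> ennreal s * (ennreal (gram_vol (?D' u)) * hausdorff_outer_measure ?k B)"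
      "\<And>B. B \<in> sets borel \<Longrightarrow> B \<subseteq> ball u r2 \<Longrightarrow>
         ennreal (gram_vol (?D' u)) * hausdorff_outer_measure ?k B \<le> ennreal s * ?H ((T \<circ> \<Phi>) ` B)"
      by (rule hausdorff_parametrization_local[OF U(1) U' u(1) s(1)], assumption, assumption) (rule that)
    note h2 = h2'[unfolded D']
    define r where "r = min r1 r2"
    have r: "0 < r" "ball u r \<subseteq> U" using r1 r2 by (auto simp: r_def)
    have cp: "continuous_on UNIV p" using U(4) by (simp add: linear_continuous_on linear_conv_bounded_linear)
    have c\<Phi>: "continuous_on U \<Phi>"
      using U(2) by (intro continuous_at_imp_continuous_on) (auto intro: has_derivative_continuous)
    show "\<exists>V. open V \<and> x \<in> V \<and> (\<forall>A\<in>sets ?M. A \<subseteq> V \<longrightarrow>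
        emeasure N A \<le> ennreal (q * ?J x) * emeasure ?M A \<and>
        ennreal (?J x) * emeasure ?M A \<le> ennreal q * emeasure N A)"
    proof (intro exI[of _ "p -` ball u r"] conjI ballI impI)
      show "open (p -` ball u r)" using cp by (simp add: continuous_on_open_vimage)
      show "x \<in> p -` ball u r" using r(1) by (simp add: u_def)
      fix A assume A: "A \<in> sets ?M" "A \<subseteq> p -` ball u r"
      then have A': "A \<in> sets borel" "A \<subseteq> S" using sets_iff[OF S(1)] by auto
      define B where "B = {v \<in> ball u r. \<Phi> v \<in> A}"
      have "B \<in> sets borel"
      proof -
        have "continuous_on (ball u r) \<Phi>" using c\<Phi> r(2) by (rule continuous_on_subset)
        then have "\<Phi> \<in> borel_measurable (restrict_space borel (ball u r))"
          by (rule borel_measurable_continuous_on_restrict)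
        from measurable_sets[OF this A'(1)] have "\<Phi> -` A \<inter> ball u r \<in> sets (restrict_space borel (ball u r))"
          by (simp add: space_restrict_space)
        then show ?thesis by (simp add: sets_restrict_space_iff B_def vimage_def Int_def conj_commute)
      qed
      moreover have "B \<subseteq> ball u r1" "B \<subseteq> ball u r2" by (auto simp: B_def r_def)
      moreover have \<Phi>B: "\<Phi> ` B = A"
      proof (intro equalityI subsetI)
        fix y assume "y \<in> A"
        then have "y \<in> \<Phi> ` U"
          using A'(2) R closure_subset[of S] unfolding regular_parametrization_def by blast
        then obtain v where v: "v \<in> U" "y = \<Phi> v" by blast
        then have "v \<in> ball u r" using A(2) \<open>y \<in> A\<close> U(5)[OF v(1)] by auto
        then show "y \<in> \<Phi> ` B" using v \<open>y \<in> A\<close> by (auto simp: B_def)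
      qed (auto simp: B_def)
      moreover have "(T \<circ> \<Phi>) ` B = T ` A" using \<Phi>B by (metis image_comp)
      ultimately have h: "?H A \<le> ennreal s * (ennreal ?g * hausdorff_outer_measure ?k B)"
          "ennreal ?g * hausdorff_outer_measure ?k B \<le> ennreal s * ?H A"
          "?H (T ` A) \<le> ennreal s * (ennreal ?g' * hausdorff_outer_measure ?k B)"
          "ennreal ?g' * hausdorff_outer_measure ?k B \<le> ennreal s * ?H (T ` A)"
        using h1[of B] h2[of B] by simp_all
      have gg: "ennreal ?g' = ennreal (?J x) * ennreal ?g" using g by (simp add: J ennreal_mult[symmetric])
      have "?H (T ` A) \<le> ennreal s * (ennreal (?J x) * (ennreal ?g * hausdorff_outer_measure ?k B))"
        using h(3) by (simp add: gg mult.assoc)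
      also have "\<dots> \<le> ennreal s * (ennreal (?J x) * (ennreal s * ?H A))"
        using h(2) by (intro mult_left_mono) auto
      also have "\<dots> = ennreal (q * ?J x) * ?H A"
      proof -
        have eq: "s * (?J x * s) = q * ?J x" by (simp only: s(2)[symmetric] mult_ac)
        have "0 \<le> ?J x" using g by (simp add: J)
        then have "ennreal s * (ennreal (?J x) * ennreal s) = ennreal (s * (?J x * s))"
          using s(1) by (simp add: ennreal_mult)
        then have "ennreal s * (ennreal (?J x) * ennreal s) = ennreal (q * ?J x)"
          unfolding eq .
        then show ?thesis by (simp only: mult.assoc[symmetric])
      qed
      finally show "emeasure N A \<le> ennreal (q * ?J x) * emeasure ?M A"
        using emN[OF A(1)] em[OF S(1) A'] by simp
      have "ennreal (?J x) * ?H A \<le> ennreal (?J x) * (ennreal s * (ennreal ?g * hausdorff_outer_measure ?k B))"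
        using h(1) by (intro mult_left_mono) auto
      also have "\<dots> = ennreal s * (ennreal ?g' * hausdorff_outer_measure ?k B)"
        by (simp add: gg mult_ac)
      also have "\<dots> \<le> ennreal s * (ennreal s * ?H (T ` A))"
        using h(4) by (intro mult_left_mono) auto
      also have "\<dots> = ennreal q * ?H (T ` A)"
        using s by (simp add: mult.assoc[symmetric] ennreal_mult[symmetric])
      finally show "ennreal (?J x) * emeasure ?M A \<le> ennreal q * emeasure N A"
        using emN[OF A(1)] em[OF S(1) A'] by simp
    qed
  qed
  then have "distr (density ?M ?J) ?M' T = distr (distr ?M' ?M (inv T)) ?M' T" by (simp add: N_def)
  also have "\<dots> = distr ?M' ?M' (T \<circ> inv T)" by (rule distr_distr[OF Tmeas Imeas])
  also have "\<dots> = ?M'" by (simp add: comp_def TI distr_id2)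
  finally show ?thesis ..
qed

end

section \<open>Tangent and normal spaces of regular pieces\<close>

text \<open>The rotated graph map is the parametrisation, and \<open>p\<close> rotates back and drops the graph coordinates. The Hoelder bound enters
  through the continuity of the derivative.\<close>

lemma regular_piece_parametrization:
  fixes \<phi> :: "real^'k::finite \<Rightarrow> real^'m::finite" and S :: "(real^'n::finite) set"
  assumes piece: "regular_piece \<beta> b R U \<phi> S" and \<beta>: "0 < \<beta>" and b: "0 < b"
  obtains e :: "'n \<Rightarrow> 'k + 'm" and \<Phi> D p where "bij e" "regular_parametrization U \<Phi> D p S"
proof -
  obtain e :: "'n \<Rightarrow> 'k + 'm" and G where e: "bij e" and G: "orthogonal_transformation G"
    and S: "openin (top_of_set (G ` graph_of e U \<phi>)) S" "compact (closure S)" "closure S \<subseteq> G ` graph_of e U \<phi>"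
    and U: "open U" and hb: "C1_hoelder_bound \<beta> b R U \<phi>"
    using piece unfolding regular_piece_def by blast
  obtain D\<phi> :: "real^'k \<Rightarrow> (real^'k) \<Rightarrow>\<^sub>L (real^'m)" where D\<phi>: "\<And>x. x \<in> U \<Longrightarrow> (\<phi> has_derivative blinfun_apply (D\<phi> x)) (at x)"
    and bound: "ennreal (R powr (- \<beta>)) * (SUP x\<in>U. ennreal (norm (D\<phi> x)))
          + (SUP x\<in>U. SUP x'\<in>U - {x}. ennreal (norm (D\<phi> x - D\<phi> x') / norm (x - x') powr \<beta>)) \<le> ennreal b"
    using hb unfolding C1_hoelder_bound_def by blast
  have hoelder: "norm (D\<phi> x - D\<phi> y) \<le> b * norm (x - y) powr \<beta>" if "x \<in> U" "y \<in> U" for x y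
  proof (cases "x = y")
    case False
    have "ennreal (norm (D\<phi> x - D\<phi> y) / norm (x - y) powr \<beta>)
        \<le> (SUP x'\<in>U - {x}. ennreal (norm (D\<phi> x - D\<phi> x') / norm (x - x') powr \<beta>))"
      using that False by (intro SUP_upper) auto
    also have "\<dots> \<le> (SUP x\<in>U. SUP x'\<in>U - {x}. ennreal (norm (D\<phi> x - D\<phi> x') / norm (x - x') powr \<beta>))"
      using that(1) by (rule SUP_upper)
    also have "\<dots> \<le> ennreal b"
      using bound by (rule order_trans[rotated]) simp
    finally have "norm (D\<phi> x - D\<phi> y) / norm (x - y) powr \<beta> \<le> b"
      using b by (simp add: ennreal_le_iff)
    then show ?thesis using False by (simp add: divide_le_eq)
  qed simp
  have cD\<phi>: "continuous_on U D\<phi>"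
    unfolding continuous_on_iff
  proof (intro ballI allI impI)
    fix x and \<epsilon> :: real assume x: "x \<in> U" and \<epsilon>: "0 < \<epsilon>"
    \<comment> \<open>The solution of \<open>b \<delta>\<^sup>\<beta> = \<epsilon>\<close>.\<close>
    define \<delta> where "\<delta> = (\<epsilon> / b) powr (1 / \<beta>)"
    have \<delta>: "0 < \<delta>" "\<delta> powr \<beta> = \<epsilon> / b" using \<epsilon> b \<beta> by (auto simp: \<delta>_def powr_powr)
    show "\<exists>\<delta>>0. \<forall>y\<in>U. dist y x < \<delta> \<longrightarrow> dist (D\<phi> y) (D\<phi> x) < \<epsilon>"
    proof (intro exI[of _ \<delta>] conjI ballI impI)
      fix y assume y: "y \<in> U" "dist y x < \<delta>"
      have "norm (D\<phi> y - D\<phi> x) \<le> b * norm (y - x) powr \<beta>" by (rule hoelder[OF y(1) x])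
      also have "norm (y - x) powr \<beta> < \<delta> powr \<beta>"
        using y(2) \<beta> by (intro powr_less_mono2) (auto simp: dist_norm)
      then have "b * norm (y - x) powr \<beta> < b * (\<delta> powr \<beta>)" using b by simp
      also have "\<dots> = \<epsilon>" using \<delta>(2) b by simp
      finally show "dist (D\<phi> y) (D\<phi> x) < \<epsilon>" by (simp add: dist_norm)
    qed (rule \<delta>)
  qed
  define E1 :: "real^'k \<Rightarrow> real^'n" where "E1 x = (\<chi> j. case e j of Inl a \<Rightarrow> x $ a | Inr c \<Rightarrow> 0)" for x
  define E2 :: "real^'m \<Rightarrow> real^'n" where "E2 y = (\<chi> j. case e j of Inl a \<Rightarrow> 0 | Inr c \<Rightarrow> y $ c)" for y
  have "linear E1" by (rule linearI) (auto simp: E1_def vec_eq_iff split: sum.split)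
  moreover have "linear E2" by (rule linearI) (auto simp: E2_def vec_eq_iff split: sum.split)
  moreover have Gl: "linear G" using G by (simp add: orthogonal_transformation_def)
  ultimately have "linear (G \<circ> E1)" "linear (G \<circ> E2)" by (auto intro: linear_compose)
  then have bl: "bounded_linear (G \<circ> E1)" "bounded_linear (G \<circ> E2)" by (auto simp: linear_conv_bounded_linear)
  define \<Phi> where "\<Phi> x = G (\<chi> j. case e j of Inl a \<Rightarrow> x $ a | Inr c \<Rightarrow> \<phi> x $ c)" for x
  have \<Phi>: "\<Phi> x = (G \<circ> E1) x + (G \<circ> E2) (\<phi> x)" for x
  proof -
    have "(\<chi> j. case e j of Inl a \<Rightarrow> x $ a | Inr c \<Rightarrow> \<phi> x $ c) = E1 x + E2 (\<phi> x)"
      by (auto simp: E1_def E2_def vec_eq_iff split: sum.split)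
    then show ?thesis by (simp add: \<Phi>_def linear_add[OF Gl])
  qed
  have image: "G ` graph_of e U \<phi> = \<Phi> ` U" by (simp add: graph_of_def image_image \<Phi>_def)
  define D where "D x = Blinfun (G \<circ> E1) + (Blinfun (G \<circ> E2) o\<^sub>L D\<phi> x)" for x
  define p where "p z = (\<chi> a. inv G z $ inv e (Inl a))" for z
  have invG: "linear (inv G)" "inv G (G z) = z" for z
    using G orthogonal_transformation_inj[OF G] by (auto intro: inj_linear_imp_inv_linear[OF Gl])
  have "regular_parametrization U \<Phi> D p S"
    unfolding regular_parametrization_def
  proof (intro conjI ballI)
    fix x assume x: "x \<in> U"
    have "((\<lambda>x. (G \<circ> E1) x + (G \<circ> E2) (\<phi> x)) has_derivative
        (\<lambda>w. (G \<circ> E1) w + (G \<circ> E2) (blinfun_apply (D\<phi> x) w))) (at x)"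
      by (intro has_derivative_add bounded_linear_imp_has_derivative bl
          bounded_linear.has_derivative[OF bl(2)] D\<phi> x)
    moreover have "blinfun_apply (D x) = (\<lambda>w. (G \<circ> E1) w + (G \<circ> E2) (blinfun_apply (D\<phi> x) w))"
      by (simp add: D_def fun_eq_iff plus_blinfun.rep_eq bounded_linear_Blinfun_apply[OF bl(1)] bounded_linear_Blinfun_apply[OF bl(2)])
    ultimately show "(\<Phi> has_derivative blinfun_apply (D x)) (at x)" by (simp add: \<Phi>[abs_def])
    show "p (\<Phi> x) = x"
      by (simp add: p_def \<Phi>_def invG vec_eq_iff surj_f_inv_f[OF bij_is_surj[OF e]])
  next
    show "continuous_on U D" unfolding D_def by (intro continuous_intros cD\<phi>)
    show "linear p"
      using invG(1) by (intro linearI) (auto simp: p_def vec_eq_iff linear_add linear_scale)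
  qed (use S U in \<open>auto simp: image\<close>)
  with e show thesis by (rule that)
qed

text \<open>A curve \<open>\<gamma>\<close> in \<open>S\<close> equals \<open>\<Phi> \<circ> p \<circ> \<gamma>\<close>, so its velocity is in the range of the derivative. Conversely \<open>\<Phi>\<close> maps short
  segments through the parameter into \<open>S\<close>, because \<open>S\<close> is relatively open.\<close>

lemma tangent_space_parametrization:
  fixes S :: "'a::euclidean_space set"
  assumes R: "regular_parametrization U \<Phi> D p S" and x: "x \<in> S"
  shows "tangent_space S x = range (blinfun_apply (D (p x)))"
proof -
  have U: "open U" "\<And>u. u \<in> U \<Longrightarrow> (\<Phi> has_derivative blinfun_apply (D u)) (at u)" "linear p"
      "\<And>u. u \<in> U \<Longrightarrow> p (\<Phi> u) = u"
    using R by (auto simp: regular_parametrization_def)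
  obtain O' where O': "open O'" "S = \<Phi> ` U \<inter> O'"
    using R unfolding regular_parametrization_def openin_open by blast
  have pS: "p y \<in> U" "\<Phi> (p y) = y" if "y \<in> S" for y using that O'(2) U(4) by auto
  have bp: "bounded_linear p" using U(3) by (simp add: linear_conv_bounded_linear)
  let ?u = "p x"
  note der = U(2)[OF pS(1)[OF x]]
  show ?thesis
  proof (intro equalityI subsetI)
    fix v assume "v \<in> tangent_space S x"
    then obtain \<gamma> \<epsilon> where \<epsilon>: "0 < \<epsilon>" and \<gamma>: "\<gamma> 0 = x" "\<And>t::real. \<bar>t\<bar> < \<epsilon> \<Longrightarrow> \<gamma> t \<in> S"
      and v: "(\<gamma> has_vector_derivative v) (at 0)"
      unfolding tangent_space_def by blast
    have "((\<lambda>t. p (\<gamma> t)) has_derivative (\<lambda>t. p (t *\<^sub>R v))) (at 0)"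
      using bounded_linear.has_derivative[OF bp] v unfolding has_vector_derivative_def by blast
    moreover have "(\<Phi> has_derivative blinfun_apply (D ?u)) (at (p (\<gamma> 0)))" using der \<gamma>(1) by simp
    ultimately have "((\<lambda>t. \<Phi> (p (\<gamma> t))) has_derivative (\<lambda>t. D ?u (p (t *\<^sub>R v)))) (at 0)"
      by (rule has_derivative_compose)
    then have "((\<lambda>t. \<Phi> (p (\<gamma> t))) has_vector_derivative D ?u (p v)) (at 0)"
      by (simp add: has_vector_derivative_def linear_scale[OF U(3)] blinfun.scaleR_right)
    then have "(\<gamma> has_vector_derivative D ?u (p v)) (at 0)"
      by (rule has_vector_derivative_transform_within_open[where S="ball 0 \<epsilon>"])
         (use \<epsilon> \<gamma>(2) pS(2) in auto)
    then have "v = D ?u (p v)" using v by (rule vector_derivative_unique_at[rotated])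
    then show "v \<in> range (blinfun_apply (D ?u))" by (rule range_eqI)
  next
    fix v assume "v \<in> range (blinfun_apply (D ?u))"
    then obtain w where v: "v = D ?u w" by blast
    define l where "l t = ?u + t *\<^sub>R w" for t :: real
    have l0: "l 0 = ?u" by (simp add: l_def)
    have dl: "(l has_derivative (\<lambda>t. t *\<^sub>R w)) (at 0)"
      unfolding l_def by (auto intro!: derivative_eq_intros)
    have "(\<Phi> has_derivative blinfun_apply (D ?u)) (at (l 0))" using der l0 by simp
    with dl have "((\<lambda>t. \<Phi> (l t)) has_derivative (\<lambda>t. D ?u (t *\<^sub>R w))) (at 0)"
      by (rule has_derivative_compose)
    then have d: "((\<lambda>t. \<Phi> (l t)) has_vector_derivative v) (at 0)"
      by (simp add: has_vector_derivative_def blinfun.scaleR_right v)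
    have "l \<midarrow>0\<rightarrow> ?u" "(\<lambda>t. \<Phi> (l t)) \<midarrow>0\<rightarrow> x"
      using has_derivative_continuous[OF dl] has_vector_derivative_continuous[OF d] l0 pS(2)[OF x]
      by (auto simp: isCont_def)
    then have "\<forall>\<^sub>F t in at 0. l t \<in> U" "\<forall>\<^sub>F t in at 0. \<Phi> (l t) \<in> O'"
      using U(1) pS(1)[OF x] O' x by (auto elim!: topological_tendstoD)
    then have "\<forall>\<^sub>F t in at 0. \<Phi> (l t) \<in> S"
      by eventually_elim (auto simp: O'(2))
    then obtain \<epsilon> where \<epsilon>: "0 < \<epsilon>" "\<And>t. t \<noteq> 0 \<Longrightarrow> dist t 0 < \<epsilon> \<Longrightarrow> \<Phi> (l t) \<in> S"
      unfolding eventually_at by blast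
    have "\<Phi> (l t) \<in> S" if "\<bar>t\<bar> < \<epsilon>" for t
      using \<epsilon>(2)[of t] that x l0 pS(2)[OF x] by (cases "t = 0") auto
    then show "v \<in> tangent_space S x"
      unfolding tangent_space_def using d \<epsilon>(1) l0 pS(2)[OF x]
      by (intro CollectI exI[of _ "\<lambda>t. \<Phi> (l t)"] exI[of _ \<epsilon>]) auto
  qed
qed

lemma ex_orthonormal_basis:
  fixes N :: "'a::euclidean_space set"
  assumes "subspace N" "dim N = CARD('m::finite)"
  shows "\<exists>B :: 'm \<Rightarrow> 'a. is_orthonormal_basis B N"
proof -
  obtain X where X: "X \<subseteq> N" "pairwise orthogonal X" "\<And>x. x \<in> X \<Longrightarrow> norm x = 1"
    "independent X" "card X = dim N" "span X = N"
    using orthonormal_basis_subspace[OF assms(1)] by blast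
  have "finite X" using X(4) by (rule independent_imp_finite)
  then obtain B :: "'m \<Rightarrow> 'a" where B: "bij_betw B UNIV X"
    using finite_same_card_bij[of "UNIV :: 'm set" X] X(5) assms(2) by auto
  have "B i \<bullet> B j = (if i = j then 1 else 0)" for i j
  proof (cases "i = j")
    case True
    have "B i \<in> X" using B by (auto simp: bij_betw_def)
    then show ?thesis using True X(3)[of "B i"] by (simp add: norm_eq_1)
  next
    case False
    then have "B i \<noteq> B j" "B i \<in> X" "B j \<in> X" using B by (auto simp: bij_betw_def inj_eq)
    then show ?thesis using X(2) False by (auto simp: pairwise_def orthogonal_def)
  qed
  then have "is_orthonormal_basis B N"
    using X(6) B by (simp add: is_orthonormal_basis_def bij_betw_def)
  then show ?thesis by blast
qed

lemma normal_space_has_orthonormal_basis: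
  fixes S :: "(real^'n::finite) set" and e :: "'n \<Rightarrow> 'k::finite + 'm::finite"
  assumes R: "regular_parametrization U (\<Phi> :: real^'k \<Rightarrow> real^'n) D p S" and x: "x \<in> S" and e: "bij e"
  shows "\<exists>B :: 'm \<Rightarrow> real^'n. is_orthonormal_basis B (normal_space S x)"
proof (rule ex_orthonormal_basis)
  show "subspace (normal_space S x)" unfolding normal_space_def by (rule subspace_orthogonal_comp)
  let ?L = "blinfun_apply (D (p x))"
  have L: "linear ?L" by (simp add: bounded_linear.linear blinfun.bounded_linear_right)
  have "p x \<in> U" using R x closure_subset[of S] by (auto simp: regular_parametrization_def)
  then have "inj ?L"
    using R unfolding regular_parametrization_def
    by (intro inj_derivative_retraction[of U "p x" \<Phi> _ p]) auto
  then have "dim (range ?L) = CARD('k)"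
    using dim_image_eq[OF L, of UNIV] by simp
  moreover have "dim {y \<in> UNIV. \<forall>v\<in>range ?L. orthogonal v y} + dim (range ?L) = dim (UNIV :: (real^'n) set)"
    using L by (intro dim_subspace_orthogonal_to_vectors) (auto intro: linear_subspace_image)
  moreover have "CARD('n) = CARD('k) + CARD('m)"
    using bij_betw_same_card[OF e] by simp
  ultimately show "dim (normal_space S x) = CARD('m)"
    by (simp add: normal_space_def tangent_space_parametrization[OF R x] orthogonal_comp_def)
qed

text \<open>The orthonormal basis chosen in the definition of the transversality determinant.\<close>

definition normal_frame :: "'a::euclidean_space set \<Rightarrow> 'a \<Rightarrow> 'm::finite \<Rightarrow> 'a" where
  "normal_frame S x = (SOME B. is_orthonormal_basis B (normal_space S x))"

section \<open>Function spaces under linear maps\<close>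

lemma frechet_derivative_eqI: "(f has_derivative f') (at x) \<Longrightarrow> frechet_derivative f (at x) = f'"
  using frechet_derivative_at by blast

lemma has_frechet_derivative:
  "f differentiable (at x) \<Longrightarrow> (f has_derivative frechet_derivative f (at x)) (at x)"
  by (simp add: frechet_derivative_works[symmetric])

lemma C_k_add: "C_k k f \<Longrightarrow> C_k k g \<Longrightarrow> C_k k (\<lambda>x. f x + g x)"
proof (induction k arbitrary: f g)
  case 0
  then show ?case by (simp add: continuous_on_add)
next
  case (Suc k)
  have d: "((\<lambda>x. f x + g x) has_derivative (\<lambda>v. frechet_derivative f (at x) v + frechet_derivative g (at x) v)) (at x)" for x
    using Suc.prems by (intro has_derivative_add has_frechet_derivative) auto
  show ?case
    using Suc.prems d by (auto simp: frechet_derivative_eqI[OF d] differentiable_def intro!: Suc.IH)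
qed

lemma C_k_scaleR: "C_k k f \<Longrightarrow> C_k k (\<lambda>x. c *\<^sub>R f x)"
proof (induction k arbitrary: f)
  case 0
  then show ?case by (simp add: continuous_on_scaleR)
next
  case (Suc k)
  have d: "((\<lambda>x. c *\<^sub>R f x) has_derivative (\<lambda>v. c *\<^sub>R frechet_derivative f (at x) v)) (at x)" for x
    using Suc.prems by (intro has_derivative_scaleR_right has_frechet_derivative) auto
  show ?case
    using Suc.prems d by (auto simp: frechet_derivative_eqI[OF d] differentiable_def intro!: Suc.IH)
qed

lemma C_k_zero: "C_k k (\<lambda>x. 0)"
  by (induction k) (simp_all add: frechet_derivative_const)

lemma C_k_sum: "finite A \<Longrightarrow> (\<And>a. a \<in> A \<Longrightarrow> C_k k (f a)) \<Longrightarrow> C_k k (\<lambda>x. \<Sum>a\<in>A. f a x)"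
  by (induction A rule: finite_induct) (simp_all add: C_k_zero C_k_add)

text \<open>By the chain rule, a partial derivative of \<open>f \<circ> T\<close> is a linear combination, with constant coefficients, of partial
  derivatives of \<open>f\<close> composed with \<open>T\<close>.\<close>

lemma C_k_compose_linear:
  fixes f :: "'a::euclidean_space \<Rightarrow> complex" and T :: "'a \<Rightarrow> 'a"
  assumes "linear T"
  shows "C_k k f \<Longrightarrow> C_k k (\<lambda>x. f (T x))"
proof (induction k arbitrary: f)
  case 0
  then show ?case
    using assms by (auto intro!: continuous_on_compose2[of UNIV f] simp: linear_continuous_on linear_conv_bounded_linear)
next
  case (Suc k)
  have bl: "bounded_linear T" using assms by (simp add: linear_conv_bounded_linear)
  have diff: "(f has_derivative frechet_derivative f (at x)) (at x)" for x
    using Suc.prems by (intro has_frechet_derivative) auto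
  have d: "((\<lambda>x. f (T x)) has_derivative (\<lambda>v. \<Sum>b\<in>Basis. (T v \<bullet> b) *\<^sub>R frechet_derivative f (at (T x)) b)) (at x)" for x
  proof -
    have lin: "linear (frechet_derivative f (at (T x)))" using diff has_derivative_linear by blast
    have "((\<lambda>x. f (T x)) has_derivative (\<lambda>v. frechet_derivative f (at (T x)) (T v))) (at x)"
      by (rule has_derivative_compose[OF bounded_linear_imp_has_derivative[OF bl] diff])
    moreover have "frechet_derivative f (at (T x)) (T v) = (\<Sum>b\<in>Basis. (T v \<bullet> b) *\<^sub>R frechet_derivative f (at (T x)) b)" for v
    proof -
      have "frechet_derivative f (at (T x)) (\<Sum>b\<in>Basis. (T v \<bullet> b) *\<^sub>R b)
          = (\<Sum>b\<in>Basis. (T v \<bullet> b) *\<^sub>R frechet_derivative f (at (T x)) b)"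
        by (simp only: linear_sum[OF lin] linear_scale[OF lin])
      then show ?thesis by (simp only: euclidean_representation)
    qed
    ultimately show ?thesis by simp
  qed
  show ?case
    using Suc.prems d
    by (auto simp: frechet_derivative_eqI[OF d] differentiable_def intro!: C_k_sum C_k_scaleR Suc.IH)
qed

lemma C0_compose_linear:
  fixes T :: "'a::euclidean_space \<Rightarrow> 'a"
  assumes T: "linear T" "bij T" and F: "F \<in> C0 (T ` S)"
  shows "(\<lambda>x. F (T x)) \<in> C0 S"
proof -
  have I: "linear (inv T)" using T by (simp add: bij_is_inj inj_linear_imp_inv_linear)
  obtain K where K: "continuous_on (T ` S) F" "compact K" "K \<subseteq> T ` S" "\<And>x. x \<in> T ` S \<Longrightarrow> x \<notin> K \<Longrightarrow> F x = 0"
    using F by (auto simp: C0_def)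
  have "continuous_on S (\<lambda>x. F (T x))"
    using T(1) by (intro continuous_on_compose2[OF K(1)]) (auto simp: linear_continuous_on linear_conv_bounded_linear)
  moreover have "compact (inv T ` K)"
    using I K(2) by (intro compact_continuous_image) (auto simp: linear_continuous_on linear_conv_bounded_linear)
  moreover have "inv T ` K \<subseteq> S" using K(3) T(2) by (auto simp: bij_is_inj dest!: subsetD)
  moreover have "F (T x) = 0" if "x \<in> S - inv T ` K" for x
  proof -
    have "T x \<notin> K" using that T(2) by (metis DiffD2 bij_inv_eq_iff imageI)
    then show ?thesis using that K(4) by blast
  qed
  ultimately show ?thesis unfolding C0_def by blast
qed

lemma C0_mult_continuous:
  assumes "F \<in> C0 S" "continuous_on S J"
  shows "(\<lambda>x. complex_of_real (J x) * F x) \<in> C0 S"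
  using assms unfolding C0_def by (auto intro!: continuous_intros)

lemma test_functions_compose_linear:
  fixes T :: "'a::euclidean_space \<Rightarrow> 'a"
  assumes T: "linear T" "bij T" and "\<psi> \<in> test_functions"
  shows "(\<lambda>x. \<psi> (T x)) \<in> test_functions"
  using assms C0_compose_linear[OF T, of \<psi> UNIV] C_k_compose_linear[OF T(1)]
  by (auto simp: test_functions_def bij_is_surj)

text \<open>Measurability of \<open>u\<close> and \<open>v\<close> is equivalent, and so is integrability; without integrability both integrals are \<open>0\<close> by
  convention. Hence the inequality holds for all functions.\<close>

lemma integral_le_of_bounded_ratio:
  fixes u v w :: "'a \<Rightarrow> real"
  assumes w: "w \<in> borel_measurable M" "\<And>x. x \<in> space M \<Longrightarrow> a \<le> w x" "\<And>x. x \<in> space M \<Longrightarrow> w x \<le> b" "0 < a"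
    and u: "\<And>x. x \<in> space M \<Longrightarrow> u x = w x * v x" and v: "\<And>x. x \<in> space M \<Longrightarrow> 0 \<le> v x"
  shows "integrable M u \<longleftrightarrow> integrable M v" "(\<integral>x. u x \<partial>M) \<le> b * (\<integral>x. v x \<partial>M)"
proof -
  have pos: "0 < w x" if "x \<in> space M" for x using w that by force
  have int_u: "integrable M u" if "integrable M v"
  proof (rule Bochner_Integration.integrable_bound[of M "\<lambda>x. b * v x"])
    have "(\<lambda>x. w x * v x) \<in> borel_measurable M" using w(1) that by measurable
    then show "u \<in> borel_measurable M" using u by (simp cong: measurable_cong)
    show "AE x in M. norm (u x) \<le> norm (b * v x)"
    proof (rule AE_I2)
      fix x assume x: "x \<in> space M"
      have "0 \<le> w x * v x" "w x * v x \<le> b * v x"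
        using pos[OF x] v[OF x] w(3)[OF x] by (auto intro: mult_right_mono)
      then show "norm (u x) \<le> norm (b * v x)" using u[OF x] by simp
    qed
  qed (use that in simp)
  have int_v: "integrable M v" if "integrable M u"
  proof (rule Bochner_Integration.integrable_bound[of M "\<lambda>x. u x / a"])
    have "(\<lambda>x. u x / w x) \<in> borel_measurable M" using w(1) that by measurable
    moreover have "u x / w x = v x" if "x \<in> space M" for x using u[OF that] pos[OF that] by simp
    ultimately show "v \<in> borel_measurable M" by (simp cong: measurable_cong)
    show "AE x in M. norm (v x) \<le> norm (u x / a)"
    proof (rule AE_I2)
      fix x assume x: "x \<in> space M"
      have "a * v x \<le> w x * v x" using v[OF x] w(2)[OF x] by (rule mult_right_mono[rotated])
      then have "v x \<le> u x / a" using u[OF x] w(4) by (simp add: field_simps)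
      then show "norm (v x) \<le> norm (u x / a)" using v[OF x] by (simp only: real_norm_def abs_of_nonneg)
    qed
  qed (use that in simp)
  show iff: "integrable M u \<longleftrightarrow> integrable M v" by (rule iffI[OF int_v int_u])
  show "(\<integral>x. u x \<partial>M) \<le> b * (\<integral>x. v x \<partial>M)"
  proof (cases "integrable M v")
    case True
    have "(\<integral>x. u x \<partial>M) \<le> (\<integral>x. b * v x \<partial>M)"
    proof (rule integral_mono[OF int_u[OF True]])
      show "integrable M (\<lambda>x. b * v x)" using True by simp
      fix x assume x: "x \<in> space M"
      show "u x \<le> b * v x" unfolding u[OF x] using w(3)[OF x] v[OF x] by (rule mult_right_mono)
    qed
    then show ?thesis by simp
  qed (use iff in \<open>simp add: not_integrable_integral_eq\<close>)
qed

lemma L2_norm_nonneg: "0 \<le> L2_norm M f"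
  by (simp add: L2_norm_def)

lemma L2_norm_mult: "L2_norm M (\<lambda>x. a * f x) = cmod a * L2_norm M f"
  by (simp add: L2_norm_def norm_mult power_mult_distrib real_sqrt_mult)

text \<open>The situation of one surface and its image: \<open>M'\<close> is the image under the linear bijection \<open>T\<close> of \<open>M\<close> with the density \<open>J\<close>,
  which is continuous and bounded between positive constants. Lebesgue measure on the whole space, with constant \<open>J\<close>, is a further
  instance.\<close>

locale weighted_image =
  fixes M M' :: "'a::euclidean_space measure" and T :: "'a \<Rightarrow> 'a" and J :: "'a \<Rightarrow> real" and c C :: real
  assumes T: "linear T" "bij T"
    and sets_M: "sets M = sets (restrict_space borel (space M))"
    and sets_M': "sets M' = sets (restrict_space borel (space M'))"
    and space_M': "space M' = T ` space M"
    and J: "continuous_on (space M) J" "0 < c" "\<And>x. x \<in> space M \<Longrightarrow> c \<le> J x" "\<And>x. x \<in> space M \<Longrightarrow> J x \<le> C"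
    and M': "M' = distr (density M J) M' T"
begin

definition weighted_pullback :: "('a \<Rightarrow> complex) \<Rightarrow> 'a \<Rightarrow> complex" where
  "weighted_pullback f x = complex_of_real (J x) * f (T x)"

lemma J_pos: "x \<in> space M \<Longrightarrow> 0 < J x"
  using J(2,3) by force

lemma inv_T [simp]: "inv T (T x) = x" "T (inv T x) = x"
  using T(2) by (auto simp: bij_is_inj bij_is_surj surj_f_inv_f)

lemma linear_inv: "linear (inv T)"
  using T by (simp add: bij_is_inj inj_linear_imp_inv_linear)

lemma measurable_T [measurable]: "T \<in> measurable M M'"
  and measurable_inv_T [measurable]: "inv T \<in> measurable M' M"
  and measurable_J [measurable]: "J \<in> borel_measurable M"
proof -
  have "T \<in> borel_measurable borel" "inv T \<in> borel_measurable borel"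
    using T(1) linear_inv by (auto intro!: borel_measurable_continuous_onI simp: linear_continuous_on linear_conv_bounded_linear)
  then show "T \<in> measurable M M'" "inv T \<in> measurable M' M"
    unfolding measurable_cong_sets[OF sets_M sets_M'] measurable_cong_sets[OF sets_M' sets_M]
    by (auto intro!: measurable_restrict_space3 simp: space_M')
  show "J \<in> borel_measurable M"
    using borel_measurable_continuous_on_restrict[OF J(1)] by (simp cong: measurable_cong_sets add: sets_M)
qed

text \<open>The change of variables formula for arbitrary functions: \<open>T\<close> has a measurable inverse and \<open>J\<close> is positive, so a
  nonmeasurable function is nonmeasurable on both sides, and both integrals are \<open>0\<close>.\<close>

lemma
  fixes f :: "'a \<Rightarrow> 'b::{banach, second_countable_topology}"
  shows integrable_image: "integrable M' f \<longleftrightarrow> integrable M (\<lambda>x. J x *\<^sub>R f (T x))"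
    and integral_image: "(\<integral>x. f x \<partial>M') = (\<integral>x. J x *\<^sub>R f (T x) \<partial>M)"
proof -
  have "integrable M' f \<longleftrightarrow> integrable M (\<lambda>x. J x *\<^sub>R f (T x))"
    and "(\<integral>x. f x \<partial>M') = (\<integral>x. J x *\<^sub>R f (T x) \<partial>M)" if f: "f \<in> borel_measurable M'"
  proof -
    have [measurable]: "(\<lambda>x. f (T x)) \<in> borel_measurable M"
      using f by (rule measurable_compose[OF measurable_T])
    have J0: "AE x in M. 0 \<le> J x" using J_pos by (auto intro!: AE_I2 less_imp_le)
    have Td: "T \<in> measurable (density M J) M'" by simp
    have "integrable M' f \<longleftrightarrow> integrable (density M J) (\<lambda>x. f (T x))"
      by (subst M') (rule integrable_distr_eq[OF Td f])
    also have "\<dots> \<longleftrightarrow> integrable M (\<lambda>x. J x *\<^sub>R f (T x))"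
      by (rule integrable_density) (use J0 in auto)
    finally show "integrable M' f \<longleftrightarrow> integrable M (\<lambda>x. J x *\<^sub>R f (T x))" .
    have "(\<integral>x. f x \<partial>M') = (\<integral>x. f (T x) \<partial>density M J)"
      by (subst M') (rule integral_distr[OF Td f])
    also have "\<dots> = (\<integral>x. J x *\<^sub>R f (T x) \<partial>M)"
      by (rule integral_density) (use J0 in auto)
    finally show "(\<integral>x. f x \<partial>M') = (\<integral>x. J x *\<^sub>R f (T x) \<partial>M)" .
  qed
  moreover have "f \<in> borel_measurable M'" if "(\<lambda>x. J x *\<^sub>R f (T x)) \<in> borel_measurable M"
  proof -
    have "(\<lambda>x. inverse (J x) *\<^sub>R (J x *\<^sub>R f (T x))) \<in> borel_measurable M"
      using that by measurable
    then have "(\<lambda>x. f (T x)) \<in> borel_measurable M"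
      by (rule measurable_cong[THEN iffD1, rotated]) (use J_pos in force)
    then have "(\<lambda>y. f (T (inv T y))) \<in> borel_measurable M'"
      by (rule measurable_compose[OF measurable_inv_T])
    then show ?thesis by simp
  qed
  ultimately have "(integrable M' f \<longleftrightarrow> integrable M (\<lambda>x. J x *\<^sub>R f (T x))) \<and>
      (\<integral>x. f x \<partial>M') = (\<integral>x. J x *\<^sub>R f (T x) \<partial>M)"
  proof (cases "f \<in> borel_measurable M'")
    case False
    with \<open>(\<lambda>x. J x *\<^sub>R f (T x)) \<in> borel_measurable M \<Longrightarrow> f \<in> borel_measurable M'\<close>
    have "\<not> integrable M' f" "\<not> integrable M (\<lambda>x. J x *\<^sub>R f (T x))"
      using borel_measurable_integrable by blast+
    then show ?thesis by (simp add: not_integrable_integral_eq)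
  qed simp
  then show "integrable M' f \<longleftrightarrow> integrable M (\<lambda>x. J x *\<^sub>R f (T x))"
    and "(\<integral>x. f x \<partial>M') = (\<integral>x. J x *\<^sub>R f (T x) \<partial>M)" by auto
qed

lemma L2_norm_image: "L2_norm M' f = sqrt (\<integral>x. J x * (cmod (f (T x)))\<^sup>2 \<partial>M)"
  unfolding L2_norm_def by (simp add: integral_image)

text \<open>One factor \<open>J\<close> of the weight \<open>J\<^sup>2\<close> is the density of \<open>M'\<close>; the other one is bounded by \<open>j\<close>.\<close>

lemma L2_norm_weighted_pullback_le:
  assumes "\<And>x. x \<in> space M \<Longrightarrow> J x \<le> j"
  shows "L2_norm M (weighted_pullback f) \<le> sqrt j * L2_norm M' f"
proof -
  have "(\<integral>x. (cmod (weighted_pullback f x))\<^sup>2 \<partial>M) \<le> j * (\<integral>x. J x * (cmod (f (T x)))\<^sup>2 \<partial>M)"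
    by (rule integral_le_of_bounded_ratio(2)[of J M c j])
       (use assms J J_pos in \<open>auto simp: weighted_pullback_def norm_mult power_mult_distrib power2_eq_square less_imp_le\<close>)
  then show ?thesis
    unfolding L2_norm_image by (simp add: L2_norm_def real_sqrt_mult[symmetric])
qed

lemma L2_norm_le_weighted_pullback:
  "L2_norm M' f \<le> sqrt (1 / c) * L2_norm M (weighted_pullback f)"
proof (cases "space M = {}")
  case False
  then have C: "0 < C" using J J_pos by force
  have "(\<integral>x. J x * (cmod (f (T x)))\<^sup>2 \<partial>M) \<le> (1 / c) * (\<integral>x. (cmod (weighted_pullback f x))\<^sup>2 \<partial>M)"
  proof (rule integral_le_of_bounded_ratio(2)[of "\<lambda>x. 1 / J x" M "1 / C" "1 / c"])
    fix x assume x: "x \<in> space M"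
    show "1 / C \<le> 1 / J x" "1 / J x \<le> 1 / c" using J(2) J(3,4)[OF x] J_pos[OF x] by (auto intro: divide_left_mono frac_le)
    show "J x * (cmod (f (T x)))\<^sup>2 = 1 / J x * (cmod (weighted_pullback f x))\<^sup>2"
      using J_pos[OF x] by (simp add: weighted_pullback_def norm_mult power_mult_distrib power2_eq_square)
  qed (use C in auto)
  then show ?thesis
    unfolding L2_norm_image by (simp add: L2_norm_def real_sqrt_mult[symmetric])
next
  case True
  then have "L2_norm M' f = 0"
    unfolding L2_norm_image using Bochner_Integration.integral_empty[of M] by simp
  then show ?thesis by (simp add: L2_norm_nonneg J less_imp_le)
qed

lemma weighted_pullback_L2:
  assumes "f \<in> L2 M'"
  shows "weighted_pullback f \<in> L2 M"
proof -
  have f: "f \<in> borel_measurable M'" "integrable M' (\<lambda>x. (cmod (f x))\<^sup>2)" using assms by (auto simp: L2_def)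
  have "(\<lambda>x. f (T x)) \<in> borel_measurable M"
    using f(1) by (rule measurable_compose[OF measurable_T])
  then have "weighted_pullback f \<in> borel_measurable M"
    unfolding weighted_pullback_def by measurable
  moreover have "integrable M (\<lambda>x. (cmod (weighted_pullback f x))\<^sup>2) \<longleftrightarrow> integrable M (\<lambda>x. J x * (cmod (f (T x)))\<^sup>2)"
    by (rule integral_le_of_bounded_ratio(1)[of J M c C])
       (use J J_pos in \<open>auto simp: weighted_pullback_def norm_mult power_mult_distrib power2_eq_square less_imp_le\<close>)
  ultimately show ?thesis using f(2) integrable_image[of "\<lambda>x. (cmod (f x))\<^sup>2"] by (simp add: L2_def)
qed

lemma L2_norm_pushforward_le:
  assumes "\<And>x. x \<in> space M \<Longrightarrow> J x \<le> j"
  shows "L2_norm M' (\<lambda>z. h (inv T z)) \<le> sqrt j * L2_norm M h"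
proof -
  have "(\<integral>x. J x * (cmod (h x))\<^sup>2 \<partial>M) \<le> j * (\<integral>x. (cmod (h x))\<^sup>2 \<partial>M)"
    by (rule integral_le_of_bounded_ratio(2)[of J M c j]) (use assms J in auto)
  then show ?thesis
    unfolding L2_norm_image by (simp add: L2_norm_def real_sqrt_mult[symmetric])
qed

lemma pushforward_L2:
  assumes "h \<in> L2 M"
  shows "(\<lambda>z. a * h (inv T z)) \<in> L2 M'"
proof -
  have h: "h \<in> borel_measurable M" "integrable M (\<lambda>x. (cmod (h x))\<^sup>2)" using assms by (auto simp: L2_def)
  have [measurable]: "(\<lambda>x. h (inv T x)) \<in> borel_measurable M'"
    using h(1) by (rule measurable_compose[OF measurable_inv_T])
  have "integrable M (\<lambda>x. J x * (cmod (h x))\<^sup>2)"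
    using h(2) integral_le_of_bounded_ratio(1)[of J M c C "\<lambda>x. J x * (cmod (h x))\<^sup>2" "\<lambda>x. (cmod (h x))\<^sup>2"] J by simp
  then have "integrable M' (\<lambda>x. (cmod (h (inv T x)))\<^sup>2)"
    by (simp add: integrable_image)
  then show ?thesis by (simp add: L2_def norm_mult power_mult_distrib)
qed

lemma weighted_pullback_C0: "F \<in> C0 (space M') \<Longrightarrow> weighted_pullback F \<in> C0 (space M)"
  unfolding weighted_pullback_def space_M' by (intro C0_mult_continuous C0_compose_linear[OF T] J)

end

lemma weighted_image_lborel:
  fixes T :: "real^'n \<Rightarrow> real^'n"
  assumes T: "linear T" "bij T"
  shows "weighted_image lborel lborel T (\<lambda>_. \<bar>det (matrix T)\<bar>) \<bar>det (matrix T)\<bar> \<bar>det (matrix T)\<bar>"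
proof (rule weighted_image.intro)
  have Tm: "(*v) (matrix T) = T" using matrix_of_linear[OF T(1)] by (simp add: fun_eq_iff)
  have inv: "invertible (matrix T)"
    using T(2) by (simp add: invertible_left_inverse matrix_left_invertible_injective Tm bij_is_inj)
  have Tb: "T \<in> borel_measurable borel"
    using T(1) by (auto intro!: borel_measurable_continuous_onI simp: linear_continuous_on linear_conv_bounded_linear)
  show "linear T" "bij T" by (rule T)+
  show "0 < \<bar>det (matrix T)\<bar>" using inv by (simp add: invertible_det_nz)
  show "space lborel = T ` space lborel" using T(2) by (simp add: bij_is_surj)
  show "lborel = distr (density lborel (\<lambda>x. ennreal \<bar>det (matrix T)\<bar>)) lborel T"
  proof (rule measure_eqI)
    fix A :: "(real^'n) set" assume "A \<in> sets lborel"
    then have A: "A \<in> sets borel" by simp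
    have vA: "T -` A \<in> sets borel" using Tb A by (rule measurable_sets_borel)
    have "T ` (T -` A) = A" using T(2) by (simp add: bij_is_surj surj_image_vimage_eq)
    then have "emeasure lborel A = ennreal \<bar>det (matrix T)\<bar> * emeasure lborel (T -` A)"
      using emeasure_lborel_matrix_image[OF inv vA] by (simp add: Tm)
    then show "emeasure lborel A = emeasure (distr (density lborel (\<lambda>x. ennreal \<bar>det (matrix T)\<bar>)) lborel T) A"
      using A vA Tb by (simp add: emeasure_distr emeasure_density nn_integral_cmult_indicator)
  qed simp
qed (use T in \<open>simp_all add: sets_restrict_space\<close>)

lemma lborel_integral_linear:
  fixes T :: "real^'n \<Rightarrow> real^'n" and f :: "real^'n \<Rightarrow> complex"
  assumes "linear T" "bij T"
  shows "(\<integral>x. f x \<partial>lborel) = complex_of_real \<bar>det (matrix T)\<bar> * (\<integral>x. f (T x) \<partial>lborel)"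
  using weighted_image.integral_image[OF weighted_image_lborel[OF assms], of f]
  by (simp add: scaleR_conv_of_real)

section \<open>Convolution and its trace under a linear map\<close>

text \<open>Test the convolution with \<open>\<psi>\<close>. Changing variables in the two surface integrals produces the weights \<open>J1\<close>, \<open>J2\<close> and the test
  function \<open>\<psi> \<circ> T\<close>; changing them in the Lebesgue integral against \<open>h\<close> produces \<open>\<bar>det T\<bar>\<close>.\<close>

lemma conv_represented_by_linear_image:
  fixes M1 M1' M2 M2' :: "(real^'n) measure"
  assumes 1: "weighted_image M1 M1' T J1 c1 C1" and 2: "weighted_image M2 M2' T J2 c2 C2"
    and rep: "conv_represented_by M1 M2 (weighted_image.weighted_pullback T J1 F) (weighted_image.weighted_pullback T J2 G) h"
  shows "conv_represented_by M1' M2' F G (\<lambda>z. complex_of_real (1 / \<bar>det (matrix T)\<bar>) * h (inv T z))"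
proof -
  interpret A: weighted_image M1 M1' T J1 c1 C1 by (rule 1)
  interpret B: weighted_image M2 M2' T J2 c2 C2 by (rule 2)
  let ?d = "\<bar>det (matrix T)\<bar>"
  have d: "?d \<noteq> 0" using det_matrix_inv_adjoint[OF A.T] by auto
  have h: "h \<in> C0 UNIV" and conv: "\<And>\<psi>. \<psi> \<in> test_functions \<Longrightarrow>
      (\<integral>z. h z * \<psi> z \<partial>lborel) = (\<integral>y. (\<integral>x. A.weighted_pullback F x * B.weighted_pullback G y * \<psi> (x + y) \<partial>M1) \<partial>M2)"
    using rep by (auto simp: conv_represented_by_def)
  have bijI: "bij (inv T)" using A.T(2) by (rule bij_imp_bij_inv)
  have "(\<lambda>z. h (inv T z)) \<in> C0 UNIV"
    using C0_compose_linear[OF A.linear_inv bijI, of h UNIV] h bijI by (simp add: bij_is_surj)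
  then have "(\<lambda>z. complex_of_real (1 / ?d) * h (inv T z)) \<in> C0 UNIV"
    by (intro C0_mult_continuous) auto
  moreover have "(\<integral>z. complex_of_real (1 / ?d) * h (inv T z) * \<psi> z \<partial>lborel)
      = (\<integral>y. (\<integral>x. F x * G y * \<psi> (x + y) \<partial>M1') \<partial>M2')" if \<psi>: "\<psi> \<in> test_functions" for \<psi>
  proof -
    have "(\<integral>z. complex_of_real (1 / ?d) * h (inv T z) * \<psi> z \<partial>lborel)
        = complex_of_real ?d * (\<integral>x. complex_of_real (1 / ?d) * (h x * \<psi> (T x)) \<partial>lborel)"
      by (subst lborel_integral_linear[OF A.T]) (simp add: mult.assoc)
    also have "\<dots> = (\<integral>x. h x * \<psi> (T x) \<partial>lborel)"
      using d by (simp del: of_real_divide) (simp add: mult.assoc[symmetric] of_real_mult[symmetric] del: of_real_mult)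
    also have "\<dots> = (\<integral>y. (\<integral>x. A.weighted_pullback F x * B.weighted_pullback G y * \<psi> (T (x + y)) \<partial>M1) \<partial>M2)"
      by (rule conv) (rule test_functions_compose_linear[OF A.T \<psi>])
    also have "\<dots> = (\<integral>y. J2 y *\<^sub>R (\<integral>x. J1 x *\<^sub>R (F (T x) * G (T y) * \<psi> (T x + T y)) \<partial>M1) \<partial>M2)"
    proof (rule Bochner_Integration.integral_cong[OF refl])
      fix y
      have "(\<integral>x. A.weighted_pullback F x * B.weighted_pullback G y * \<psi> (T (x + y)) \<partial>M1)
          = (\<integral>x. complex_of_real (J2 y) * (J1 x *\<^sub>R (F (T x) * G (T y) * \<psi> (T x + T y))) \<partial>M1)"
        by (rule Bochner_Integration.integral_cong[OF refl])
           (simp add: A.weighted_pullback_def B.weighted_pullback_def scaleR_conv_of_real linear_add[OF A.T(1)] mult_ac)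
      also have "\<dots> = J2 y *\<^sub>R (\<integral>x. J1 x *\<^sub>R (F (T x) * G (T y) * \<psi> (T x + T y)) \<partial>M1)"
        by (simp add: scaleR_conv_of_real)
      finally show "(\<integral>x. A.weighted_pullback F x * B.weighted_pullback G y * \<psi> (T (x + y)) \<partial>M1)
          = J2 y *\<^sub>R (\<integral>x. J1 x *\<^sub>R (F (T x) * G (T y) * \<psi> (T x + T y)) \<partial>M1)" .
    qed
    also have "\<dots> = (\<integral>y. (\<integral>x. F x * G y * \<psi> (x + y) \<partial>M1') \<partial>M2')"
      by (simp only: A.integral_image B.integral_image)
    finally show ?thesis .
  qed
  ultimately show ?thesis by (simp add: conv_represented_by_def)
qed

lemma tendsto_0_le_mult:
  fixes f g :: "nat \<Rightarrow> real"
  assumes "g \<longlonglongrightarrow> 0" "\<And>n. 0 \<le> f n" "\<And>n. f n \<le> K * g n"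
  shows "f \<longlonglongrightarrow> 0"
proof (rule tendsto_sandwich[of "\<lambda>_. 0"])
  show "(\<lambda>n. K * g n) \<longlonglongrightarrow> 0" using tendsto_mult_right_zero[OF assms(1)] by simp
qed (use assms in auto)

text \<open>Approximations of \<open>f\<close>, \<open>g\<close> by continuous functions of compact support on the image surfaces pull back to such approximations on
  the original ones, because the densities are continuous and bounded.\<close>

lemma is_conv_trace_linear_image:
  fixes M1 M1' M2 M2' M3 M3' :: "(real^'n) measure"
  assumes 1: "weighted_image M1 M1' T J1 c1 C1" and 2: "weighted_image M2 M2' T J2 c2 C2"
    and 3: "weighted_image M3 M3' T J3 c3 C3"
    and tr: "is_conv_trace M1 M2 M3 (weighted_image.weighted_pullback T J1 f) (weighted_image.weighted_pullback T J2 g) t"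
  shows "is_conv_trace M1' M2' M3' f g (\<lambda>z. complex_of_real (1 / \<bar>det (matrix T)\<bar>) * t (inv T z))"
proof -
  interpret A: weighted_image M1 M1' T J1 c1 C1 by (rule 1)
  interpret B: weighted_image M2 M2' T J2 c2 C2 by (rule 2)
  interpret E: weighted_image M3 M3' T J3 c3 C3 by (rule 3)
  let ?a = "complex_of_real (1 / \<bar>det (matrix T)\<bar>)"
  have t: "t \<in> L2 M3" and lim: "\<And>F G. (\<And>k. F k \<in> C0 (space M1)) \<Longrightarrow> (\<And>k. G k \<in> C0 (space M2)) \<Longrightarrow>
      (\<lambda>k. L2_norm M1 (\<lambda>x. F k x - A.weighted_pullback f x)) \<longlonglongrightarrow> 0 \<Longrightarrow>
      (\<lambda>k. L2_norm M2 (\<lambda>y. G k y - B.weighted_pullback g y)) \<longlonglongrightarrow> 0 \<Longrightarrow>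
      \<exists>H. (\<forall>k. conv_represented_by M1 M2 (F k) (G k) (H k)) \<and> (\<lambda>k. L2_norm M3 (\<lambda>z. H k z - t z)) \<longlonglongrightarrow> 0"
    using tr unfolding is_conv_trace_def by blast+
  show ?thesis
    unfolding is_conv_trace_def
  proof (intro conjI allI impI; (elim conjE)?)
    show "(\<lambda>z. ?a * t (inv T z)) \<in> L2 M3'" by (rule E.pushforward_L2[OF t])
    fix F G assume FG: "\<forall>k. F k \<in> C0 (space M1')" "\<forall>k. G k \<in> C0 (space M2')"
      and F: "(\<lambda>k. L2_norm M1' (\<lambda>x. F k x - f x)) \<longlonglongrightarrow> 0" and G: "(\<lambda>k. L2_norm M2' (\<lambda>y. G k y - g y)) \<longlonglongrightarrow> 0"
    have "A.weighted_pullback u x - A.weighted_pullback v x = A.weighted_pullback (\<lambda>x. u x - v x) x"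
      "B.weighted_pullback u x - B.weighted_pullback v x = B.weighted_pullback (\<lambda>x. u x - v x) x" for u v x
      by (simp_all add: A.weighted_pullback_def B.weighted_pullback_def right_diff_distrib)
    note diff = this
    have "(\<lambda>k. L2_norm M1 (\<lambda>x. A.weighted_pullback (F k) x - A.weighted_pullback f x)) \<longlonglongrightarrow> 0"
      unfolding diff by (rule tendsto_0_le_mult[OF F L2_norm_nonneg A.L2_norm_weighted_pullback_le[OF A.J(4)]])
    moreover have "(\<lambda>k. L2_norm M2 (\<lambda>x. B.weighted_pullback (G k) x - B.weighted_pullback g x)) \<longlonglongrightarrow> 0"
      unfolding diff by (rule tendsto_0_le_mult[OF G L2_norm_nonneg B.L2_norm_weighted_pullback_le[OF B.J(4)]])
    ultimately obtain H where rep: "\<And>k. conv_represented_by M1 M2 (A.weighted_pullback (F k)) (B.weighted_pullback (G k)) (H k)"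
      and H: "(\<lambda>k. L2_norm M3 (\<lambda>z. H k z - t z)) \<longlonglongrightarrow> 0"
      using lim[of "\<lambda>k. A.weighted_pullback (F k)" "\<lambda>k. B.weighted_pullback (G k)"] FG
        A.weighted_pullback_C0 B.weighted_pullback_C0 by blast
    show "\<exists>H. (\<forall>k. conv_represented_by M1' M2' (F k) (G k) (H k)) \<and>
        (\<lambda>k. L2_norm M3' (\<lambda>z. H k z - ?a * t (inv T z))) \<longlonglongrightarrow> 0"
    proof (intro exI[of _ "\<lambda>k z. ?a * H k (inv T z)"] conjI allI)
      show "conv_represented_by M1' M2' (F k) (G k) (\<lambda>z. ?a * H k (inv T z))" for k
        by (rule conv_represented_by_linear_image[OF 1 2 rep])
      have "L2_norm M3' (\<lambda>z. ?a * H k (inv T z) - ?a * t (inv T z)) \<le> (cmod ?a * sqrt C3) * L2_norm M3 (\<lambda>z. H k z - t z)" for k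
      proof -
        have "L2_norm M3' (\<lambda>z. ?a * H k (inv T z) - ?a * t (inv T z)) = cmod ?a * L2_norm M3' (\<lambda>z. H k (inv T z) - t (inv T z))"
          by (simp only: right_diff_distrib[symmetric] L2_norm_mult)
        also have "\<dots> \<le> cmod ?a * (sqrt C3 * L2_norm M3 (\<lambda>z. H k z - t z))"
          using E.L2_norm_pushforward_le[OF E.J(4), of "\<lambda>z. H k z - t z"] by (intro mult_left_mono) auto
        finally show ?thesis by (simp only: mult.assoc)
      qed
      then show "(\<lambda>k. L2_norm M3' (\<lambda>z. ?a * H k (inv T z) - ?a * t (inv T z))) \<longlonglongrightarrow> 0"
        by (rule tendsto_0_le_mult[OF H L2_norm_nonneg])
    qed
  qed
qed

section \<open>The transported estimate\<close>

lemma space_surface_measure: "space (surface_measure k S) = S"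
  by (simp add: surface_measure_def space_restrict_space)

lemma sets_surface_measure: "sets (surface_measure k S) = sets (restrict_space borel S)"
  unfolding surface_measure_def by (rule sets_restrict_space_cong) simp

lemma weighted_image_surface:
  assumes "linear T" "bij T" "continuous_on S J" "0 < c" "\<And>x. x \<in> S \<Longrightarrow> c \<le> J x" "\<And>x. x \<in> S \<Longrightarrow> J x \<le> C"
    and "surface_measure k (T ` S) = distr (density (surface_measure k S) J) (surface_measure k (T ` S)) T"
  shows "weighted_image (surface_measure k S) (surface_measure k (T ` S)) T J c C"
  by (rule weighted_image.intro) (use assms in \<open>simp_all only: space_surface_measure sets_surface_measure\<close>)

text \<open>All that the main proof uses about one surface: the surface measure of the image has a bounded continuous density \<open>J\<close>, and
  \<open>J\<close> is expressed through the matrix \<open>A\<close> of the inverse transpose of \<open>T\<close> with respect to the chosen normal frames.\<close>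

lemma regular_piece_linear_image:
  fixes \<phi> :: "real^'k::finite \<Rightarrow> real^'m::finite" and S :: "(real^'n::finite) set"
    and T :: "real^'n \<Rightarrow> real^'n"
  assumes piece: "regular_piece \<beta> b R U \<phi> S" and \<beta>: "0 < \<beta>" and b: "0 < b" and T: "linear T" "bij T"
  obtains J c C and A :: "real^'n \<Rightarrow> real^'m^'m"
  where "weighted_image (surface_measure CARD('k) S) (surface_measure CARD('k) (T ` S)) T J c C"
    "\<And>x. x \<in> S \<Longrightarrow> invertible (A x)"
    "\<And>x j. x \<in> S \<Longrightarrow> adjoint (inv T) (normal_frame S x j) = (\<Sum>i\<in>UNIV. A x $ i $ j *\<^sub>R normal_frame (T ` S) (T x) i)"
    "\<And>x. x \<in> S \<Longrightarrow> J x = \<bar>det (matrix T)\<bar> * \<bar>det (A x)\<bar>"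
proof -
  obtain e :: "'n \<Rightarrow> 'k + 'm" and \<Phi> D p where e: "bij e" and P: "regular_parametrization U \<Phi> D p S"
    by (rule regular_piece_parametrization[OF piece \<beta> b])
  note P' = regular_parametrization_linear_image[OF P T]
  let ?J = "tangential_jacobian T D p"
  obtain c C where c: "0 < c" "\<And>x. x \<in> S \<Longrightarrow> c \<le> ?J x" "\<And>x. x \<in> S \<Longrightarrow> ?J x \<le> C"
    by (rule tangential_jacobian_bounds[OF P T]) (rule that)
  have "continuous_on S ?J"
    using P closure_subset[of S] by (intro continuous_on_subset[OF tangential_jacobian_continuous[OF P T]])
      (auto simp: regular_parametrization_def)
  then have W: "weighted_image (surface_measure CARD('k) S) (surface_measure CARD('k) (T ` S)) T ?J c C"
    by (rule weighted_image_surface[OF T _ c surface_measure_linear_image[OF P T]])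
  have "\<exists>A :: real^'m^'m. invertible A \<and>
      (\<forall>j. adjoint (inv T) (normal_frame S x j) = (\<Sum>i\<in>UNIV. A $ i $ j *\<^sub>R normal_frame (T ` S) (T x) i)) \<and>
      ?J x = \<bar>det (matrix T)\<bar> * \<bar>det A\<bar>" if x: "x \<in> S" for x
  proof -
    let ?L = "blinfun_apply (D (p x))"
    have u: "p x \<in> U" using P x closure_subset[of S] by (auto simp: regular_parametrization_def)
    have L: "linear ?L" "inj ?L"
      using P u unfolding regular_parametrization_def
      by (auto intro!: inj_derivative_retraction[of U "p x" \<Phi> _ p] simp: bounded_linear.linear blinfun.bounded_linear_right)
    define B B' :: "'m \<Rightarrow> real^'n" where "B = normal_frame S x" and "B' = normal_frame (T ` S) (T x)"
    have "blinfun_apply (Blinfun T o\<^sub>L D ((p \<circ> inv T) (T x))) = T \<circ> ?L"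
      using T by (simp add: fun_eq_iff bounded_linear_Blinfun_apply linear_conv_bounded_linear bij_is_inj)
    then have N': "normal_space (T ` S) (T x) = orthogonal_comp (range (T \<circ> ?L))"
      using tangent_space_parametrization[OF P' imageI[OF x]] by (simp add: normal_space_def)
    have N: "normal_space S x = orthogonal_comp (range ?L)"
      by (simp add: normal_space_def tangent_space_parametrization[OF P x])
    have "is_orthonormal_basis B (normal_space S x)"
      unfolding B_def normal_frame_def by (rule someI_ex[OF normal_space_has_orthonormal_basis[OF P x e]])
    moreover have "is_orthonormal_basis B' (normal_space (T ` S) (T x))"
      unfolding B'_def normal_frame_def by (rule someI_ex[OF normal_space_has_orthonormal_basis[OF P' imageI[OF x] e]])
    ultimately obtain A :: "real^'m^'m" where A: "invertible A"
      "\<And>j. adjoint (inv T) (B j) = (\<Sum>i\<in>UNIV. A $ i $ j *\<^sub>R B' i)"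
      "gram_vol (T \<circ> ?L) = \<bar>det (matrix T)\<bar> * \<bar>det A\<bar> * gram_vol ?L"
      using normal_jacobian[OF e L T, of B B'] unfolding N N' by blast
    have "?J x = \<bar>det (matrix T)\<bar> * \<bar>det A\<bar>"
      using A(3) gram_vol_derivative_pos(1)[OF P T u] by (simp add: tangential_jacobian_def)
    with A(1,2) show ?thesis unfolding B_def B'_def by blast
  qed
  then have "\<forall>x\<in>S. \<exists>A :: real^'m^'m. invertible A \<and>
      (\<forall>j. adjoint (inv T) (normal_frame S x j) = (\<Sum>i\<in>UNIV. A $ i $ j *\<^sub>R normal_frame (T ` S) (T x) i)) \<and>
      ?J x = \<bar>det (matrix T)\<bar> * \<bar>det A\<bar>" by (rule ballI)
  from bchoice[OF this] show thesis
  proof (elim exE)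
    fix A :: "real^'n \<Rightarrow> real^'m^'m"
    assume A: "\<forall>x\<in>S. invertible (A x) \<and>
      (\<forall>j. adjoint (inv T) (normal_frame S x j) = (\<Sum>i\<in>UNIV. A x $ i $ j *\<^sub>R normal_frame (T ` S) (T x) i)) \<and>
      ?J x = \<bar>det (matrix T)\<bar> * \<bar>det (A x)\<bar>"
    show thesis by (rule that[OF W, of A]) (use A in blast)+
  qed
qed

text \<open>The three arguments vary independently, so the bound passes to the product of the suprema \<open>j1\<close>, \<open>j2\<close>, \<open>j3\<close>, one factor at a
  time.\<close>

lemma split_product_bound:
  fixes J1 :: "'a \<Rightarrow> real" and J2 :: "'b \<Rightarrow> real" and J3 :: "'c \<Rightarrow> real"
  assumes ne: "X1 \<noteq> {}" "X2 \<noteq> {}" "X3 \<noteq> {}"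
    and pos: "\<And>x. x \<in> X1 \<Longrightarrow> 0 < J1 x" "\<And>x. x \<in> X2 \<Longrightarrow> 0 < J2 x" "\<And>x. x \<in> X3 \<Longrightarrow> 0 < J3 x"
    and bd: "bdd_above (J1 ` X1)" "bdd_above (J2 ` X2)" "bdd_above (J3 ` X3)"
    and prod: "\<And>x y z. x \<in> X1 \<Longrightarrow> y \<in> X2 \<Longrightarrow> z \<in> X3 \<Longrightarrow> J1 x * J2 y * J3 z \<le> B"
  obtains j1 j2 j3 where "\<And>x. x \<in> X1 \<Longrightarrow> J1 x \<le> j1" "\<And>x. x \<in> X2 \<Longrightarrow> J2 x \<le> j2" "\<And>x. x \<in> X3 \<Longrightarrow> J3 x \<le> j3"
    "0 < j1" "0 < j2" "0 < j3" "j1 * j2 * j3 \<le> B"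
proof -
  define j1 j2 j3 where "j1 = (SUP x\<in>X1. J1 x)" and "j2 = (SUP x\<in>X2. J2 x)" and "j3 = (SUP x\<in>X3. J3 x)"
  have up: "\<And>x. x \<in> X1 \<Longrightarrow> J1 x \<le> j1" "\<And>x. x \<in> X2 \<Longrightarrow> J2 x \<le> j2" "\<And>x. x \<in> X3 \<Longrightarrow> J3 x \<le> j3"
    unfolding j1_def j2_def j3_def using bd by (auto intro: cSUP_upper)
  obtain x1 x2 x3 where x: "x1 \<in> X1" "x2 \<in> X2" "x3 \<in> X3" using ne by blast
  have j: "0 < j1" "0 < j2" "0 < j3"
    using up(1)[OF x(1)] up(2)[OF x(2)] up(3)[OF x(3)] pos(1)[OF x(1)] pos(2)[OF x(2)] pos(3)[OF x(3)] by auto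
  have 1: "j1 * (J2 y * J3 z) \<le> B" if "y \<in> X2" "z \<in> X3" for y z
  proof -
    have "j1 \<le> B / (J2 y * J3 z)"
      unfolding j1_def using ne(1) pos prod that by (intro cSUP_least) (auto simp: pos_le_divide_eq mult.assoc)
    then show ?thesis using pos that by (simp add: pos_le_divide_eq)
  qed
  have 2: "j2 * (j1 * J3 z) \<le> B" if "z \<in> X3" for z
  proof -
    have "j2 \<le> B / (j1 * J3 z)"
      unfolding j2_def using ne(2) pos 1 j that by (intro cSUP_least) (auto simp: pos_le_divide_eq mult_ac)
    then show ?thesis using pos j that by (simp add: pos_le_divide_eq)
  qed
  have "j3 \<le> B / (j1 * j2)"
    unfolding j3_def using ne(3) pos 2 j by (intro cSUP_least) (auto simp: pos_le_divide_eq mult_ac)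
  then have "j1 * j2 * j3 \<le> B" using j by (simp add: pos_le_divide_eq mult_ac)
  with up j show thesis by (rule that)
qed

text \<open>The case of a negative constant is included: there the hypothesis forces the product
  of the norms of the weighted pullbacks to vanish, hence also that of the norms of the given functions and the trace.\<close>

theorem proposition1p2:
  fixes S1 S2 S3 :: "(real^('m1::finite + 'm2::finite + 'm3::finite)) set"
    and T :: "real^('m1 + 'm2 + 'm3) \<Rightarrow> real^('m1 + 'm2 + 'm3)"
    and \<beta> b \<theta> R C :: real
  assumes "admissible \<beta> b \<theta> R S1 S2 S3"
    and "\<And>x1 x2 x3. x1 \<in> S1 \<Longrightarrow> x2 \<in> S2 \<Longrightarrow> x3 \<in> S3 \<Longrightarrow>
           \<theta> \<le> \<bar>normal_det S1 S2 S3 x1 x2 x3\<bar> \<and> \<bar>normal_det S1 S2 S3 x1 x2 x3\<bar> \<le> 2 * \<theta>"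
    and "L2_conv_estimate S1 S2 S3 (C * \<theta> powr (- (1/2)))"
    and "linear T" and "bij T"
  shows "L2_conv_estimate (T ` S1) (T ` S2) (T ` S3)
           (2 * C * transversality_const (T ` S1) (T ` S2) (T ` S3) powr (- (1/2)))"
proof -
  note T = \<open>linear T\<close> \<open>bij T\<close> and d_bounds = assms(2)
  have par: "0 < \<beta>" "0 < b" "0 < \<theta>" and ne: "S1 \<noteq> {}" "S2 \<noteq> {}" "S3 \<noteq> {}"
    using assms(1) by (auto simp: admissible_def)
  obtain U1 U2 U3 and \<phi>1 :: "real^('m2 + 'm3) \<Rightarrow> real^'m1" and \<phi>2 :: "real^('m1 + 'm3) \<Rightarrow> real^'m2"
      and \<phi>3 :: "real^('m1 + 'm2) \<Rightarrow> real^'m3" where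
    piece: "regular_piece \<beta> b R U1 \<phi>1 S1" "regular_piece \<beta> b R U2 \<phi>2 S2" "regular_piece \<beta> b R U3 \<phi>3 S3"
    using assms(1) unfolding admissible_def by blast
  define D where "D = \<bar>det (matrix T)\<bar>"
  define \<theta>' where "\<theta>' = transversality_const (T ` S1) (T ` S2) (T ` S3)"
  have detS: "D * \<bar>det (matrix (adjoint (inv T)))\<bar> = 1"
    unfolding D_def abs_mult[symmetric] det_matrix_inv_adjoint[OF T] by simp
  then have D: "0 < D" by (auto simp: D_def)
  have lS: "linear (adjoint (inv T))"
    using T by (intro adjoint_linear) (simp add: bij_is_inj inj_linear_imp_inv_linear)
  let ?k1 = "CARD('m2) + CARD('m3)" and ?k2 = "CARD('m1) + CARD('m3)" and ?k3 = "CARD('m1) + CARD('m2)"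
  let ?M1 = "surface_measure ?k1 S1" and ?M2 = "surface_measure ?k2 S2" and ?M3 = "surface_measure ?k3 S3"
  let ?M1' = "surface_measure ?k1 (T ` S1)" and ?M2' = "surface_measure ?k2 (T ` S2)" and ?M3' = "surface_measure ?k3 (T ` S3)"
  have cards: "CARD('m2 + 'm3) = ?k1" "CARD('m1 + 'm3) = ?k2" "CARD('m1 + 'm2) = ?k3" by simp_all
  let ?d = "normal_det S1 S2 S3" and ?d' = "normal_det (T ` S1) (T ` S2) (T ` S3)"
  obtain J1 c1 C1 and A1 :: "real^('m1 + 'm2 + 'm3) \<Rightarrow> real^'m1^'m1"
    where W1: "weighted_image ?M1 ?M1' T J1 c1 C1"
      and A1: "\<And>x. x \<in> S1 \<Longrightarrow> invertible (A1 x)"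
        "\<And>x j. x \<in> S1 \<Longrightarrow> adjoint (inv T) (normal_frame S1 x j) = (\<Sum>i\<in>UNIV. A1 x $ i $ j *\<^sub>R normal_frame (T ` S1) (T x) i)"
        "\<And>x. x \<in> S1 \<Longrightarrow> J1 x = D * \<bar>det (A1 x)\<bar>"
    by (rule regular_piece_linear_image[OF piece(1) par(1,2) T, unfolded cards, folded D_def]) (rule that)
  obtain J2 c2 C2 and A2 :: "real^('m1 + 'm2 + 'm3) \<Rightarrow> real^'m2^'m2"
    where W2: "weighted_image ?M2 ?M2' T J2 c2 C2"
      and A2: "\<And>x. x \<in> S2 \<Longrightarrow> invertible (A2 x)"
        "\<And>x j. x \<in> S2 \<Longrightarrow> adjoint (inv T) (normal_frame S2 x j) = (\<Sum>i\<in>UNIV. A2 x $ i $ j *\<^sub>R normal_frame (T ` S2) (T x) i)"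
        "\<And>x. x \<in> S2 \<Longrightarrow> J2 x = D * \<bar>det (A2 x)\<bar>"
    by (rule regular_piece_linear_image[OF piece(2) par(1,2) T, unfolded cards, folded D_def]) (rule that)
  obtain J3 c3 C3 and A3 :: "real^('m1 + 'm2 + 'm3) \<Rightarrow> real^'m3^'m3"
    where W3: "weighted_image ?M3 ?M3' T J3 c3 C3"
      and A3: "\<And>x. x \<in> S3 \<Longrightarrow> invertible (A3 x)"
        "\<And>x j. x \<in> S3 \<Longrightarrow> adjoint (inv T) (normal_frame S3 x j) = (\<Sum>i\<in>UNIV. A3 x $ i $ j *\<^sub>R normal_frame (T ` S3) (T x) i)"
        "\<And>x. x \<in> S3 \<Longrightarrow> J3 x = D * \<bar>det (A3 x)\<bar>"
    by (rule regular_piece_linear_image[OF piece(3) par(1,2) T, unfolded cards, folded D_def]) (rule that)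
  interpret A: weighted_image ?M1 ?M1' T J1 c1 C1 by (rule W1)
  interpret B: weighted_image ?M2 ?M2' T J2 c2 C2 by (rule W2)
  interpret E: weighted_image ?M3 ?M3' T J3 c3 C3 by (rule W3)
  note J_le = A.J(4)[unfolded space_surface_measure] B.J(4)[unfolded space_surface_measure] E.J(4)[unfolded space_surface_measure]
  note J_pos = A.J_pos[unfolded space_surface_measure] B.J_pos[unfolded space_surface_measure] E.J_pos[unfolded space_surface_measure]
  \<comment> \<open>The three Jacobians contribute \<open>D\<^sup>3\<close>, and the inverse transpose of \<open>T\<close> contributes \<open>1 / D\<close>.\<close>
  have key: "J1 x1 * J2 x2 * J3 x3 * \<bar>?d' (T x1) (T x2) (T x3)\<bar>
      = D\<^sup>2 * \<bar>?d x1 x2 x3\<bar>" if x: "x1 \<in> S1" "x2 \<in> S2" "x3 \<in> S3" for x1 x2 x3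
  proof -
    define s where "s = \<bar>det (matrix (adjoint (inv T)))\<bar>"
    have "s * \<bar>?d x1 x2 x3\<bar>
        = \<bar>?d' (T x1) (T x2) (T x3)\<bar> * (\<bar>det (A1 x1)\<bar> * \<bar>det (A2 x2)\<bar> * \<bar>det (A3 x3)\<bar>)"
      unfolding normal_det_def s_def normal_frame_def[symmetric]
      by (rule columns_matrix_change_of_basis[OF lS A1(1)[OF x(1)] A2(1)[OF x(2)] A3(1)[OF x(3)]
            A1(2)[OF x(1)] A2(2)[OF x(2)] A3(2)[OF x(3)]])
    then have "D^3 * (\<bar>?d' (T x1) (T x2) (T x3)\<bar> * (\<bar>det (A1 x1)\<bar> * \<bar>det (A2 x2)\<bar> * \<bar>det (A3 x3)\<bar>))
        = D^2 * (D * s) * \<bar>?d x1 x2 x3\<bar>"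
      by (simp add: power3_eq_cube power2_eq_square)
    also have "D * s = 1" using detS by (simp add: s_def)
    finally show ?thesis by (simp add: A1(3)[OF x(1)] A2(3)[OF x(2)] A3(3)[OF x(3)] power3_eq_cube mult_ac)
  qed
  have inf: "\<theta>' = (INF z\<in>(T ` S1) \<times> (T ` S2) \<times> (T ` S3). case z of (y1, y2, y3) \<Rightarrow> \<bar>?d' y1 y2 y3\<bar>)"
    by (simp add: \<theta>'_def transversality_const_def)
  have \<theta>'_le: "\<theta>' \<le> \<bar>?d' (T x1) (T x2) (T x3)\<bar>"
    if "x1 \<in> S1" "x2 \<in> S2" "x3 \<in> S3" for x1 x2 x3
  proof -
    let ?f = "\<lambda>z. case z of (y1, y2, y3) \<Rightarrow> \<bar>?d' y1 y2 y3\<bar>"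
    have "(INF z\<in>(T ` S1) \<times> (T ` S2) \<times> (T ` S3). ?f z) \<le> ?f (T x1, T x2, T x3)"
      by (rule cINF_lower) (use that in \<open>auto intro!: bdd_belowI2[of _ 0]\<close>)
    then show ?thesis by (simp add: inf)
  qed
  \<comment> \<open>The image triple is again transversal, so that \<open>\<theta>'\<close> can be divided by.\<close>
  have "D\<^sup>2 * \<theta> / (C1 * C2 * C3) \<le> \<theta>'"
    unfolding inf
  proof (rule cINF_greatest)
    fix z assume "z \<in> (T ` S1) \<times> (T ` S2) \<times> (T ` S3)"
    then obtain x1 x2 x3 where z: "z = (T x1, T x2, T x3)" and x: "x1 \<in> S1" "x2 \<in> S2" "x3 \<in> S3" by auto
    note p = J_pos(1)[OF x(1)] J_pos(2)[OF x(2)] J_pos(3)[OF x(3)]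
    have CC: "J1 x1 * J2 x2 * J3 x3 \<le> C1 * C2 * C3"
      using p J_le(1)[OF x(1)] J_le(2)[OF x(2)] J_le(3)[OF x(3)] by (intro mult_mono) auto
    moreover have "0 < J1 x1 * J2 x2 * J3 x3" using p by simp
    ultimately have C0: "0 < C1 * C2 * C3" by linarith
    have "D\<^sup>2 * \<theta> \<le> D\<^sup>2 * \<bar>?d x1 x2 x3\<bar>"
      using d_bounds[OF x] by (intro mult_left_mono) auto
    also have "\<dots> \<le> C1 * C2 * C3 * \<bar>?d' (T x1) (T x2) (T x3)\<bar>"
      unfolding key[OF x, symmetric] using CC by (rule mult_right_mono) simp
    finally show "D\<^sup>2 * \<theta> / (C1 * C2 * C3) \<le> (case z of (y1, y2, y3) \<Rightarrow> \<bar>?d' y1 y2 y3\<bar>)"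
      using C0 by (simp add: z pos_divide_le_eq mult.commute)
  qed (use ne in auto)
  moreover have "0 < D\<^sup>2 * \<theta> / (C1 * C2 * C3)"
  proof -
    obtain x1 x2 x3 where x: "x1 \<in> S1" "x2 \<in> S2" "x3 \<in> S3" using ne by blast
    have "0 < C1" "0 < C2" "0 < C3"
      using J_pos(1)[OF x(1)] J_pos(2)[OF x(2)] J_pos(3)[OF x(3)] J_le(1)[OF x(1)] J_le(2)[OF x(2)] J_le(3)[OF x(3)] by linarith+
    then show ?thesis using D par by simp
  qed
  ultimately have \<theta>': "0 < \<theta>'" by linarith
  obtain j1 j2 j3 where j: "\<And>x. x \<in> S1 \<Longrightarrow> J1 x \<le> j1" "\<And>x. x \<in> S2 \<Longrightarrow> J2 x \<le> j2" "\<And>x. x \<in> S3 \<Longrightarrow> J3 x \<le> j3"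
    and j0: "0 < j1" "0 < j2" "0 < j3" and jB: "j1 * j2 * j3 \<le> 2 * D\<^sup>2 * \<theta> / \<theta>'"
  proof (rule split_product_bound[of S1 S2 S3 J1 J2 J3 "2 * D\<^sup>2 * \<theta> / \<theta>'"])
    show "S1 \<noteq> {}" "S2 \<noteq> {}" "S3 \<noteq> {}" by (rule ne)+
    show "0 < J1 x" if "x \<in> S1" for x using that by (rule J_pos(1))
    show "0 < J2 x" if "x \<in> S2" for x using that by (rule J_pos(2))
    show "0 < J3 x" if "x \<in> S3" for x using that by (rule J_pos(3))
    show "bdd_above (J1 ` S1)" "bdd_above (J2 ` S2)" "bdd_above (J3 ` S3)"
      using bdd_aboveI2[of S1 J1 C1] bdd_aboveI2[of S2 J2 C2] bdd_aboveI2[of S3 J3 C3] J_le(1) J_le(2) J_le(3) by auto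
    fix x1 x2 x3 assume x: "x1 \<in> S1" "x2 \<in> S2" "x3 \<in> S3"
    have "J1 x1 * J2 x2 * J3 x3 * \<theta>' \<le> D\<^sup>2 * \<bar>?d x1 x2 x3\<bar>"
      unfolding key[OF x, symmetric]
      using \<theta>'_le[OF x] J_pos(1)[OF x(1)] J_pos(2)[OF x(2)] J_pos(3)[OF x(3)] by (intro mult_left_mono) auto
    also have "\<dots> \<le> D\<^sup>2 * (2 * \<theta>)" using d_bounds[OF x] by (intro mult_left_mono) auto
    finally show "J1 x1 * J2 x2 * J3 x3 \<le> 2 * D\<^sup>2 * \<theta> / \<theta>'"
      using \<theta>' by (simp add: pos_le_divide_eq mult_ac)
  qed (rule that)
  show ?thesis
    unfolding L2_conv_estimate_def Let_def \<theta>'_def[symmetric]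
  proof (intro ballI)
    fix f g assume f: "f \<in> L2 ?M1'" and g: "g \<in> L2 ?M2'"
    let ?Pf = "A.weighted_pullback f" and ?Pg = "B.weighted_pullback g"
    define K where "K = C * \<theta> powr (- (1/2))"
    obtain t where t: "is_conv_trace ?M1 ?M2 ?M3 ?Pf ?Pg t" "L2_norm ?M3 t \<le> K * L2_norm ?M1 ?Pf * L2_norm ?M2 ?Pg"
      using assms(3) A.weighted_pullback_L2[OF f] B.weighted_pullback_L2[OF g]
      unfolding L2_conv_estimate_def Let_def K_def by blast
    let ?t' = "\<lambda>z. complex_of_real (1 / \<bar>det (matrix T)\<bar>) * t (inv T z)"
    define nf ng where "nf = L2_norm ?M1' f" and "ng = L2_norm ?M2' g"
    have n0: "0 \<le> nf" "0 \<le> ng" by (auto simp: nf_def ng_def L2_norm_nonneg)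
    have Pf: "L2_norm ?M1 ?Pf \<le> sqrt j1 * nf" unfolding nf_def
      by (rule A.L2_norm_weighted_pullback_le) (use j(1) in \<open>simp add: space_surface_measure\<close>)
    have Pg: "L2_norm ?M2 ?Pg \<le> sqrt j2 * ng" unfolding ng_def
      by (rule B.L2_norm_weighted_pullback_le) (use j(2) in \<open>simp add: space_surface_measure\<close>)
    have push: "L2_norm ?M3' (\<lambda>z. t (inv T z)) \<le> sqrt j3 * L2_norm ?M3 t"
      by (rule E.L2_norm_pushforward_le) (use j(3) in \<open>simp add: space_surface_measure\<close>)
    have t': "L2_norm ?M3' ?t' \<le> (1 / D) * (sqrt j3 * L2_norm ?M3 t)"
      unfolding L2_norm_mult using push D by (simp add: D_def norm_divide divide_right_mono)
    have "L2_norm ?M3' ?t' \<le> 2 * C * \<theta>' powr (- (1/2)) * nf * ng"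
    proof (cases "0 \<le> C")
      case True
      then have K: "0 \<le> K" by (simp add: K_def)
      have "K * (L2_norm ?M1 ?Pf * L2_norm ?M2 ?Pg) \<le> K * ((sqrt j1 * nf) * (sqrt j2 * ng))"
        using K Pf Pg n0 j0 by (intro mult_left_mono mult_mono) (auto simp: L2_norm_nonneg)
      then have "L2_norm ?M3 t \<le> K * ((sqrt j1 * nf) * (sqrt j2 * ng))"
        using t(2) by (simp add: mult.assoc)
      then have "(1 / D) * (sqrt j3 * L2_norm ?M3 t) \<le> (1 / D) * (sqrt j3 * (K * ((sqrt j1 * nf) * (sqrt j2 * ng))))"
        using D j0 by (intro mult_left_mono) auto
      also have "\<dots> = (sqrt (j1 * j2 * j3) / D) * K * nf * ng"
        by (simp add: real_sqrt_mult mult_ac)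
      also have "\<dots> \<le> (sqrt (2 * D\<^sup>2 * \<theta> / \<theta>') / D) * K * nf * ng"
        using jB D K n0 by (intro mult_right_mono divide_right_mono) auto
      also have "\<dots> = sqrt 2 * C * \<theta>' powr (- (1/2)) * nf * ng"
        using D \<theta>' par by (simp add: K_def real_sqrt_mult real_sqrt_divide powr_minus powr_half_sqrt field_simps)
      also have "\<dots> \<le> 2 * C * \<theta>' powr (- (1/2)) * nf * ng"
        using True n0 sqrt2_less_2 by (intro mult_right_mono) auto
      finally show ?thesis using t' by linarith
    next
      case False
      then have K: "K < 0" using par by (simp add: K_def mult_less_0_iff)
      let ?p = "L2_norm ?M1 ?Pf * L2_norm ?M2 ?Pg"
      have "0 \<le> K * ?p" using t(2) L2_norm_nonneg[of ?M3 t] by (simp add: mult.assoc)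
      moreover have "0 \<le> ?p" by (simp add: L2_norm_nonneg)
      ultimately have p: "?p = 0" using K by (smt (verit) mult_neg_pos)
      have "L2_norm ?M3 t \<le> K * ?p" using t(2) by (simp only: mult.assoc)
      then have "L2_norm ?M3 t = 0" using p L2_norm_nonneg[of ?M3 t] by (simp only: mult_zero_right antisym)
      then have "L2_norm ?M3' ?t' \<le> 0" using t' by simp
      moreover have "2 * C * \<theta>' powr (- (1/2)) * nf * ng = 0"
      proof -
        have "nf * ng \<le> (sqrt (1 / c1) * L2_norm ?M1 ?Pf) * (sqrt (1 / c2) * L2_norm ?M2 ?Pg)"
          unfolding nf_def ng_def
          by (intro mult_mono A.L2_norm_le_weighted_pullback B.L2_norm_le_weighted_pullback)
             (use A.J(2) B.J(2) in \<open>auto simp: L2_norm_nonneg\<close>)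
        then have "nf * ng \<le> sqrt (1 / c1) * sqrt (1 / c2) * ?p" by (simp only: mult_ac)
        then have "nf * ng \<le> 0" by (simp only: p mult_zero_right)
        then have "nf * ng = 0" using mult_nonneg_nonneg[OF n0] by (rule antisym)
        then show ?thesis by (simp only: mult.assoc mult_zero_right)
      qed
      ultimately show ?thesis by (simp only:)
    qed
    then show "\<exists>t. is_conv_trace ?M1' ?M2' ?M3' f g t \<and>
        L2_norm ?M3' t \<le> 2 * C * \<theta>' powr (- (1/2)) * L2_norm ?M1' f * L2_norm ?M2' g"
      unfolding nf_def ng_def using is_conv_trace_linear_image[OF W1 W2 W3 t(1)] by blast
  qed
qed

end
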